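(* Let $H$ be a hypersurface in $\mathbb{P}^2\times\mathbb{P}^2$ and let $X$ be a nonempty Zariski-open subset of $\mathbb{P}^2$. If $H\cap(X\times \mathbb{P}^2)$ is $(2,2)$-grid-free, then there exists $F(\overline{x},\overline{y})\in\mathbb{C}_{\mathrm{hom}}[\overline{x},\overline{y}]$ of degree $\le 2$ in $\overline{y}$ such that $H\cap(X\times \mathbb{P}^2) = \{F=0\}\cap(X\times \mathbb{P}^2)$.
   Context: $\mathbb{P}^2$ is the complex projective plane. Write $\overline{x}=(x_0,x_1,x_2)$ and $\overline{y}=(y_0,y_1,y_2)$ for the homogeneous coordinates on the first and second factor of $\mathbb{P}^2\times\mathbb{P}^2$. $\mathbb{C}_{\mathrm{hom}}[\overline{x},\overline{y}]$ is the set of polynomials in $\mathbb{C}[\overline{x},\overline{y}]$ that are separately homogeneous in $\overline{x}$ and in $\overline{y}$ (constants are allowed). For $F\in\mathbb{C}_{\mathrm{hom}}[\overline{x},\overline{y}]$, $\{F=0\}$ denotes its zero set in $\mathbb{P}^2\times\mathbb{P}^2$. A hypersurface in $\mathbb{P}^2\times\mathbb{P}^2$ is an algebraic subset of codimension one, i.e. the zero set $\{\tilde F=0\}$ of a nonconstant $\tilde F\in\mathbb{C}_{\mathrm{hom}}[\overline{x},\overline{y}]$. A set $V\subset P_1\times P_2$ contains an $(s,t)$-grid if there exist $S\subset P_1$, $T\subset P_2$ with $|S|=s$, $|T|=t$ and $S\times T\subset V$; otherwise $V$ is $(s,t)$-grid-free. *)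

theory Defs
  imports "HOL-Analysis.Analysis" "HOL-Library.Poly_Mapping"
begin

section \<open>Polynomials in finitely many variables\<close>

text \<open>A monomial is its exponent vector; addition and multiplication of polynomials are
  those of the monoid algebra provided by \<^theory>\<open>HOL-Library.Poly_Mapping\<close>.\<close>

type_synonym 'v cpoly = "('v \<Rightarrow>\<^sub>0 nat) \<Rightarrow>\<^sub>0 complex"

definition poly_eval :: "('v::finite \<Rightarrow> complex) \<Rightarrow> 'v cpoly \<Rightarrow> complex" where
  "poly_eval a F =
     (\<Sum>m\<in>Poly_Mapping.keys F. Poly_Mapping.lookup F m * (\<Prod>v\<in>UNIV. a v ^ Poly_Mapping.lookup m v))"

definition mon_degree_in :: "'v set \<Rightarrow> ('v::finite \<Rightarrow>\<^sub>0 nat) \<Rightarrow> nat" where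
  "mon_degree_in V m = (\<Sum>v\<in>V. Poly_Mapping.lookup m v)"

text \<open>The zero polynomial gets degree 0.\<close>

definition degree_in :: "'v set \<Rightarrow> 'v::finite cpoly \<Rightarrow> nat" where
  "degree_in V F = Max (insert 0 (mon_degree_in V ` Poly_Mapping.keys F))"

text \<open>The zero polynomial is homogeneous (of every degree), and so are all constants.\<close>

definition homogeneous_in :: "'v set \<Rightarrow> 'v::finite cpoly \<Rightarrow> bool" where
  "homogeneous_in V F \<longleftrightarrow> (\<exists>d. \<forall>m\<in>Poly_Mapping.keys F. mon_degree_in V m = d)"

definition constant_poly :: "'v cpoly \<Rightarrow> bool" where
  "constant_poly F \<longleftrightarrow> (\<exists>c. F = Poly_Mapping.single 0 c)"


section \<open>The complex projective plane\<close>

definition proportional :: "complex^3 \<Rightarrow> complex^3 \<Rightarrow> bool" where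
  "proportional v w \<longleftrightarrow> v \<noteq> 0 \<and> w \<noteq> 0 \<and> (\<exists>c. c \<noteq> 0 \<and> w = c *s v)"

lemma part_equivp_proportional: "part_equivp proportional"
proof (rule part_equivpI)
  have "proportional (axis 0 1) (axis 0 1)"
    unfolding proportional_def
    by (auto intro!: exI[of _ 1] simp: axis_eq_0_iff)
  then show "\<exists>v. proportional v v" ..
  show "symp proportional"
  proof (rule sympI)
    fix v w assume "proportional v w"
    then obtain c where c: "v \<noteq> 0" "w \<noteq> 0" "c \<noteq> 0" "w = c *s v"
      unfolding proportional_def by blast
    then have "v = inverse c *s w"
      by (simp add: vector_smult_assoc)
    then show "proportional w v"
      unfolding proportional_def using c(1-3) by (metis inverse_nonzero_iff_nonzero)
  qed
  show "transp proportional"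
  proof (rule transpI)
    fix u v w assume "proportional u v" "proportional v w"
    then obtain c d where "u \<noteq> 0" "w \<noteq> 0" "c \<noteq> 0" "d \<noteq> 0" "v = c *s u" "w = d *s v"
      unfolding proportional_def by blast
    then show "proportional u w"
      unfolding proportional_def
      by (intro conjI exI[of _ "d * c"]) (auto simp: vector_smult_assoc)
  qed
qed

text \<open>\<open>proj v\<close> is the point with homogeneous coordinates \<open>v\<close>; it is meaningful
  only for \<open>v \<noteq> 0\<close>.\<close>

quotient_type p2 = "complex^3" / partial: proportional
  morphisms rep_p2 proj
  by (rule part_equivp_proportional)

lemma proj_eq_iff:
  assumes "v \<noteq> 0" "w \<noteq> 0"
  shows "proj v = proj w \<longleftrightarrow> (\<exists>c. c \<noteq> 0 \<and> w = c *s v)"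
proof -
  have refl: "proportional u u" if "u \<noteq> 0" for u
    using that unfolding proportional_def by (auto intro!: exI[of _ 1])
  have "proj v = proj w \<longleftrightarrow> proportional v w"
    using Quotient3_rel[OF Quotient3_p2, of v w] refl assms by blast
  then show ?thesis
    using assms unfolding proportional_def by blast
qed

lemma p2_cases:
  obtains v where "v \<noteq> 0" "p = proj v"
proof -
  have "proportional (rep_p2 p) (rep_p2 p)" "proj (rep_p2 p) = p"
    using Quotient3_rep_reflp[OF Quotient3_p2] Quotient3_abs_rep[OF Quotient3_p2] by blast+
  then show thesis
    using that unfolding proportional_def by metis
qed

definition zeros_p2 :: "3 cpoly \<Rightarrow> p2 set" where
  "zeros_p2 f = {proj v | v. v \<noteq> 0 \<and> poly_eval (\<lambda>i. v $ i) f = 0}"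

definition zariski_closed :: "p2 set \<Rightarrow> bool" where
  "zariski_closed Z \<longleftrightarrow>
     (\<exists>S. (\<forall>f\<in>S. homogeneous_in UNIV f) \<and> Z = {p. \<forall>f\<in>S. p \<in> zeros_p2 f})"

definition zariski_open :: "p2 set \<Rightarrow> bool" where
  "zariski_open X \<longleftrightarrow> zariski_closed (- X)"


section \<open>Hypersurfaces in the product of two projective planes\<close>

text \<open>The variable \<open>Inl i\<close> is $x_i$ and \<open>Inr i\<close> is $y_i$, where \<open>i :: 3\<close>
  takes the values 0, 1, 2.\<close>

type_synonym xypoly = "(3 + 3) cpoly"

abbreviation x_vars :: "(3 + 3) set" where "x_vars \<equiv> range Inl"
abbreviation y_vars :: "(3 + 3) set" where "y_vars \<equiv> range Inr"

definition eval_xy :: "xypoly \<Rightarrow> complex^3 \<Rightarrow> complex^3 \<Rightarrow> complex" where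
  "eval_xy F v w = poly_eval (case_sum (\<lambda>i. v $ i) (\<lambda>i. w $ i)) F"

definition C_hom :: "xypoly set" where
  "C_hom = {F. homogeneous_in x_vars F \<and> homogeneous_in y_vars F}"

definition zeros_p2p2 :: "xypoly \<Rightarrow> (p2 \<times> p2) set" where
  "zeros_p2p2 F = {(proj v, proj w) | v w. v \<noteq> 0 \<and> w \<noteq> 0 \<and> eval_xy F v w = 0}"

definition hypersurface :: "(p2 \<times> p2) set \<Rightarrow> bool" where
  "hypersurface H \<longleftrightarrow> (\<exists>F\<in>C_hom. \<not> constant_poly F \<and> H = zeros_p2p2 F)"


section \<open>Independence of the representatives\<close>

text \<open>For homogeneous polynomials, membership in a zero set can be tested on any choice of
  homogeneous coordinates.\<close>

lemma poly_eval_scale: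
  assumes "\<forall>m\<in>Poly_Mapping.keys F. mon_degree_in V m = d"
  shows "poly_eval (\<lambda>v. if v \<in> V then c * a v else a v) F = c ^ d * poly_eval a F"
proof -
  have "(\<Prod>v\<in>UNIV. (if v \<in> V then c * a v else a v) ^ Poly_Mapping.lookup m v)
      = c ^ d * (\<Prod>v\<in>UNIV. a v ^ Poly_Mapping.lookup m v)" if "m \<in> Poly_Mapping.keys F" for m
  proof -
    have "(\<Prod>v\<in>UNIV. (if v \<in> V then c * a v else a v) ^ Poly_Mapping.lookup m v)
        = (\<Prod>v\<in>UNIV. (if v \<in> V then c ^ Poly_Mapping.lookup m v else 1) * a v ^ Poly_Mapping.lookup m v)"
      by (intro prod.cong) (auto simp: power_mult_distrib)
    also have "\<dots> = (\<Prod>v\<in>V. c ^ Poly_Mapping.lookup m v) * (\<Prod>v\<in>UNIV. a v ^ Poly_Mapping.lookup m v)"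
      by (simp add: prod.distrib prod.If_cases)
    also have "(\<Prod>v\<in>V. c ^ Poly_Mapping.lookup m v) = c ^ d"
      using assms that by (simp add: mon_degree_in_def flip: power_sum)
    finally show ?thesis .
  qed
  then show ?thesis
    unfolding poly_eval_def sum_distrib_left
    by (intro sum.cong) (auto simp: mult_ac)
qed

lemma proj_in_zeros_p2_iff:
  assumes "homogeneous_in UNIV f" "v \<noteq> 0"
  shows "proj v \<in> zeros_p2 f \<longleftrightarrow> poly_eval (\<lambda>i. v $ i) f = 0"
proof
  obtain d where d: "\<forall>m\<in>Poly_Mapping.keys f. mon_degree_in UNIV m = d"
    using assms(1) unfolding homogeneous_in_def by blast
  assume "proj v \<in> zeros_p2 f"
  then obtain u where u: "u \<noteq> 0" "proj u = proj v" "poly_eval (\<lambda>i. u $ i) f = 0"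
    unfolding zeros_p2_def by auto
  then obtain c where "v = c *s u"
    using proj_eq_iff assms(2) by blast
  then show "poly_eval (\<lambda>i. v $ i) f = 0"
    using poly_eval_scale[OF d, of c "\<lambda>i. u $ i"] u(3) by simp
qed (use assms in \<open>auto simp: zeros_p2_def\<close>)

lemma proj_in_zeros_p2p2_iff:
  assumes "F \<in> C_hom" "v \<noteq> 0" "w \<noteq> 0"
  shows "(proj v, proj w) \<in> zeros_p2p2 F \<longleftrightarrow> eval_xy F v w = 0"
proof
  obtain d e where
    d: "\<forall>m\<in>Poly_Mapping.keys F. mon_degree_in x_vars m = d" and
    e: "\<forall>m\<in>Poly_Mapping.keys F. mon_degree_in y_vars m = e"
    using assms(1) unfolding C_hom_def homogeneous_in_def by blast
  assume "(proj v, proj w) \<in> zeros_p2p2 F"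
  then obtain v' w' where vw': "v' \<noteq> 0" "w' \<noteq> 0" "proj v' = proj v" "proj w' = proj w"
      "eval_xy F v' w' = 0"
    unfolding zeros_p2p2_def by auto
  then obtain b c where bc: "v = b *s v'" "w = c *s w'"
    using proj_eq_iff assms(2,3) by metis
  have x: "case_sum (\<lambda>i. v $ i) (\<lambda>i. w' $ i)
      = (\<lambda>k. if k \<in> x_vars then b * case_sum (\<lambda>i. v' $ i) (\<lambda>i. w' $ i) k
              else case_sum (\<lambda>i. v' $ i) (\<lambda>i. w' $ i) k)"
    by (rule ext) (auto simp: bc split: sum.splits)
  have y: "case_sum (\<lambda>i. v $ i) (\<lambda>i. w $ i)
      = (\<lambda>k. if k \<in> y_vars then c * case_sum (\<lambda>i. v $ i) (\<lambda>i. w' $ i) k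
              else case_sum (\<lambda>i. v $ i) (\<lambda>i. w' $ i) k)"
    by (rule ext) (auto simp: bc split: sum.splits)
  have "eval_xy F v w' = b ^ d * eval_xy F v' w'"
    unfolding eval_xy_def x by (rule poly_eval_scale[OF d])
  moreover have "eval_xy F v w = c ^ e * eval_xy F v w'"
    unfolding eval_xy_def y by (rule poly_eval_scale[OF e])
  ultimately show "eval_xy F v w = 0"
    using vw'(5) by simp
qed (use assms in \<open>auto simp: zeros_p2p2_def\<close>)


section \<open>Grids\<close>

text \<open>Finiteness is required explicitly because \<^const>\<open>card\<close> is 0 on infinite sets.\<close>

definition contains_grid :: "nat \<Rightarrow> nat \<Rightarrow> ('a \<times> 'b) set \<Rightarrow> bool" where
  "contains_grid s t V \<longleftrightarrow>
     (\<exists>S T. finite S \<and> card S = s \<and> finite T \<and> card T = t \<and> S \<times> T \<subseteq> V)"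

abbreviation grid_free :: "nat \<Rightarrow> nat \<Rightarrow> ('a \<times> 'b) set \<Rightarrow> bool" where
  "grid_free s t V \<equiv> \<not> contains_grid s t V"

end

theory Submission
  imports Defs "HOL-Complex_Analysis.Complex_Analysis" "HOL-Computational_Algebra.Field_as_Ring"
    "HOL-Computational_Algebra.Polynomial_Factorial" "HOL-Computational_Algebra.Polynomial_FPS"
    "HOL-Computational_Algebra.Fundamental_Theorem_Algebra"
begin

text \<open>
  Let \<open>f x y\<close> define the hypersurface, of degree \<open>e > 0\<close> in \<open>y\<close>. Then every curve \<open>f x = 0\<close> is a line with
  multiplicity \<open>e\<close>, so even an equation that is linear in \<open>y\<close> exists. To see this, project from a point \<open>Q\<close>
  and let \<open>m\<close> be the smallest multiplicity of a zero of \<open>f x\<close> on a line through \<open>Q\<close>, over all \<open>x\<close> in \<open>X\<close>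
  with \<open>f x Q \<noteq> 0\<close>. Near a zero of multiplicity \<open>m\<close> the curves are graphs depending holomorphically on \<open>x\<close>.
  Two curves never meet twice, so the parameter \<open>T u\<close> at which a line of parameters yields a curve through
  the point over \<open>u\<close> of another curve is an injective holomorphic function of \<open>u\<close>; hence its derivative does
  not vanish, which means that the two curves through a point can be chosen transversal there. Their only common
  point then has intersection multiplicity \<open>m\<^sup>2\<close>, and Bezout's theorem gives \<open>m = e\<close>.

  The coefficients of the linear equations obtained from different \<open>Q\<close> are parallel, and unique factorization
  provides a parallel triple of homogeneous polynomials without common zeros on \<open>X\<close>.
\<close>

text \<open>The obstacle is that a zero of multiplicity \<open>m > 1\<close> has no implicit
  function: the derivative of \<open>f x\<close> in the direction \<open>Q\<close> vanishes there.
  But when \<open>m\<close> is the smallest multiplicity, every zero of \<open>f x\<close> is also a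
  zero of the Taylor coefficient \<open>c (m - 1)\<close> along \<open>Q\<close>, and a zero of
  multiplicity exactly \<open>m\<close> is a simple zero of it. So uniqueness, Lipschitz bounds and
  derivatives come from \<open>c (m - 1)\<close>, while existence of nearby zeros comes from
  \<open>f\<close> by a Hurwitz argument. Several variables are handled by exact difference formulas
  with continuous coefficients, and holomorphy is used in one variable at a time. Bezout's theorem
  appears as the growth of a resultant, written as a product over roots: the line through
  \<open>Q\<close> and the common point is put at infinity, and an entire function without zeros
  cannot tend to infinity. A single \<open>Q\<close> need not satisfy
  \<open>f x Q \<noteq> 0\<close> for all \<open>x\<close> in \<open>X\<close>, hence the gluing of
  linear equations at the end.\<close>

no_notation fps_nth (infixl "$" 75)

subsection \<open>Bihomogeneous polynomial functions\<close>

text \<open>Generating the functions by rules, instead of describing coefficients, lets continuity,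
  holomorphy, Taylor expansion and difference formulas be proved by induction. The zero function has
  every bidegree, so vanishing coefficients need no exceptions.\<close>

inductive bihom :: "nat \<Rightarrow> nat \<Rightarrow> (complex^3 \<Rightarrow> complex^3 \<Rightarrow> complex) \<Rightarrow> bool" where
  zero: "bihom d e (\<lambda>x y. 0)"
| const: "bihom 0 0 (\<lambda>x y. c)"
| add: "bihom d e f \<Longrightarrow> bihom d e g \<Longrightarrow> bihom d e (\<lambda>x y. f x y + g x y)"
| multX: "bihom d e f \<Longrightarrow> bihom (Suc d) e (\<lambda>x y. x $ i * f x y)"
| multY: "bihom d e f \<Longrightarrow> bihom d (Suc e) (\<lambda>x y. y $ i * f x y)"

lemma bihom_sum:
  assumes "\<And>i. i \<in> A \<Longrightarrow> bihom d e (f i)"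
  shows "bihom d e (\<lambda>x y. \<Sum>i\<in>A. f i x y)"
  using assms by (induction A rule: infinite_finite_induct) (simp_all add: bihom.zero bihom.add)

lemma bihom_cmult: "bihom d e f \<Longrightarrow> bihom d e (\<lambda>x y. c * f x y)"
proof (induction rule: bihom.induct)
  case (multX d e f i)
  then show ?case using bihom.multX[OF multX.IH, of i] by (simp add: mult.left_commute)
next
  case (multY d e f i)
  then show ?case using bihom.multY[OF multY.IH, of i] by (simp add: mult.left_commute)
qed (simp_all add: distrib_left bihom.zero bihom.const bihom.add)

lemma bihom_mult:
  assumes "bihom d e f" "bihom d' e' g" shows "bihom (d + d') (e + e') (\<lambda>x y. f x y * g x y)"
  using assms(1)
proof (induction rule: bihom.induct)
  case (multX d e f i)
  then show ?case using bihom.multX[OF multX.IH, of i] by (simp add: mult_ac)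
next
  case (multY d e f i)
  then show ?case using bihom.multY[OF multY.IH, of i] by (simp add: mult_ac)
qed (simp_all add: distrib_right bihom.zero bihom.add bihom_cmult assms(2))

lemma bihom_powerX: "bihom k 0 (\<lambda>x y. x $ i ^ k)"
  by (induction k) (simp_all add: bihom.const bihom.multX)

lemma bihom_powerY: "bihom 0 k (\<lambda>x y. y $ i ^ k)"
  by (induction k) (simp_all add: bihom.const bihom.multY)

lemma bihom_prodX: "finite A \<Longrightarrow> bihom (\<Sum>i\<in>A. k i) 0 (\<lambda>x y. \<Prod>i\<in>A. x $ i ^ k i)"
proof (induction A rule: finite_induct)
  case empty
  show ?case by (simp add: bihom.const)
next
  case (insert j A)
  then show ?case using bihom_mult[OF bihom_powerX[of "k j" j] insert.IH] by simp
qed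

lemma bihom_prodY: "finite A \<Longrightarrow> bihom 0 (\<Sum>i\<in>A. k i) (\<lambda>x y. \<Prod>i\<in>A. y $ i ^ k i)"
proof (induction A rule: finite_induct)
  case empty
  show ?case by (simp add: bihom.const)
next
  case (insert j A)
  then show ?case using bihom_mult[OF bihom_powerY[of "k j" j] insert.IH] by simp
qed

section \<open>Passage between formal polynomials and bihomogeneous functions\<close>

definition has_bidegree :: "nat \<Rightarrow> nat \<Rightarrow> xypoly \<Rightarrow> bool" where
  "has_bidegree d e F \<longleftrightarrow>
     (\<forall>m\<in>Poly_Mapping.keys F. mon_degree_in x_vars m = d \<and> mon_degree_in y_vars m = e)"

lemma prod_UNIV_sum:
  fixes g :: "'a::finite + 'b::finite \<Rightarrow> complex"
  shows "(\<Prod>v\<in>UNIV. g v) = (\<Prod>i\<in>UNIV. g (Inl i)) * (\<Prod>i\<in>UNIV. g (Inr i))"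
proof -
  have "(\<Prod>v\<in>UNIV. g v) = (\<Prod>v\<in>range Inl \<union> range Inr. g v)"
    by (simp flip: UNIV_sum)
  also have "\<dots> = (\<Prod>v\<in>range Inl. g v) * (\<Prod>v\<in>range Inr. g v)"
    by (rule prod.union_disjoint) auto
  finally show ?thesis by (simp add: prod.reindex)
qed

lemma eval_xy_altdef:
  "eval_xy F x y = (\<Sum>m\<in>Poly_Mapping.keys F. Poly_Mapping.lookup F m *
     ((\<Prod>i\<in>UNIV. x $ i ^ Poly_Mapping.lookup m (Inl i)) * (\<Prod>i\<in>UNIV. y $ i ^ Poly_Mapping.lookup m (Inr i))))"
  unfolding eval_xy_def poly_eval_def by (simp add: prod_UNIV_sum)

lemma bihom_eval_xy:
  assumes "has_bidegree d e F" shows "bihom d e (eval_xy F)"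
proof -
  have "bihom d e (\<lambda>x y. Poly_Mapping.lookup F m *
     ((\<Prod>i\<in>UNIV. x $ i ^ Poly_Mapping.lookup m (Inl i)) * (\<Prod>i\<in>UNIV. y $ i ^ Poly_Mapping.lookup m (Inr i))))"
    if "m \<in> Poly_Mapping.keys F" for m
  proof -
    have "(\<Sum>i\<in>UNIV. Poly_Mapping.lookup m (Inl i)) = d" "(\<Sum>i\<in>UNIV. Poly_Mapping.lookup m (Inr i)) = e"
      using assms that unfolding has_bidegree_def mon_degree_in_def by (simp_all add: sum.reindex)
    then show ?thesis
      using bihom_mult[OF bihom_prodX[of UNIV "\<lambda>i. Poly_Mapping.lookup m (Inl i)"] bihom_prodY[of UNIV "\<lambda>i. Poly_Mapping.lookup m (Inr i)"]]
      by (intro bihom_cmult) simp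
  qed
  then have "bihom d e (\<lambda>x y. eval_xy F x y)"
    unfolding eval_xy_altdef by (rule bihom_sum)
  then show ?thesis by simp
qed

lemma poly_eval_superset:
  assumes "finite K" "Poly_Mapping.keys F \<subseteq> K"
  shows "poly_eval a F = (\<Sum>m\<in>K. Poly_Mapping.lookup F m * (\<Prod>v\<in>UNIV. a v ^ Poly_Mapping.lookup m v))"
  unfolding poly_eval_def using assms by (intro sum.mono_neutral_left) (auto simp: in_keys_iff)

lemma poly_eval_add: "poly_eval a (F + G) = poly_eval a F + poly_eval a G"
proof -
  let ?K = "Poly_Mapping.keys F \<union> Poly_Mapping.keys G"
  have "Poly_Mapping.keys (F + G) \<subseteq> ?K" by (rule Poly_Mapping.keys_add)
  then show ?thesis
    by (subst (1 2 3) poly_eval_superset[of ?K]) (auto simp: lookup_add distrib_right sum.distrib)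
qed

lemma poly_eval_sum: "finite A \<Longrightarrow> poly_eval a (\<Sum>i\<in>A. F i) = (\<Sum>i\<in>A. poly_eval a (F i))"
proof (induction A rule: finite_induct)
  case empty
  show ?case by (simp add: poly_eval_def)
qed (simp add: poly_eval_add)

lemma poly_eval_single:
  "poly_eval a (Poly_Mapping.single m c) = c * (\<Prod>v\<in>UNIV. a v ^ Poly_Mapping.lookup m v)"
  by (subst poly_eval_superset[of "{m}"]) auto

lemma has_bidegree_add: "has_bidegree d e F \<Longrightarrow> has_bidegree d e G \<Longrightarrow> has_bidegree d e (F + G)"
  unfolding has_bidegree_def using Poly_Mapping.keys_add[of F G] by blast

lemma has_bidegree_sum:
  "(\<And>i. i \<in> A \<Longrightarrow> has_bidegree d e (F i)) \<Longrightarrow> has_bidegree d e (\<Sum>i\<in>A. F i)"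
proof (induction A rule: infinite_finite_induct)
  case (insert i A)
  then show ?case by (simp add: has_bidegree_add)
qed (simp_all add: has_bidegree_def)

lemma poly_eval_mult_var:
  fixes F :: "'v::finite cpoly" and v :: 'v
  defines "G \<equiv> \<Sum>m\<in>Poly_Mapping.keys F. Poly_Mapping.single (m + Poly_Mapping.single v 1) (Poly_Mapping.lookup F m)"
  shows "poly_eval a G = a v * poly_eval a F"
proof -
  have "(\<Prod>u\<in>UNIV. a u ^ Poly_Mapping.lookup (m + Poly_Mapping.single v 1) u) =
      a v * (\<Prod>u\<in>UNIV. a u ^ Poly_Mapping.lookup m u)" for m
  proof -
    have "(\<Prod>u\<in>UNIV. a u ^ Poly_Mapping.lookup (m + Poly_Mapping.single v 1) u) =
      (\<Prod>u\<in>UNIV. (if u = v then a v else 1) * a u ^ Poly_Mapping.lookup m u)"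
      by (rule prod.cong) (auto simp: lookup_add lookup_single when_def)
    then show ?thesis by (simp add: prod.distrib)
  qed
  then show ?thesis
    unfolding G_def poly_eval_sum[OF Poly_Mapping.finite_keys] poly_eval_single
    by (simp add: poly_eval_def sum_distrib_left mult_ac)
qed

text \<open>The linear equation is found as a function; this turns it back into the formal
  polynomial that the theorem asks for. Multiplication by a variable is a shift of the exponents by
  a unit vector.\<close>

lemma bihom_imp_poly:
  assumes "bihom d e f" shows "\<exists>F. has_bidegree d e F \<and> eval_xy F = f"
  using assms
proof (induction rule: bihom.induct)
  case (zero d e)
  have "has_bidegree d e 0" "eval_xy 0 = (\<lambda>x y. 0)"
    by (auto simp: has_bidegree_def eval_xy_def poly_eval_def fun_eq_iff)
  then show ?case by blast
next
  case (const c)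
  have "has_bidegree 0 0 (Poly_Mapping.single 0 c)" "eval_xy (Poly_Mapping.single 0 c) = (\<lambda>x y. c)"
    by (auto simp: has_bidegree_def eval_xy_def poly_eval_single mon_degree_in_def fun_eq_iff)
  then show ?case by blast
next
  case (add d e f g)
  then obtain F G where FG: "has_bidegree d e F" "eval_xy F = f" "has_bidegree d e G" "eval_xy G = g" by blast
  have "eval_xy (F + G) = (\<lambda>x y. f x y + g x y)"
    unfolding FG(2,4)[symmetric] eval_xy_def poly_eval_add by simp
  then show ?case using has_bidegree_add[OF FG(1,3)] by blast
next
  case (multX d e f i)
  then obtain F where F: "has_bidegree d e F" "eval_xy F = f" by blast
  let ?G = "\<Sum>m\<in>Poly_Mapping.keys F. Poly_Mapping.single (m + Poly_Mapping.single (Inl i) 1) (Poly_Mapping.lookup F m)"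
  have "has_bidegree (Suc d) e ?G"
  proof (rule has_bidegree_sum)
    fix m assume "m \<in> Poly_Mapping.keys F"
    then show "has_bidegree (Suc d) e (Poly_Mapping.single (m + Poly_Mapping.single (Inl i) 1) (Poly_Mapping.lookup F m))"
      using F(1) unfolding has_bidegree_def mon_degree_in_def
      by (auto simp: lookup_add sum.distrib lookup_single when_def sum.reindex)
  qed
  moreover have "eval_xy ?G = (\<lambda>x y. x $ i * f x y)"
    unfolding F(2)[symmetric] eval_xy_def poly_eval_mult_var by simp
  ultimately show ?case by blast
next
  case (multY d e f i)
  then obtain F where F: "has_bidegree d e F" "eval_xy F = f" by blast
  let ?G = "\<Sum>m\<in>Poly_Mapping.keys F. Poly_Mapping.single (m + Poly_Mapping.single (Inr i) 1) (Poly_Mapping.lookup F m)"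
  have "has_bidegree d (Suc e) ?G"
  proof (rule has_bidegree_sum)
    fix m assume "m \<in> Poly_Mapping.keys F"
    then show "has_bidegree d (Suc e) (Poly_Mapping.single (m + Poly_Mapping.single (Inr i) 1) (Poly_Mapping.lookup F m))"
      using F(1) unfolding has_bidegree_def mon_degree_in_def
      by (auto simp: lookup_add sum.distrib lookup_single when_def sum.reindex)
  qed
  moreover have "eval_xy ?G = (\<lambda>x y. y $ i * f x y)"
    unfolding F(2)[symmetric] eval_xy_def poly_eval_mult_var by simp
  ultimately show ?case by blast
qed

lemma bihom_scaleX: "bihom d e f \<Longrightarrow> f (c *s x) y = c ^ d * f x y"
  by (induction rule: bihom.induct) (auto simp: distrib_left)

lemma bihom_scaleY: "bihom d e f \<Longrightarrow> f x (c *s y) = c ^ e * f x y"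
  by (induction rule: bihom.induct) (auto simp: distrib_left)

lemma bihom_continuous:
  fixes g h :: "'a::topological_space \<Rightarrow> complex^3"
  assumes "bihom d e f" "continuous_on S g" "continuous_on S h"
  shows "continuous_on S (\<lambda>z. f (g z) (h z))"
  using assms(1)
proof (induction rule: bihom.induct)
  case (multX d e f i)
  show ?case by (intro continuous_intros multX.IH assms(2))
next
  case (multY d e f i)
  show ?case by (intro continuous_intros multY.IH assms(3))
qed (simp_all add: continuous_on_add)

lemma bihom_holomorphic:
  fixes g h :: "complex \<Rightarrow> complex^3"
  assumes "bihom d e f" "\<And>i. (\<lambda>z. g z $ i) holomorphic_on S" "\<And>i. (\<lambda>z. h z $ i) holomorphic_on S"
  shows "(\<lambda>z. f (g z) (h z)) holomorphic_on S"
  using assms(1)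
proof (induction rule: bihom.induct)
  case (multX d e f i)
  show ?case by (intro holomorphic_intros multX.IH assms(2))
next
  case (multY d e f i)
  show ?case by (intro holomorphic_intros multY.IH assms(3))
qed (simp_all add: holomorphic_on_add)

section \<open>The bilinear pairing, exact difference formulas and Taylor expansion\<close>

definition cdot :: "complex^3 \<Rightarrow> complex^3 \<Rightarrow> complex" where
  "cdot u v = (\<Sum>i\<in>UNIV. u $ i * v $ i)"

lemma cdot_0 [simp]: "cdot u 0 = 0" "cdot 0 u = 0"
  by (simp_all add: cdot_def)

lemma cdot_add [simp]: "cdot u (v + w) = cdot u v + cdot u w" "cdot (v + w) u = cdot v u + cdot w u"
  by (simp_all add: cdot_def sum.distrib distrib_left distrib_right)

lemma cdot_diff [simp]: "cdot u (v - w) = cdot u v - cdot u w"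
  by (simp_all add: cdot_def sum_subtractf right_diff_distrib)

lemma cdot_scale [simp]: "cdot u (c *s v) = c * cdot u v" "cdot (c *s u) v = c * cdot u v"
  by (simp_all add: cdot_def sum_distrib_left mult_ac)

lemma cdot_axis [simp]: "cdot (axis i 1) v = v $ i" "cdot u (axis i 1) = u $ i"
  by (simp_all add: cdot_def axis_def if_distrib[of "\<lambda>z. z * _"] if_distrib[of "\<lambda>z. _ * z"] cong: if_cong)

lemma continuous_on_cdot [continuous_intros]:
  "continuous_on S f \<Longrightarrow> continuous_on S g \<Longrightarrow> continuous_on S (\<lambda>z. cdot (f z) (g z))"
  unfolding cdot_def by (intro continuous_intros)

lemma continuous_on_vsmult [continuous_intros]:
  fixes f :: "'a::topological_space \<Rightarrow> complex" and g :: "'a \<Rightarrow> complex^3"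
  shows "continuous_on S f \<Longrightarrow> continuous_on S g \<Longrightarrow> continuous_on S (\<lambda>z. f z *s g z)"
  unfolding vector_scalar_mult_def by (intro continuous_intros)

text \<open>A Hadamard factorization: on the diagonal \<open>A\<close> and \<open>B\<close> are the
  gradients in \<open>x\<close> and \<open>y\<close>. As an exact formula for increments it gives
  Lipschitz bounds and implicit derivatives without a remainder term.\<close>

definition difference_factors ::
    "(complex^3 \<Rightarrow> complex^3 \<Rightarrow> complex) \<Rightarrow> ((complex^3) \<times> (complex^3) \<times> (complex^3) \<times> (complex^3) \<Rightarrow> complex^3)
      \<Rightarrow> ((complex^3) \<times> (complex^3) \<times> (complex^3) \<times> (complex^3) \<Rightarrow> complex^3) \<Rightarrow> bool" where
  "difference_factors f A B \<longleftrightarrow> continuous_on UNIV A \<and> continuous_on UNIV B \<and>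
     (\<forall>x y x' y'. f x' y' - f x y = cdot (A (x, y, x', y')) (x' - x) + cdot (B (x, y, x', y')) (y' - y))"

lemma difference_factorsD:
  assumes "difference_factors f A B"
  shows "continuous_on UNIV A" "continuous_on UNIV B"
    "f x' y' - f x y = cdot (A (x, y, x', y')) (x' - x) + cdot (B (x, y, x', y')) (y' - y)"
proof -
  note * = assms[unfolded difference_factors_def]
  show "continuous_on UNIV A" by (rule *[THEN conjunct1])
  show "continuous_on UNIV B" by (rule *[THEN conjunct2, THEN conjunct1])
  show "f x' y' - f x y = cdot (A (x, y, x', y')) (x' - x) + cdot (B (x, y, x', y')) (y' - y)"
    by (rule *[THEN conjunct2, THEN conjunct2, rule_format])
qed

lemma difference_factors_add:
  assumes "difference_factors f A B" "difference_factors g A' B'"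
  shows "difference_factors (\<lambda>x y. f x y + g x y) (\<lambda>z. A z + A' z) (\<lambda>z. B z + B' z)"
  unfolding difference_factors_def
proof (intro conjI allI)
  fix x y x' y'
  show "f x' y' + g x' y' - (f x y + g x y) = cdot (A (x, y, x', y') + A' (x, y, x', y')) (x' - x)
         + cdot (B (x, y, x', y') + B' (x, y, x', y')) (y' - y)"
    unfolding cdot_add(2) add_diff_add difference_factorsD(3)[OF assms(1), of x' y' x y]
      difference_factorsD(3)[OF assms(2), of x' y' x y] by (simp only: add_ac)
qed (intro continuous_intros difference_factorsD[OF assms(1)] difference_factorsD[OF assms(2)])+

text \<open>Discrete product rule: the coordinate moves while \<open>f\<close> is taken at the new
  point, then \<open>f\<close> moves while the coordinate stays at the old one.\<close>

lemma difference_factors_multX: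
  assumes "difference_factors f A B" "bihom d e f"
  shows "difference_factors (\<lambda>x y. x $ i * f x y)
    (\<lambda>z. f (fst (snd (snd z))) (snd (snd (snd z))) *s axis i 1 + fst z $ i *s A z) (\<lambda>z. fst z $ i *s B z)"
  unfolding difference_factors_def
proof (intro conjI allI)
  fix x y x' y'
  have "x' $ i * f x' y' - x $ i * f x y = f x' y' * (x' - x) $ i + x $ i * (f x' y' - f x y)"
    by (simp add: algebra_simps)
  then show "x' $ i * f x' y' - x $ i * f x y =
      cdot (f (fst (snd (snd (x, y, x', y')))) (snd (snd (snd (x, y, x', y')))) *s axis i 1 + fst (x, y, x', y') $ i *s A (x, y, x', y')) (x' - x)
      + cdot (fst (x, y, x', y') $ i *s B (x, y, x', y')) (y' - y)"
    unfolding difference_factorsD(3)[OF assms(1), of x' y' x y] fst_conv snd_conv cdot_add(2) cdot_scale(2) cdot_axis(1)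
    by (simp only: distrib_left distrib_right mult_ac add_ac)
qed (intro continuous_intros difference_factorsD[OF assms(1)] bihom_continuous[OF assms(2)])+

lemma difference_factors_multY:
  assumes "difference_factors f A B" "bihom d e f"
  shows "difference_factors (\<lambda>x y. y $ i * f x y) (\<lambda>z. fst (snd z) $ i *s A z)
    (\<lambda>z. f (fst (snd (snd z))) (snd (snd (snd z))) *s axis i 1 + fst (snd z) $ i *s B z)"
  unfolding difference_factors_def
proof (intro conjI allI)
  fix x y x' y'
  have "y' $ i * f x' y' - y $ i * f x y = f x' y' * (y' - y) $ i + y $ i * (f x' y' - f x y)"
    by (simp add: algebra_simps)
  then show "y' $ i * f x' y' - y $ i * f x y =
      cdot (fst (snd (x, y, x', y')) $ i *s A (x, y, x', y')) (x' - x) +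
      cdot (f (fst (snd (snd (x, y, x', y')))) (snd (snd (snd (x, y, x', y')))) *s axis i 1 + fst (snd (x, y, x', y')) $ i *s B (x, y, x', y')) (y' - y)"
    unfolding difference_factorsD(3)[OF assms(1), of x' y' x y] fst_conv snd_conv cdot_add(2) cdot_scale(2) cdot_axis(1)
    by (simp only: distrib_left distrib_right mult_ac add_ac)
qed (intro continuous_intros difference_factorsD[OF assms(1)] bihom_continuous[OF assms(2)])+

lemma bihom_difference_factors:
  assumes "bihom d e f"
  shows "\<exists>A B. difference_factors f A B"
  using assms
proof (induction rule: bihom.induct)
  case (zero d e)
  have "difference_factors (\<lambda>x y. 0) (\<lambda>_. 0) (\<lambda>_. 0)" by (simp add: difference_factors_def)
  then show ?case by (intro exI)
next
  case (const c)
  have "difference_factors (\<lambda>x y. c) (\<lambda>_. 0) (\<lambda>_. 0)" by (simp add: difference_factors_def)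
  then show ?case by (intro exI)
next
  case (add d e f g)
  then show ?case by (elim exE) (intro exI, rule difference_factors_add)
next
  case (multX d e f i)
  then show ?case by (elim exE) (intro exI, rule difference_factors_multX)
next
  case (multY d e f i)
  then show ?case by (elim exE) (intro exI, rule difference_factors_multY)
qed

text \<open>The coefficient of \<open>t ^ e\<close> does not depend on \<open>y\<close>. So as soon
  as \<open>f x Q\<close> is nonzero, all lines in the direction \<open>Q\<close> carry the same
  number \<open>e\<close> of zeros, counted with multiplicity.\<close>

lemma bihom_Taylor:
  assumes "bihom d e f"
  obtains c where "\<And>j. j \<le> e \<Longrightarrow> bihom d (e - j) (c j)" "\<And>x y. c e x y = f x Q"
    "\<And>x y t. f x (y + t *s Q) = (\<Sum>j\<le>e. c j x y * t ^ j)"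
proof -
  have "\<exists>c. (\<forall>j\<le>e. bihom d (e - j) (c j)) \<and> (\<forall>x y. c e x y = f x Q) \<and>
     (\<forall>x y t. f x (y + t *s Q) = (\<Sum>j\<le>e. c j x y * t ^ j))"
    using assms
  proof (induction rule: bihom.induct)
    case (zero d e)
    show ?case by (rule exI[of _ "\<lambda>_ _ _. 0"]) (simp add: bihom.zero)
  next
    case (const c)
    show ?case by (rule exI[of _ "\<lambda>_ _ _. c"]) (simp add: bihom.const)
  next
    case (add d e f g)
    from add.IH(1) obtain a where "\<forall>j\<le>e. bihom d (e - j) (a j)" "\<forall>x y. a e x y = f x Q"
       "\<forall>x y t. f x (y + t *s Q) = (\<Sum>j\<le>e. a j x y * t ^ j)" by blast
    moreover from add.IH(2) obtain b where "\<forall>j\<le>e. bihom d (e - j) (b j)" "\<forall>x y. b e x y = g x Q"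
       "\<forall>x y t. g x (y + t *s Q) = (\<Sum>j\<le>e. b j x y * t ^ j)" by blast
    ultimately show ?case
      by (intro exI[of _ "\<lambda>j x y. a j x y + b j x y"]) (simp add: bihom.add sum.distrib distrib_right)
  next
    case (multX d e f i)
    then obtain a where "\<forall>j\<le>e. bihom d (e - j) (a j)" "\<forall>x y. a e x y = f x Q"
       "\<forall>x y t. f x (y + t *s Q) = (\<Sum>j\<le>e. a j x y * t ^ j)" by blast
    then show ?case
      by (intro exI[of _ "\<lambda>j x y. x $ i * a j x y"]) (simp add: bihom.multX sum_distrib_left mult.assoc)
  next
    case (multY d e f i)
    then obtain a where a: "\<forall>j\<le>e. bihom d (e - j) (a j)" "\<forall>x y. a e x y = f x Q"
       "\<forall>x y t. f x (y + t *s Q) = (\<Sum>j\<le>e. a j x y * t ^ j)" by blast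
    \<comment> \<open>The expansion of \<open>f\<close> multiplied by
      \<open>y $ i + t * Q $ i\<close>. The guard cuts off \<open>a j\<close> for
      \<open>j > e\<close>, about which nothing is known.\<close>
    define b where "b = (\<lambda>j x y. (if j \<le> e then y $ i * a j x y else 0) +
        (case j of 0 \<Rightarrow> 0 | Suc j' \<Rightarrow> Q $ i * a j' x y))"
    have "bihom d (Suc e - j) (b j)" if "j \<le> Suc e" for j
    proof -
      have 1: "bihom d (Suc e - j) (\<lambda>x y. if j \<le> e then y $ i * a j x y else 0)"
        using a(1) by (cases "j \<le> e") (simp_all add: Suc_diff_le bihom.multY bihom.zero)
      have 2: "bihom d (Suc e - j) (\<lambda>x y. case j of 0 \<Rightarrow> 0 | Suc j' \<Rightarrow> Q $ i * a j' x y)"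
        using a(1) that by (cases j) (simp_all add: bihom.zero bihom_cmult)
      show ?thesis unfolding b_def by (intro bihom.add 1 2)
    qed
    moreover have "b (Suc e) x y = Q $ i * f x Q" for x y
      using a(2) by (simp add: b_def)
    moreover have "(y + t *s Q) $ i * f x (y + t *s Q) = (\<Sum>j\<le>Suc e. b j x y * t ^ j)" for x y t
    proof -
      have "(\<Sum>j\<le>Suc e. b j x y * t ^ j) = (\<Sum>j\<le>Suc e. (if j \<le> e then y $ i * a j x y else 0) * t ^ j)
           + (\<Sum>j\<le>Suc e. (case j of 0 \<Rightarrow> 0 | Suc j' \<Rightarrow> Q $ i * a j' x y) * t ^ j)"
        unfolding b_def by (simp add: distrib_right sum.distrib)
      also have "(\<Sum>j\<le>Suc e. (if j \<le> e then y $ i * a j x y else 0) * t ^ j) = y $ i * f x (y + t *s Q)"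
        using a(3) by (simp add: sum_distrib_left mult_ac)
      also have "(\<Sum>j\<le>Suc e. (case j of 0 \<Rightarrow> 0 | Suc j' \<Rightarrow> Q $ i * a j' x y) * t ^ j) = t * Q $ i * f x (y + t *s Q)"
        using a(3) by (subst sum.atMost_Suc_shift) (simp add: sum_distrib_left mult_ac)
      finally show ?thesis by (simp add: algebra_simps)
    qed
    ultimately show ?case by blast
  qed
  then show ?thesis by (elim exE conjE) (rule that, simp_all)
qed

subsection \<open>Products over the roots of a polynomial\<close>

text \<open>The coefficient of index \<open>k\<close> is the elementary symmetric function of degree
  \<open>k\<close>. Power series are used so that the logarithmic derivative makes sense.\<close>

definition esym_fps :: "complex multiset \<Rightarrow> complex fps" where
  "esym_fps M = (\<Prod>\<alpha>\<in>#M. 1 + fps_const \<alpha> * fps_X)"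

definition power_sum :: "nat \<Rightarrow> complex multiset \<Rightarrow> complex" where
  "power_sum k M = (\<Sum>\<alpha>\<in>#M. \<alpha> ^ k)"

lemma esym_fps_add: "esym_fps (add_mset \<alpha> M) = (1 + fps_const \<alpha> * fps_X) * esym_fps M"
  by (simp add: esym_fps_def)

lemma esym_fps_nth_Suc:
  "fps_nth (esym_fps (add_mset \<alpha> M)) (Suc n) = fps_nth (esym_fps M) (Suc n) + \<alpha> * fps_nth (esym_fps M) n"
  by (simp add: esym_fps_add distrib_right mult.assoc)

lemma esym_fps_nth_0: "fps_nth (esym_fps M) 0 = 1"
  by (induction M) (simp_all add: esym_fps_add, simp add: esym_fps_def)

lemma esym_fps_nth_gt: "k > size M \<Longrightarrow> fps_nth (esym_fps M) k = 0"
proof (induction M arbitrary: k)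
  case empty
  then show ?case by (simp add: esym_fps_def)
next
  case (add \<alpha> M)
  then show ?case by (cases k) (simp_all add: esym_fps_nth_Suc)
qed

lemma esym_fps_nth_size: "fps_nth (esym_fps M) (size M) = (\<Prod>\<alpha>\<in>#M. \<alpha>)"
proof (induction M)
  case empty
  then show ?case by (simp add: esym_fps_def)
next
  case (add \<alpha> M)
  then show ?case by (simp add: esym_fps_nth_Suc esym_fps_nth_gt)
qed

text \<open>The logarithmic derivative of \<open>\<Prod>(1 + \<alpha> X)\<close>: comparing coefficients gives Newton's identities.\<close>

lemma fps_deriv_esym_fps:
  "fps_deriv (esym_fps M) = esym_fps M * Abs_fps (\<lambda>n. (-1) ^ n * power_sum (Suc n) M)"
proof (induction M)
  case empty
  then show ?case by (simp add: esym_fps_def power_sum_def fps_eq_iff)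
next
  case (add \<alpha> M)
  let ?P = "\<lambda>M. Abs_fps (\<lambda>n. (-1) ^ n * power_sum (Suc n) M)"
  define g where "g = Abs_fps (\<lambda>n. (-1) ^ n * \<alpha> ^ Suc n)"
  have P: "?P (add_mset \<alpha> M) = g + ?P M"
    by (simp add: g_def fps_eq_iff power_sum_def algebra_simps)
  have g: "(1 + fps_const \<alpha> * fps_X) * g = fps_const \<alpha>"
  proof (rule fps_ext)
    fix n show "fps_nth ((1 + fps_const \<alpha> * fps_X) * g) n = fps_nth (fps_const \<alpha>) n"
      by (cases n) (simp_all add: g_def distrib_right mult.assoc)
  qed
  have "fps_deriv (esym_fps (add_mset \<alpha> M)) =
      fps_const \<alpha> * esym_fps M + (1 + fps_const \<alpha> * fps_X) * fps_deriv (esym_fps M)"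
    unfolding esym_fps_add by (simp add: algebra_simps)
  also have "\<dots> = (1 + fps_const \<alpha> * fps_X) * g * esym_fps M + (1 + fps_const \<alpha> * fps_X) * fps_deriv (esym_fps M)"
    unfolding g ..
  also have "\<dots> = esym_fps (add_mset \<alpha> M) * (g + ?P M)"
    unfolding add.IH esym_fps_add by (simp only: algebra_simps)
  finally show ?case unfolding P .
qed

lemma Newton_identity:
  "of_nat (Suc n) * fps_nth (esym_fps M) (Suc n) =
     (\<Sum>i\<le>n. fps_nth (esym_fps M) i * ((-1) ^ (n - i) * power_sum (Suc (n - i)) M))"
proof -
  have "of_nat (Suc n) * fps_nth (esym_fps M) (Suc n) = fps_nth (fps_deriv (esym_fps M)) n"
    by simp
  also have "\<dots> = (\<Sum>i\<le>n. fps_nth (esym_fps M) i * ((-1) ^ (n - i) * power_sum (Suc (n - i)) M))"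
    unfolding fps_deriv_esym_fps fps_mult_nth atLeast0AtMost by simp
  finally show ?thesis .
qed

text \<open>Newton's identity solved for the power sum of highest index; together with the converse
  \<open>esym_holomorphic\<close> it replaces any choice of the individual roots as functions of the
  parameter.\<close>

lemma power_sum_holomorphic:
  assumes "\<And>k. (\<lambda>a. fps_nth (esym_fps (M a)) k) holomorphic_on S"
  shows "(\<lambda>a. power_sum (Suc n) (M a)) holomorphic_on S"
proof (induction n rule: less_induct)
  case (less n)
  have eq: "power_sum (Suc n) (M a) = (-1) ^ n * (of_nat (Suc n) * fps_nth (esym_fps (M a)) (Suc n) -
     (\<Sum>i\<in>{..n} - {0}. fps_nth (esym_fps (M a)) i * ((-1) ^ (n - i) * power_sum (Suc (n - i)) (M a))))" for a
  proof -
    have "(-1) ^ n * power_sum (Suc n) (M a) = of_nat (Suc n) * fps_nth (esym_fps (M a)) (Suc n) -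
     (\<Sum>i\<in>{..n} - {0}. fps_nth (esym_fps (M a)) i * ((-1) ^ (n - i) * power_sum (Suc (n - i)) (M a)))"
      \<comment> \<open>Only the term \<open>i = 0\<close> contains the power sum of index
        \<open>Suc n\<close>, and its other factor is a sign, since \<open>esym_fps\<close> has
        constant coefficient 1.\<close>
      unfolding Newton_identity by (subst sum.remove[of _ 0]) (simp_all add: esym_fps_nth_0)
    then have "(-1) ^ n * ((-1) ^ n * power_sum (Suc n) (M a)) = (-1) ^ n * (of_nat (Suc n) * fps_nth (esym_fps (M a)) (Suc n) -
     (\<Sum>i\<in>{..n} - {0}. fps_nth (esym_fps (M a)) i * ((-1) ^ (n - i) * power_sum (Suc (n - i)) (M a))))"
      by (rule arg_cong)
    then show ?thesis by (simp flip: mult.assoc power_mult_distrib)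
  qed
  show ?case unfolding eq
    by (intro holomorphic_intros assms less.IH) auto
qed

lemma esym_holomorphic:
  assumes "\<And>k. (\<lambda>a. power_sum (Suc k) (M a)) holomorphic_on S"
  shows "(\<lambda>a. fps_nth (esym_fps (M a)) n) holomorphic_on S"
proof (induction n rule: less_induct)
  case (less n)
  show ?case
  proof (cases n)
    case 0
    then show ?thesis by (simp add: esym_fps_nth_0)
  next
    case (Suc k)
    have eq: "fps_nth (esym_fps (M a)) n =
       (\<Sum>i\<le>k. fps_nth (esym_fps (M a)) i * ((-1) ^ (k - i) * power_sum (Suc (k - i)) (M a))) / of_nat (Suc k)" for a
      using Newton_identity[of k "M a"] unfolding Suc by (simp add: nonzero_eq_divide_eq mult.commute del: of_nat_Suc)
    show ?thesis unfolding eq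
      using Suc by (intro holomorphic_intros assms less.IH) auto
  qed
qed

text \<open>Reflection turns a factor with root \<open>\<alpha>\<close> into
  \<open>1 - \<alpha> X\<close>; hence the sign change of the roots, and the coefficients are read
  from the top downwards.\<close>

lemma esym_fps_proots:
  fixes A :: "complex poly"
  assumes "A \<noteq> 0"
  shows "fps_of_poly (reflect_poly A) = fps_const (lead_coeff A) * esym_fps (image_mset uminus (proots A))"
proof -
  have *: "fps_of_poly (reflect_poly (\<Prod>x\<in>#M. [:-x, 1:])) = esym_fps (image_mset uminus M)" for M
  proof (induction M)
    case empty
    then show ?case by (simp add: esym_fps_def)
  next
    case (add x M)
    have x: "fps_of_poly (reflect_poly [:-x, 1:]) = 1 + fps_const (-x) * fps_X"
      by (cases "x = 0") (simp_all add: reflect_poly_def fps_of_poly_pCons)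
    show ?case
      unfolding image_mset_add_mset prod_mset.add_mset reflect_poly_mult fps_of_poly_mult x add.IH esym_fps_add ..
  qed
  have "fps_of_poly (reflect_poly (smult (lead_coeff A) (\<Prod>x\<in>#proots A. [:-x, 1:]))) =
      fps_const (lead_coeff A) * esym_fps (image_mset uminus (proots A))"
    by (simp add: reflect_poly_smult fps_of_poly_smult *)
  then show ?thesis by (simp only: complex_poly_decompose_multiset)
qed

lemma coeff_power_holomorphic:
  assumes "\<And>j. (\<lambda>a. coeff (B a) j) holomorphic_on S"
  shows "(\<lambda>a. coeff (B a ^ k) j) holomorphic_on S"
proof (induction k arbitrary: j)
  case 0
  then show ?case by simp
next
  case (Suc k)
  then show ?case by (simp add: coeff_mult) (intro holomorphic_intros assms Suc.IH)
qed

lemma power_sum_0: "power_sum 0 M = of_nat (size M)"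
  by (simp add: power_sum_def)

lemma power_sum_image_poly:
  assumes "degree (B ^ k) \<le> n"
  shows "power_sum k (image_mset (poly B) M) = (\<Sum>j\<le>n. coeff (B ^ k) j * power_sum j M)"
proof (induction M)
  case empty
  then show ?case by (simp add: power_sum_def)
next
  case (add x M)
  have "poly B x ^ k = (\<Sum>j\<le>n. coeff (B ^ k) j * x ^ j)"
    unfolding poly_power[symmetric]
      by (subst poly_altdef, rule sum.mono_neutral_left) (use assms in \<open>auto simp: coeff_eq_0\<close>)
  then show ?case
    using add.IH by (simp add: power_sum_def algebra_simps sum.distrib)
qed

lemma power_sum_uminus: "power_sum k (image_mset uminus M) = (-1) ^ k * power_sum k M"
proof (induction M)
  case empty
  then show ?case by (simp add: power_sum_def)
next
  case (add x M)
  then show ?case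
    using power_minus[of x k] by (simp only: power_sum_def image_mset_add_mset sum_mset.add_mset distrib_left)
qed

text \<open>Up to a power of \<open>L\<close> this is the resultant of \<open>A a\<close> and
  \<open>B a\<close>. The coefficients of \<open>A\<close> give the power sums of its roots, these
  give the power sums of the values of \<open>B\<close>, and those give the product of the
  values.\<close>

lemma root_product_holomorphic:
  fixes A B :: "complex \<Rightarrow> complex poly"
  assumes A: "\<And>a. degree (A a) = e" "\<And>a. coeff (A a) e = L" "L \<noteq> 0"
    and A_hol: "\<And>j. (\<lambda>a. coeff (A a) j) holomorphic_on S"
    and B: "\<And>a. degree (B a) \<le> n" and B_hol: "\<And>j. (\<lambda>a. coeff (B a) j) holomorphic_on S"
  shows "(\<lambda>a. \<Prod>\<alpha>\<in>#proots (A a). poly (B a) \<alpha>) holomorphic_on S"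
proof -
  have nz: "A a \<noteq> 0" for a using A(2)[of a] A(3) by auto
  have esym: "(\<lambda>a. fps_nth (esym_fps (image_mset uminus (proots (A a)))) k) holomorphic_on S" for k
  proof -
    have "fps_nth (esym_fps (image_mset uminus (proots (A a)))) k = coeff (reflect_poly (A a)) k / L" for a
    proof -
      have "coeff (reflect_poly (A a)) k = L * fps_nth (esym_fps (image_mset uminus (proots (A a)))) k"
        using esym_fps_proots[OF nz[of a]] A by (simp flip: fps_of_poly_nth)
      then show ?thesis using A(3) by simp
    qed
    moreover have "(\<lambda>a. coeff (reflect_poly (A a)) k / L) holomorphic_on S"
      unfolding coeff_reflect_poly A(1)
      by (cases "k > e") (auto intro!: holomorphic_intros A_hol A(3))
    ultimately show ?thesis by simp
  qed
  have ps: "(\<lambda>a. power_sum k (proots (A a))) holomorphic_on S" for k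
  proof (cases k)
    case 0
    then show ?thesis by (simp add: power_sum_0 size_proots_complex A)
  next
    case (Suc k')
    have "power_sum k (proots (A a)) = (-1) ^ k * power_sum k (image_mset uminus (proots (A a)))" for a
    proof -
      show ?thesis unfolding power_sum_uminus by (simp flip: mult.assoc power_mult_distrib)
    qed
    moreover have "(\<lambda>a. (-1) ^ k * power_sum k (image_mset uminus (proots (A a)))) holomorphic_on S"
      unfolding Suc by (intro holomorphic_intros power_sum_holomorphic esym)
    ultimately show ?thesis by simp
  qed
  define M where "M = (\<lambda>a. image_mset (poly (B a)) (proots (A a)))"
  have "(\<lambda>a. power_sum k (M a)) holomorphic_on S" for k
  proof -
    have "degree (B a ^ k) \<le> n * k" for a
      using degree_power_le[of "B a" k] B[of a] by (meson le_trans mult_le_mono1)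
    then have "power_sum k (M a) = (\<Sum>j\<le>n * k. coeff (B a ^ k) j * power_sum j (proots (A a)))" for a
      unfolding M_def by (rule power_sum_image_poly)
    then show ?thesis
      by (simp only:) (intro holomorphic_intros coeff_power_holomorphic B_hol ps)
  qed
  then have "(\<lambda>a. fps_nth (esym_fps (M a)) e) holomorphic_on S"
    by (rule esym_holomorphic)
  \<comment> \<open>\<open>M a\<close> has \<open>e\<close> elements, so its elementary symmetric
    function of degree \<open>e\<close> is the product.\<close>
  moreover have "fps_nth (esym_fps (M a)) e = (\<Prod>\<alpha>\<in>#proots (A a). poly (B a) \<alpha>)" for a
    using esym_fps_nth_size[of "M a"] by (simp add: M_def size_proots_complex A)
  ultimately show ?thesis by simp
qed

subsection \<open>Persistence of roots and implicit functions\<close>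

text \<open>If \<open>h s\<close> had no zero in a small disc, the maximum modulus principle for its
  reciprocal would fail: \<open>h s\<close> stays within \<open>\<mu> / 3\<close> of
  \<open>h s0\<close>, so its modulus is at least \<open>2 * \<mu> / 3\<close> on the circle but at
  most \<open>\<mu> / 3\<close> at the centre. The point \<open>z1\<close> excludes that
  \<open>h s0\<close> vanishes identically.\<close>

lemma roots_persist:
  fixes h :: "'a::metric_space \<Rightarrow> complex \<Rightarrow> complex"
  assumes cont: "continuous_on UNIV (\<lambda>(s, z). h s z)" and hol: "\<And>s. h s holomorphic_on UNIV"
    and root: "h s0 z0 = 0" and nonzero: "h s0 z1 \<noteq> 0" and \<epsilon>: "\<epsilon> > 0"
  obtains \<delta> where "\<delta> > 0" "\<And>s. dist s s0 < \<delta> \<Longrightarrow> \<exists>z. dist z z0 < \<epsilon> \<and> h s z = 0"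
proof -
  obtain r where r: "r > 0" "\<And>z. z \<in> ball z0 r - {z0} \<Longrightarrow> h s0 z \<noteq> 0"
    using isolated_zeros[of "h s0" UNIV z0 z1] hol root nonzero by auto
  define \<rho> where "\<rho> = min (r / 2) (\<epsilon> / 2)"
  have \<rho>: "\<rho> > 0" "\<rho> < r" "\<rho> < \<epsilon>" using r(1) \<epsilon> by (auto simp: \<rho>_def)
  have contz: "continuous_on S (h s)" for s S
    using holomorphic_on_imp_continuous_on[OF hol] continuous_on_subset by blast
  obtain w where w: "w \<in> sphere z0 \<rho>" "\<And>z. z \<in> sphere z0 \<rho> \<Longrightarrow> norm (h s0 w) \<le> norm (h s0 z)"
  proof -
    have "sphere z0 \<rho> \<noteq> {}" using \<rho> by simp
    then show ?thesis
      using continuous_attains_inf[OF compact_sphere _ continuous_on_norm[OF contz[of _ s0]]] that by blast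
  qed
  define \<mu> where "\<mu> = norm (h s0 w)"
  have "w \<in> ball z0 r - {z0}" using w(1) \<rho> by (auto simp: dist_commute)
  then have \<mu>: "\<mu> > 0" using r(2)[of w] by (simp add: \<mu>_def)
  have cont': "continuous_on (UNIV \<times> cball z0 \<rho>) (\<lambda>(s, z). h s z)"
    using cont by (rule continuous_on_subset) simp
  have "\<mu> / 3 > 0" using \<mu> by simp
  obtain X0 where X0: "s0 \<in> X0" "open X0"
    "\<forall>s\<in>X0 \<inter> UNIV. \<forall>z\<in>cball z0 \<rho>. dist ((\<lambda>(s, z). h s z) (s, z)) ((\<lambda>(s, z). h s z) (s0, z)) \<le> \<mu> / 3"
    by (rule continuous_on_prod_compactE[OF cont' compact_cball UNIV_I[of s0] \<open>\<mu> / 3 > 0\<close>]) (rule that)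
  obtain \<delta> where \<delta>: "\<delta> > 0" "\<And>s. dist s s0 < \<delta> \<Longrightarrow> s \<in> X0"
    using X0(1,2) unfolding open_dist by blast
  have "\<exists>z. dist z z0 < \<epsilon> \<and> h s z = 0" if "dist s s0 < \<delta>" for s
  proof (rule ccontr)
    assume neg: "\<not> ?thesis"
    have near: "norm (h s z - h s0 z) \<le> \<mu> / 3" if "z \<in> cball z0 \<rho>" for z
      using X0(3) \<delta>(2)[OF \<open>dist s s0 < \<delta>\<close>] that by (auto simp: dist_norm)
    have nz: "h s z \<noteq> 0" if "z \<in> cball z0 \<rho>" for z
      using neg that \<rho> by (auto simp: dist_commute)
    have "norm (inverse (h s z0)) \<le> 3 / (2 * \<mu>)"
    proof (rule maximum_modulus_frontier[of "\<lambda>z. inverse (h s z)" "cball z0 \<rho>"])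
      show "(\<lambda>z. inverse (h s z)) holomorphic_on interior (cball z0 \<rho>)"
        using nz by (intro holomorphic_intros holomorphic_on_subset[OF hol]) auto
      show "continuous_on (closure (cball z0 \<rho>)) (\<lambda>z. inverse (h s z))"
        using nz by (intro continuous_intros contz) auto
      fix z assume "z \<in> frontier (cball z0 \<rho>)"
      then have z: "z \<in> sphere z0 \<rho>" using \<rho> by (simp add: frontier_cball)
      have "norm (h s0 z) \<le> norm (h s z) + norm (h s z - h s0 z)"
        by (metis norm_minus_commute norm_triangle_sub)
      then have "2 * \<mu> / 3 \<le> norm (h s z)"
        using near[of z] w(2)[OF z] z by (auto simp: \<mu>_def)
      moreover have "2 * \<mu> / 3 > 0" using \<mu> by simp
      ultimately have "inverse (norm (h s z)) \<le> inverse (2 * \<mu> / 3)"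
        by (rule le_imp_inverse_le)
      then show "norm (inverse (h s z)) \<le> 3 / (2 * \<mu>)"
        by (simp add: norm_inverse)
    qed (use \<rho> in auto)
    moreover have "norm (h s z0) \<le> \<mu> / 3" "norm (h s z0) > 0"
      using near[of z0] nz[of z0] root \<rho> by auto
    then have "inverse (\<mu> / 3) \<le> inverse (norm (h s z0))"
      by (intro le_imp_inverse_le)
    ultimately have "3 / \<mu> \<le> 3 / (2 * \<mu>)"
      by (simp add: norm_inverse)
    then show False using \<mu> by (simp add: field_simps)
  qed
  then show ?thesis using that \<delta>(1) by blast
qed

lemma norm_cdot_le: "norm (cdot u v) \<le> 3 * norm u * norm v"
proof -
  have "norm (cdot u v) \<le> (\<Sum>i\<in>UNIV. norm (u $ i * v $ i))"
    unfolding cdot_def by (rule norm_sum)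
  also have "\<dots> \<le> (\<Sum>i\<in>(UNIV::3 set). norm u * norm v)"
    by (rule sum_mono) (simp add: norm_mult mult_mono Finite_Cartesian_Product.norm_nth_le)
  finally show ?thesis by simp
qed

lemma norm_vsmult: "norm (c *s v) \<le> norm c * (3 * norm (v::complex^3))"
proof -
  have "norm (c *s v) \<le> (\<Sum>i\<in>UNIV. norm ((c *s v) $ i))"
    unfolding norm_vec_def by (rule L2_set_le_sum) simp
  also have "\<dots> \<le> (\<Sum>i\<in>(UNIV::3 set). norm c * norm v)"
    by (rule sum_mono) (simp add: norm_mult mult_left_mono Finite_Cartesian_Product.norm_nth_le)
  finally show ?thesis by simp
qed

lemma open_quadruple:
  fixes x0 y0 x1 y1 :: "'a::real_normed_vector"
  assumes "open N" "(x0, y0, x1, y1) \<in> N"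
  obtains r where "r > 0" "\<And>x y x' y'. dist x x0 < r \<Longrightarrow> dist y y0 < r \<Longrightarrow> dist x' x1 < r \<Longrightarrow> dist y' y1 < r \<Longrightarrow> (x, y, x', y') \<in> N"
proof -
  obtain r where r: "r > 0" "\<And>z. dist z (x0, y0, x1, y1) < r \<Longrightarrow> z \<in> N"
    using assms unfolding open_dist by blast
  have "(x, y, x', y') \<in> N" if "dist x x0 < r / 4" "dist y y0 < r / 4" "dist x' x1 < r / 4" "dist y' y1 < r / 4" for x y x' y'
  proof (rule r(2))
    have "norm (x - x0, y - y0, x' - x1, y' - y1) \<le> norm (x - x0) + (norm (y - y0) + (norm (x' - x1) + norm (y' - y1)))"
      by (meson add_left_mono norm_Pair_le order_trans)
    then show "dist (x, y, x', y') (x0, y0, x1, y1) < r"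
      using that by (simp add: dist_norm)
  qed
  then show ?thesis using that[of "r / 4"] r(1) by auto
qed

text \<open>At \<open>(x, y, x, y)\<close> this is the derivative of the function with difference factors \<open>A\<close>, \<open>B\<close> at \<open>(x, y)\<close>
  in the direction \<open>(W1, W2)\<close>.\<close>

definition slope :: "((complex^3) \<times> (complex^3) \<times> (complex^3) \<times> (complex^3) \<Rightarrow> complex^3)
      \<Rightarrow> ((complex^3) \<times> (complex^3) \<times> (complex^3) \<times> (complex^3) \<Rightarrow> complex^3) \<Rightarrow>
      complex^3 \<Rightarrow> complex^3 \<Rightarrow> (complex^3) \<times> (complex^3) \<times> (complex^3) \<times> (complex^3) \<Rightarrow> complex" where
  "slope A B W1 W2 z = cdot (A z) W1 + cdot (B z) W2"

lemma continuous_on_slope: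
  assumes "difference_factors \<psi> A B" shows "continuous_on UNIV (slope A B W1 W2)"
  unfolding slope_def
  by (intro continuous_intros difference_factorsD(1,2)[OF assms])

lemma difference_slope:
  assumes "difference_factors \<psi> A B" and z: "z = (x + v *s W1, y + v *s W2, x' + v' *s W1, y' + v' *s W2)"
  shows "\<psi> (x' + v' *s W1) (y' + v' *s W2) - \<psi> (x + v *s W1) (y + v *s W2) =
    cdot (A z) (x' - x) + cdot (B z) (y' - y) + (v' - v) * slope A B W1 W2 z"
proof -
  have *: "x' + v' *s W1 - (x + v *s W1) = (x' - x) + (v' - v) *s W1"
     "y' + v' *s W2 - (y + v *s W2) = (y' - y) + (v' - v) *s W2"
    by (simp_all add: vec_eq_iff algebra_simps)
  show ?thesis
    unfolding difference_factorsD(3)[OF assms(1)] z[symmetric] * slope_def cdot_add cdot_scale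
    by (simp only: distrib_left add_ac)
qed

lemma slope_of_zeros:
  assumes df: "difference_factors \<psi> A B" and z: "z = (x + v *s W1, y + v *s W2, x' + v' *s W1, y' + v' *s W2)"
    and zeros: "\<psi> (x + v *s W1) (y + v *s W2) = 0" "\<psi> (x' + v' *s W1) (y' + v' *s W2) = 0"
  shows "(v' - v) * slope A B W1 W2 z = - (cdot (A z) (x' - x) + cdot (B z) (y' - y))"
proof -
  have "0 = cdot (A z) (x' - x) + cdot (B z) (y' - y) + (v' - v) * slope A B W1 W2 z"
    using difference_slope[OF df z] unfolding zeros by (simp only: diff_self)
  then show ?thesis by (simp only: eq_neg_iff_add_eq_0 add_ac)
qed

text \<open>Near the base point the slope stays away from 0, so \<open>slope_of_zeros\<close> can be
  divided by it. For equal base points the bound says that the zero is unique; in general it gives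
  Lipschitz dependence.\<close>

lemma transversal_Lipschitz:
  assumes df: "difference_factors \<psi> A B" and nz: "slope A B W1 W2 (x0, y0, x0, y0) \<noteq> 0"
  obtains \<rho> K where "\<rho> > 0" "K > 0"
    "\<And>x y x' y' v v'. dist (x + v *s W1) x0 < \<rho> \<Longrightarrow> dist (y + v *s W2) y0 < \<rho> \<Longrightarrow>
      dist (x' + v' *s W1) x0 < \<rho> \<Longrightarrow> dist (y' + v' *s W2) y0 < \<rho> \<Longrightarrow>
      \<psi> (x + v *s W1) (y + v *s W2) = 0 \<Longrightarrow> \<psi> (x' + v' *s W1) (y' + v' *s W2) = 0 \<Longrightarrow>
      norm (v' - v) \<le> K * (norm (x' - x) + norm (y' - y))"
proof -
  let ?z0 = "(x0, y0, x0, y0)"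
  define s where "s = norm (slope A B W1 W2 ?z0)"
  have s: "s > 0" using nz by (simp add: s_def)
  define N where "N = {z. norm (slope A B W1 W2 z) > s / 2} \<inter> {z. norm (A z) < norm (A ?z0) + 1} \<inter> {z. norm (B z) < norm (B ?z0) + 1}"
  have "open N" unfolding N_def
    by (intro open_Int open_Collect_less continuous_intros continuous_on_slope[OF df] difference_factorsD(1,2)[OF df])
  moreover have "?z0 \<in> N" using s by (simp add: N_def s_def)
  ultimately obtain r where r: "r > 0" "\<And>x y x' y'. dist x x0 < r \<Longrightarrow> dist y y0 < r \<Longrightarrow> dist x' x0 < r \<Longrightarrow> dist y' y0 < r \<Longrightarrow> (x, y, x', y') \<in> N"
    using open_quadruple by blast
  define M where "M = norm (A ?z0) + norm (B ?z0) + 1"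
  have M: "M > 0" by (simp add: M_def add_nonneg_pos)
  \<comment> \<open>The factor 3 is from \<open>norm_cdot_le\<close>, \<open>M\<close> bounds both
    difference factors, and \<open>s / 2\<close> is the lower bound for the slope.\<close>
  define K where "K = 3 * M * (2 / s)"
  have "norm (v' - v) \<le> K * (norm (x' - x) + norm (y' - y))"
    if "dist (x + v *s W1) x0 < r" "dist (y + v *s W2) y0 < r"
      "dist (x' + v' *s W1) x0 < r" "dist (y' + v' *s W2) y0 < r"
      "\<psi> (x + v *s W1) (y + v *s W2) = 0" "\<psi> (x' + v' *s W1) (y' + v' *s W2) = 0" for x y x' y' v v'
  proof -
    define z where "z = (x + v *s W1, y + v *s W2, x' + v' *s W1, y' + v' *s W2)"
    have "z \<in> N" unfolding z_def by (rule r(2)[OF that(1-4)])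
    then have z: "norm (slope A B W1 W2 z) > s / 2" "norm (A z) \<le> M" "norm (B z) \<le> M"
      by (auto simp: N_def M_def intro: less_imp_le order_trans)
    have "(v' - v) * slope A B W1 W2 z = - (cdot (A z) (x' - x) + cdot (B z) (y' - y))"
      by (rule slope_of_zeros[OF df z_def that(5,6)])
    then have "norm (v' - v) * norm (slope A B W1 W2 z) = norm (cdot (A z) (x' - x) + cdot (B z) (y' - y))"
      by (metis norm_minus_cancel norm_mult)
    also have "\<dots> \<le> 3 * norm (A z) * norm (x' - x) + 3 * norm (B z) * norm (y' - y)"
      by (rule norm_triangle_le) (intro add_mono norm_cdot_le)
    also have "\<dots> \<le> 3 * M * norm (x' - x) + 3 * M * norm (y' - y)"
      using z by (intro add_mono mult_right_mono) auto
    finally have 1: "norm (v' - v) * norm (slope A B W1 W2 z) \<le> 3 * M * (norm (x' - x) + norm (y' - y))"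
      by (simp add: distrib_left)
    have "norm (v' - v) * (s / 2) \<le> norm (v' - v) * norm (slope A B W1 W2 z)"
      using z(1) by (intro mult_left_mono) auto
    with 1 have "norm (v' - v) * (s / 2) \<le> 3 * M * (norm (x' - x) + norm (y' - y))" by linarith
    then show ?thesis using s by (simp add: K_def field_simps)
  qed
  moreover have "K > 0" using M s by (simp add: K_def)
  ultimately show ?thesis using that r(1) by blast
qed

lemma tendsto_field_quotient:
  assumes "(g has_field_derivative D) (at z0)"
  shows "((\<lambda>z. (g z - g z0) / (z - z0)) \<longlongrightarrow> D) (at z0)"
  using assms by (simp add: has_field_derivative_iff)

text \<open>Continuity of \<open>\<rho>\<close> is enough to start with, because the difference
  quotient of \<open>\<rho>\<close> is an explicit expression in the difference factors, which
  converge to their values on the diagonal.\<close>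

lemma implicit_derivative:
  assumes df: "difference_factors \<psi> A B"
    and X: "\<And>i. ((\<lambda>z. X z $ i) has_field_derivative X' $ i) (at z0)"
    and Y: "\<And>i. ((\<lambda>z. Y z $ i) has_field_derivative Y' $ i) (at z0)"
    and \<rho>: "isCont \<rho> z0"
    and zero: "eventually (\<lambda>z. \<psi> (X z + \<rho> z *s W1) (Y z + \<rho> z *s W2) = 0) (nhds z0)"
    and p: "p = X z0 + \<rho> z0 *s W1" "q = Y z0 + \<rho> z0 *s W2"
    and nz: "slope A B W1 W2 (p, q, p, q) \<noteq> 0"
  shows "(\<rho> has_field_derivative - (slope A B X' Y' (p, q, p, q)) / slope A B W1 W2 (p, q, p, q)) (at z0)"
proof -
  define \<zeta> where "\<zeta> = (\<lambda>z. (p, q, X z + \<rho> z *s W1, Y z + \<rho> z *s W2))"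
  have Xt: "(X \<longlongrightarrow> X z0) (at z0)"
    using DERIV_isCont[OF X] by (intro vec_tendstoI) (auto simp: isCont_def)
  have Yt: "(Y \<longlongrightarrow> Y z0) (at z0)"
    using DERIV_isCont[OF Y] by (intro vec_tendstoI) (auto simp: isCont_def)
  have \<rho>t: "(\<rho> \<longlongrightarrow> \<rho> z0) (at z0)" using \<rho> by (simp add: isCont_def)
  have smult: "((\<lambda>z. \<rho> z *s W) \<longlongrightarrow> \<rho> z0 *s W) (at z0)" for W
    using \<rho>t by (intro vec_tendstoI) (auto intro!: tendsto_intros)
  have \<zeta>t: "(\<zeta> \<longlongrightarrow> (p, q, p, q)) (at z0)"
    unfolding \<zeta>_def p by (intro tendsto_intros Xt Yt smult)
  have At: "((\<lambda>z. A (\<zeta> z)) \<longlongrightarrow> A (p, q, p, q)) (at z0)" and Bt: "((\<lambda>z. B (\<zeta> z)) \<longlongrightarrow> B (p, q, p, q)) (at z0)"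
    using difference_factorsD(1,2)[OF df] \<zeta>t by (auto simp: continuous_on_eq_continuous_at intro: isCont_tendsto_compose)
  have St: "((\<lambda>z. slope A B W1 W2 (\<zeta> z)) \<longlongrightarrow> slope A B W1 W2 (p, q, p, q)) (at z0)"
    using continuous_on_slope[OF df] \<zeta>t by (auto simp: continuous_on_eq_continuous_at intro: isCont_tendsto_compose)
  \<comment> \<open>The difference quotient of \<open>\<rho>\<close>, rewritten by
    \<open>slope_of_zeros\<close> so that its limit can be read off.\<close>
  define g where "g = (\<lambda>z. - ((\<Sum>i\<in>UNIV. A (\<zeta> z) $ i * ((X z $ i - X z0 $ i) / (z - z0))) +
      (\<Sum>i\<in>UNIV. B (\<zeta> z) $ i * ((Y z $ i - Y z0 $ i) / (z - z0)))) / slope A B W1 W2 (\<zeta> z))"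
  have "(g \<longlongrightarrow> - ((\<Sum>i\<in>UNIV. A (p, q, p, q) $ i * X' $ i) + (\<Sum>i\<in>UNIV. B (p, q, p, q) $ i * Y' $ i)) / slope A B W1 W2 (p, q, p, q)) (at z0)"
    unfolding g_def
    by (intro tendsto_intros At Bt St nz tendsto_field_quotient X Y)
  moreover have "eventually (\<lambda>z. g z = (\<rho> z - \<rho> z0) / (z - z0)) (at z0)"
  proof -
    have ev1: "eventually (\<lambda>z. slope A B W1 W2 (\<zeta> z) \<noteq> 0) (at z0)"
      using St nz by (rule tendsto_imp_eventually_ne)
    have ev2: "eventually (\<lambda>z. \<psi> (X z + \<rho> z *s W1) (Y z + \<rho> z *s W2) = 0) (at z0)"
      using zero by (simp add: eventually_nhds_conv_at)
    have zero0: "\<psi> (X z0 + \<rho> z0 *s W1) (Y z0 + \<rho> z0 *s W2) = 0"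
      using zero by (rule eventually_nhds_x_imp_x)
    have ev3: "eventually (\<lambda>z. z \<noteq> z0) (at z0)" by (simp add: eventually_at_filter)
    show ?thesis using ev1 ev2 ev3
    proof eventually_elim
      case (elim z)
      have "(\<rho> z - \<rho> z0) * slope A B W1 W2 (\<zeta> z) = - (cdot (A (\<zeta> z)) (X z - X z0) + cdot (B (\<zeta> z)) (Y z - Y z0))"
        using zero0 elim(2) by (intro slope_of_zeros[OF df]) (simp_all only: \<zeta>_def p)
      then have "\<rho> z - \<rho> z0 = - (cdot (A (\<zeta> z)) (X z - X z0) + cdot (B (\<zeta> z)) (Y z - Y z0)) / slope A B W1 W2 (\<zeta> z)"
        using elim(1) by (simp only: nonzero_eq_divide_eq not_False_eq_True)
      moreover have "cdot (A (\<zeta> z)) (X z - X z0) = (z - z0) * (\<Sum>i\<in>UNIV. A (\<zeta> z) $ i * ((X z $ i - X z0 $ i) / (z - z0)))"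
        unfolding cdot_def sum_distrib_left using elim(3) by (intro sum.cong) auto
      moreover have "cdot (B (\<zeta> z)) (Y z - Y z0) = (z - z0) * (\<Sum>i\<in>UNIV. B (\<zeta> z) $ i * ((Y z $ i - Y z0 $ i) / (z - z0)))"
        unfolding cdot_def sum_distrib_left using elim(3) by (intro sum.cong) auto
      ultimately have "\<rho> z - \<rho> z0 = (z - z0) * g z"
        unfolding g_def by (simp only: distrib_left times_divide_eq_right mult_minus_right)
      then show "g z = (\<rho> z - \<rho> z0) / (z - z0)" using elim(3) by simp
    qed
  qed
  ultimately have "((\<lambda>z. (\<rho> z - \<rho> z0) / (z - z0)) \<longlongrightarrow>
     - ((\<Sum>i\<in>UNIV. A (p, q, p, q) $ i * X' $ i) + (\<Sum>i\<in>UNIV. B (p, q, p, q) $ i * Y' $ i)) / slope A B W1 W2 (p, q, p, q)) (at z0)"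
    by (rule Lim_transform_eventually)
  then show ?thesis by (simp add: has_field_derivative_iff slope_def cdot_def)
qed

subsection \<open>Families of curves without grids\<close>

text \<open>\<open>cdot (ccross p Q) q\<close> is the determinant of \<open>p\<close>,
  \<open>Q\<close>, \<open>q\<close>; linear independence is always used in the form that it is
  nonzero.\<close>

definition ccross :: "complex^3 \<Rightarrow> complex^3 \<Rightarrow> complex^3" where
  "ccross u v = vector [u$2 * v$3 - u$3 * v$2, u$3 * v$1 - u$1 * v$3, u$1 * v$2 - u$2 * v$1]"

lemma cdot_3: "cdot u v = u$1 * v$1 + u$2 * v$2 + u$3 * v$3"
  by (simp add: cdot_def sum_3)

lemma cdot_ccross [simp]: "cdot (ccross u v) u = 0" "cdot (ccross u v) v = 0"
  by (simp_all add: cdot_3 ccross_def algebra_simps)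

lemma cdot_ccross_swap: "cdot (ccross u w) v = - cdot (ccross v w) u"
  by (simp add: cdot_3 ccross_def algebra_simps)

lemma ccross_eq_0_imp:
  assumes "ccross u v = 0" "u \<noteq> 0" obtains c where "v = c *s u"
proof -
  have *: "u$2 * v$3 = u$3 * v$2" "u$3 * v$1 = u$1 * v$3" "u$1 * v$2 = u$2 * v$1"
    using assms(1) by (simp_all add: ccross_def vec_eq_iff forall_3)
  consider "u$1 \<noteq> 0" | "u$2 \<noteq> 0" | "u$3 \<noteq> 0"
    using assms(2) by (auto simp: vec_eq_iff forall_3)
  then show thesis
  proof cases
    case 1
    then have "v = (v$1 / u$1) *s u" using * by (simp add: vec_eq_iff forall_3 field_simps)
    then show ?thesis by (rule that)
  next
    case 2
    then have "v = (v$2 / u$2) *s u" using * by (simp add: vec_eq_iff forall_3 field_simps)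
    then show ?thesis by (rule that)
  next
    case 3
    then have "v = (v$3 / u$3) *s u" using * by (simp add: vec_eq_iff forall_3 field_simps)
    then show ?thesis by (rule that)
  qed
qed

lemma exists_cdot_nonzero:
  assumes "l \<noteq> 0" obtains w where "cdot l w \<noteq> 0"
proof -
  obtain i where "l $ i \<noteq> 0" using assms by (auto simp: vec_eq_iff)
  then show thesis using that[of "axis i 1"] by simp
qed

lemma exists_nonparallel:
  fixes x :: "complex^3"
  assumes "x \<noteq> 0" obtains w where "\<forall>\<epsilon> c. \<epsilon> \<noteq> 0 \<longrightarrow> x + \<epsilon> *s w \<noteq> c *s x"
proof -
  obtain i where i: "x $ i \<noteq> 0" using assms by (auto simp: vec_eq_iff)
  obtain j :: 3 where j: "j \<noteq> i" by (metis one_neq_zero)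
  have "x + \<epsilon> *s axis j 1 \<noteq> c *s x" if "\<epsilon> \<noteq> 0" for \<epsilon> c
  proof
    assume *: "x + \<epsilon> *s axis j 1 = c *s x"
    have "(x + \<epsilon> *s axis j 1) $ i = (c *s x) $ i" "(x + \<epsilon> *s axis j 1) $ j = (c *s x) $ j"
      by (simp_all only: *)
    then have "x $ i = c * x $ i" "x $ j + \<epsilon> = c * x $ j" using j by (simp_all add: axis_def)
    then show False using i \<open>\<epsilon> \<noteq> 0\<close> by simp
  qed
  then show thesis by (intro that[of "axis j 1"]) blast
qed

text \<open>The quotient of the pairings with \<open>ccross p Q\<close> and
  \<open>ccross q Q\<close> is invariant under scaling and determines \<open>u\<close>: it is the
  coordinate of the line through \<open>Q\<close> on which the point lies.\<close>

lemma pencil_points_distinct: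
  assumes "cdot (ccross p Q) q \<noteq> 0" "u \<noteq> u'"
  shows "p + u *s q + v *s Q \<noteq> c *s (p + u' *s q + v' *s Q)"
proof
  assume *: "p + u *s q + v *s Q = c *s (p + u' *s q + v' *s Q)"
  have "cdot (ccross q Q) (p + u *s q + v *s Q) = cdot (ccross q Q) (c *s (p + u' *s q + v' *s Q))"
    "cdot (ccross p Q) (p + u *s q + v *s Q) = cdot (ccross p Q) (c *s (p + u' *s q + v' *s Q))"
    by (simp_all only: *)
  moreover have "cdot (ccross q Q) p \<noteq> 0" using assms(1) cdot_ccross_swap[of p Q q] by simp
  ultimately show False using assms by simp
qed

lemma higher_pderiv_shift: "(pderiv ^^ j) (pcompose p [:s, 1:]) = pcompose ((pderiv ^^ j) p) [:s, 1 :: complex:]"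
  by (induction j) (simp_all add: pderiv_pcompose pderiv_pCons)

lemma coeff_0_higher_pderiv: "poly ((pderiv ^^ j) p) 0 = fact j * coeff (p :: complex poly) j"
  by (simp add: poly_0_coeff_0 coeff_higher_pderiv pochhammer_fact)

text \<open>\<open>Q\<close> is the centre of projection, and \<open>U\<close> contains only
  parameters whose curve avoids it. Assumption \<open>grid\<close> is freeness from (2,2)-grids in
  homogeneous coordinates, where distinct points are vectors that are not proportional.\<close>

locale gridfree_family =
  fixes d e :: nat and f :: "complex^3 \<Rightarrow> complex^3 \<Rightarrow> complex" and U :: "(complex^3) set"
    and Q :: "complex^3" and c :: "nat \<Rightarrow> complex^3 \<Rightarrow> complex^3 \<Rightarrow> complex"
  assumes bihom_f: "bihom d e f"
    and open_U: "open U" and zero_notin_U: "0 \<notin> U" and lead_nonzero: "x \<in> U \<Longrightarrow> f x Q \<noteq> 0"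
    and bihom_c: "j \<le> e \<Longrightarrow> bihom d (e - j) (c j)" and c_top: "c e x y = f x Q"
    and Taylor: "f x (y + t *s Q) = (\<Sum>j\<le>e. c j x y * t ^ j)"
    and grid: "x \<in> U \<Longrightarrow> x' \<in> U \<Longrightarrow> y \<noteq> 0 \<Longrightarrow> y' \<noteq> 0 \<Longrightarrow> (\<And>a. x' \<noteq> a *s x) \<Longrightarrow> (\<And>a. y' \<noteq> a *s y) \<Longrightarrow>
      f x y = 0 \<Longrightarrow> f x y' = 0 \<Longrightarrow> f x' y = 0 \<Longrightarrow> f x' y' = 0 \<Longrightarrow> False"
begin

definition P :: "complex^3 \<Rightarrow> complex^3 \<Rightarrow> complex poly" where
  "P x y = (\<Sum>j\<le>e. monom (c j x y) j)"

lemma coeff_P: "coeff (P x y) j = (if j \<le> e then c j x y else 0)"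
  by (simp add: P_def coeff_sum)

lemma poly_P: "poly (P x y) t = f x (y + t *s Q)"
  by (simp add: P_def Taylor poly_sum poly_monom)

lemma c_0: "c 0 x y = f x y"
  using poly_P[of x y 0] coeff_P[of x y 0] by (simp add: poly_0_coeff_0)

lemma degree_P: "x \<in> U \<Longrightarrow> degree (P x y) = e"
  by (rule antisym) (auto intro!: degree_le le_degree simp: coeff_P c_top lead_nonzero)

lemma P_shift: "P x (y + s *s Q) = pcompose (P x y) [:s, 1:]"
proof (rule poly_ext)
  fix t
  have 1: "y + s *s Q + t *s Q = y + (s + t) *s Q" by (simp add: vec_eq_iff algebra_simps)
  have 2: "poly [:s, 1:] t = s + t" by simp
  show "poly (P x (y + s *s Q)) t = poly (pcompose (P x y) [:s, 1:]) t"
    by (simp only: poly_P poly_pcompose 1 2)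
qed

text \<open>By \<open>P_shift\<close>, \<open>c j\<close> along \<open>Q\<close> is the
  \<open>j\<close>-th derivative of \<open>P x y\<close> divided by \<open>fact j\<close>. One more
  differentiation raises the index and leaves the factor \<open>Suc j\<close>.\<close>

lemma c_derivative:
  assumes "j < e"
  shows "((\<lambda>s. c j x (y + s *s Q)) has_field_derivative of_nat (Suc j) * c (Suc j) x y) (at 0)"
proof -
  have eq: "c j x (y + s *s Q) = poly ((pderiv ^^ j) (P x y)) s / fact j" for s
  proof -
    have "fact j * c j x (y + s *s Q) = fact j * coeff (P x (y + s *s Q)) j"
      using assms by (simp add: coeff_P)
    also have "\<dots> = poly ((pderiv ^^ j) (P x y)) s"
      unfolding coeff_0_higher_pderiv[symmetric] P_shift higher_pderiv_shift by (simp add: poly_pcompose)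
    finally show ?thesis by (simp add: field_simps)
  qed
  have "((\<lambda>s. poly ((pderiv ^^ j) (P x y)) s / fact j) has_field_derivative
      poly (pderiv ((pderiv ^^ j) (P x y))) 0 / fact j) (at 0)"
    by (intro DERIV_cdivide poly_DERIV)
  moreover have "poly (pderiv ((pderiv ^^ j) (P x y))) 0 / fact j = of_nat (Suc j) * c (Suc j) x y"
    using coeff_0_higher_pderiv[of "Suc j" "P x y"] assms by (simp add: coeff_P field_simps)
  ultimately show ?thesis unfolding eq by simp
qed

text \<open>Difference factors are not unique, but on the diagonal the slope is the limit of
  difference quotients along \<open>Q\<close>, hence the derivative of
  \<open>c_derivative\<close>.\<close>

lemma slope_Q:
  assumes "difference_factors (c j) A B" "j < e"
  shows "slope A B 0 Q (x, y, x, y) = of_nat (Suc j) * c (Suc j) x y"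
proof -
  have "isCont (\<lambda>s. slope A B 0 Q (x, y, x, y + s *s Q)) 0"
  proof -
    have "continuous_on UNIV (\<lambda>s. slope A B 0 Q (x, y, x, y + s *s Q))"
      by (rule continuous_on_compose2[OF continuous_on_slope[OF assms(1)]]) (auto intro!: continuous_intros)
    then show ?thesis by (simp add: continuous_on_eq_continuous_at)
  qed
  then have "((\<lambda>s. slope A B 0 Q (x, y, x, y + s *s Q)) \<longlongrightarrow> slope A B 0 Q (x, y, x, y)) (at 0)"
    by (simp add: isCont_def)
  moreover have "eventually (\<lambda>s. slope A B 0 Q (x, y, x, y + s *s Q) = (c j x (y + s *s Q) - c j x y) / s) (at 0)"
    unfolding eventually_at_filter
  proof (intro always_eventually allI impI)
    fix s :: complex assume "s \<noteq> 0"
    have "c j x (y + s *s Q) - c j x y = s * slope A B 0 Q (x, y, x, y + s *s Q)"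
      using difference_slope[OF assms(1) refl, of x s 0 y Q x 0 y]
        difference_factorsD(3)[OF assms(1), of x "y + s *s Q" x y]
      by (simp add: slope_def)
    then show "slope A B 0 Q (x, y, x, y + s *s Q) = (c j x (y + s *s Q) - c j x y) / s"
      using \<open>s \<noteq> 0\<close> by (simp add: field_simps)
  qed
  ultimately have "((\<lambda>s. (c j x (y + s *s Q) - c j x y) / s) \<longlongrightarrow> slope A B 0 Q (x, y, x, y)) (at 0)"
    by (rule Lim_transform_eventually)
  moreover have "((\<lambda>s. (c j x (y + s *s Q) - c j x y) / s) \<longlongrightarrow> of_nat (Suc j) * c (Suc j) x y) (at 0)"
    using tendsto_field_quotient[OF c_derivative[OF assms(2), of x y]] by simp
  ultimately show ?thesis by (rule tendsto_unique[rotated]) simp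
qed

end

subsection \<open>Zeros of minimal multiplicity\<close>

lemma open_pair_ball:
  fixes x0 :: "'a::metric_space" and y0 :: "'b::metric_space"
  assumes "open N" "(x0, y0) \<in> N"
  obtains r where "r > 0" "\<forall>x y. dist x x0 < r \<longrightarrow> dist y y0 < r \<longrightarrow> (x, y) \<in> N"
proof -
  obtain S T where ST: "open S" "open T" "(x0, y0) \<in> S \<times> T" "S \<times> T \<subseteq> N"
    using open_prod_elim[OF assms] by blast
  obtain r1 where r1: "r1 > 0" "\<And>x. dist x x0 < r1 \<Longrightarrow> x \<in> S"
    using ST unfolding open_dist by blast
  obtain r2 where r2: "r2 > 0" "\<And>y. dist y y0 < r2 \<Longrightarrow> y \<in> T"
    using ST unfolding open_dist by blast
  show thesis
    by (rule that[of "min r1 r2"]) (use r1 r2 ST(4) in auto)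
qed

text \<open>Minimality keeps a zero of multiplicity \<open>m\<close> from splitting when
  \<open>x\<close> moves. The difference factors belong to \<open>c (m - 1)\<close>, of which such a
  zero is a simple zero.\<close>

locale min_multiplicity = gridfree_family +
  fixes m :: nat and A B
  assumes m_le: "0 < m" "m \<le> e"
    and minimal: "x \<in> U \<Longrightarrow> y \<noteq> 0 \<Longrightarrow> f x y = 0 \<Longrightarrow> j < m \<Longrightarrow> c j x y = 0"
    and factors: "difference_factors (c (m - 1)) A B"
begin

definition regular_point :: "complex^3 \<Rightarrow> complex^3 \<Rightarrow> bool" where
  "regular_point x y \<longleftrightarrow> x \<in> U \<and> y \<noteq> 0 \<and> f x y = 0 \<and> c m x y \<noteq> 0"

lemma slope_Q_m: "slope A B 0 Q (x, y, x, y) = of_nat m * c m x y"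
  using slope_Q[OF factors, of x y] m_le by simp

lemma c_m_open: "open {(x, y). c m x y \<noteq> 0}"
proof -
  have "{(x, y). c m x y \<noteq> 0} = {z. c m (fst z) (snd z) \<noteq> 0}" by auto
  moreover have "open {z. c m (fst z) (snd z) \<noteq> 0}"
    by (intro open_Collect_neq bihom_continuous[OF bihom_c[OF m_le(2)]] continuous_intros)
  ultimately show ?thesis by simp
qed

text \<open>Near a regular point every zero of \<open>f\<close> is also a zero of \<open>c (m - 1)\<close>, whose derivative in the
  direction \<open>Q\<close> does not vanish; so the zero on each line in that direction is unique.\<close>

definition root_chart :: "complex^3 \<Rightarrow> complex^3 \<Rightarrow> real \<Rightarrow> real \<Rightarrow> real \<Rightarrow> (complex^3 \<Rightarrow> complex^3 \<Rightarrow> complex) \<Rightarrow> bool" where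
  "root_chart x0 p \<delta> \<rho> K r \<longleftrightarrow> \<delta> > 0 \<and> \<delta> \<le> \<rho> \<and> K > 0 \<and> r x0 p = 0 \<and>
    (\<forall>x. dist x x0 < \<rho> \<longrightarrow> x \<in> U) \<and> (\<forall>y. dist y p < \<rho> \<longrightarrow> y \<noteq> 0) \<and>
    (\<forall>x y. dist x x0 < \<rho> \<longrightarrow> dist y p < \<rho> \<longrightarrow> c m x y \<noteq> 0) \<and>
    (\<forall>x y. dist x x0 < \<delta> \<longrightarrow> dist y p < \<delta> \<longrightarrow> f x (y + r x y *s Q) = 0 \<and> dist (y + r x y *s Q) p < \<rho>) \<and>
    (\<forall>x y v. dist x x0 < \<delta> \<longrightarrow> dist y p < \<delta> \<longrightarrow> f x (y + v *s Q) = 0 \<longrightarrow> dist (y + v *s Q) p < \<rho> \<longrightarrow> v = r x y) \<and>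
    (\<forall>x y x' y'. dist x x0 < \<delta> \<longrightarrow> dist y p < \<delta> \<longrightarrow> dist x' x0 < \<delta> \<longrightarrow> dist y' p < \<delta> \<longrightarrow>
       norm (r x' y' - r x y) \<le> K * (norm (x' - x) + norm (y' - y)))"

lemma root_chartD:
  assumes "root_chart x0 p \<delta> \<rho> K r"
  shows "\<delta> > 0" "\<delta> \<le> \<rho>" "K > 0" "r x0 p = 0"
    "dist x x0 < \<rho> \<Longrightarrow> x \<in> U" "dist y p < \<rho> \<Longrightarrow> y \<noteq> 0"
    "dist x x0 < \<rho> \<Longrightarrow> dist y p < \<rho> \<Longrightarrow> c m x y \<noteq> 0"
    "dist x x0 < \<delta> \<Longrightarrow> dist y p < \<delta> \<Longrightarrow> f x (y + r x y *s Q) = 0"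
    "dist x x0 < \<delta> \<Longrightarrow> dist y p < \<delta> \<Longrightarrow> dist (y + r x y *s Q) p < \<rho>"
    "dist x x0 < \<delta> \<Longrightarrow> dist y p < \<delta> \<Longrightarrow> f x (y + v *s Q) = 0 \<Longrightarrow> dist (y + v *s Q) p < \<rho> \<Longrightarrow> v = r x y"
    "dist x x0 < \<delta> \<Longrightarrow> dist y p < \<delta> \<Longrightarrow> dist x' x0 < \<delta> \<Longrightarrow> dist y' p < \<delta> \<Longrightarrow>
       norm (r x' y' - r x y) \<le> K * (norm (x' - x) + norm (y' - y))"
  using assms unfolding root_chart_def by blast+

text \<open>Existence of the zero near \<open>p\<close> follows from \<open>roots_persist\<close>
  for \<open>f\<close>, uniqueness and the Lipschitz bound from \<open>transversal_Lipschitz\<close>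
  for \<open>c (m - 1)\<close>.\<close>

lemma root_chart_exists:
  assumes reg: "regular_point x0 p" and \<epsilon>0: "\<epsilon>0 > 0"
  obtains \<delta> \<rho> K r where "\<rho> \<le> \<epsilon>0" "root_chart x0 p \<delta> \<rho> K r"
proof -
  have x0: "x0 \<in> U" "p \<noteq> 0" "f x0 p = 0" "c m x0 p \<noteq> 0" using reg by (auto simp: regular_point_def)
  have "slope A B 0 Q (x0, p, x0, p) \<noteq> 0" using x0(4) m_le by (simp add: slope_Q_m)
  from transversal_Lipschitz[OF factors this] obtain \<rho>1 K where \<rho>1: "\<rho>1 > 0" and K: "K > 0"
    and Lip: "\<And>x y x' y' v v'. dist (x + v *s 0) x0 < \<rho>1 \<Longrightarrow> dist (y + v *s Q) p < \<rho>1 \<Longrightarrow>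
      dist (x' + v' *s 0) x0 < \<rho>1 \<Longrightarrow> dist (y' + v' *s Q) p < \<rho>1 \<Longrightarrow>
      c (m - 1) (x + v *s 0) (y + v *s Q) = 0 \<Longrightarrow> c (m - 1) (x' + v' *s 0) (y' + v' *s Q) = 0 \<Longrightarrow>
      norm (v' - v) \<le> K * (norm (x' - x) + norm (y' - y))" by metis
  have N: "open ((U \<times> (- {0})) \<inter> {(x, y). c m x y \<noteq> 0})"
    by (intro open_Int open_Times open_U c_m_open) auto
  have in_N: "(x0, p) \<in> (U \<times> (- {0})) \<inter> {(x, y). c m x y \<noteq> 0}" using x0 by simp
  obtain \<rho>2 where \<rho>2: "\<rho>2 > 0" "\<forall>x y. dist x x0 < \<rho>2 \<longrightarrow> dist y p < \<rho>2 \<longrightarrow> (x, y) \<in> (U \<times> (- {0})) \<inter> {(x, y). c m x y \<noteq> 0}"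
    by (rule open_pair_ball[OF N in_N])
  define \<rho> where "\<rho> = min (min \<rho>1 \<rho>2) \<epsilon>0"
  have \<rho>: "\<rho> > 0" "\<rho> \<le> \<rho>1" "\<rho> \<le> \<rho>2" "\<rho> \<le> \<epsilon>0" using \<rho>1 \<rho>2(1) \<epsilon>0 by (auto simp: \<rho>_def)
  have inU: "x \<in> U" if "dist x x0 < \<rho>" for x
    using \<rho>2(2)[rule_format, of x p] that \<rho> by auto
  have y_nz: "y \<noteq> 0" if "dist y p < \<rho>" for y
    using \<rho>2(2)[rule_format, of x0 y] that \<rho> by auto
  have cm: "c m x y \<noteq> 0" if "dist x x0 < \<rho>" "dist y p < \<rho>" for x y
    using \<rho>2(2)[rule_format, of x y] that \<rho> by auto
  have Lip': "norm (v' - v) \<le> K * (norm (x' - x) + norm (y' - y))"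
    if "dist x x0 < \<rho>" "dist (y + v *s Q) p < \<rho>" "dist x' x0 < \<rho>" "dist (y' + v' *s Q) p < \<rho>"
      "f x (y + v *s Q) = 0" "f x' (y' + v' *s Q) = 0" for x y x' y' v v'
  proof (rule Lip)
    have "c (m - 1) x (y + v *s Q) = 0" "c (m - 1) x' (y' + v' *s Q) = 0"
      using that m_le by (auto intro!: minimal inU y_nz)
    then show "c (m - 1) (x + v *s 0) (y + v *s Q) = 0" "c (m - 1) (x' + v' *s 0) (y' + v' *s Q) = 0"
      by simp_all
  qed (use that \<rho> in auto)
  \<comment> \<open>A shift by \<open>v *s Q\<close> with \<open>norm v < \<epsilon>\<close> moves a
    point by less than \<open>\<rho> / 2\<close>; the factor 3 is from \<open>norm_vsmult\<close>,
    and adding 1 makes the denominator positive.\<close>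
  define \<epsilon> where "\<epsilon> = \<rho> / (2 * (3 * norm Q + 1))"
  have den: "3 * norm Q + 1 > 0" by (simp add: add_nonneg_pos)
  have \<epsilon>: "\<epsilon> > 0" using \<rho>(1) den by (simp add: \<epsilon>_def)
  have \<epsilon>Q: "\<epsilon> * (3 * norm Q) \<le> \<rho> / 2"
  proof -
    have "\<epsilon> * (3 * norm Q) \<le> \<epsilon> * (3 * norm Q + 1)" using \<epsilon> by simp
    also have "\<dots> = \<rho> / 2" using den by (simp add: \<epsilon>_def field_simps)
    finally show ?thesis .
  qed
  define h where "h = (\<lambda>(s :: (complex^3) \<times> (complex^3)) v. f (fst s) (snd s + v *s Q))"
  have "continuous_on UNIV (\<lambda>(s, v). h s v)"
    unfolding h_def case_prod_unfold by (intro bihom_continuous[OF bihom_f] continuous_intros)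
  moreover have "h s holomorphic_on UNIV" for s
    unfolding h_def by (intro bihom_holomorphic[OF bihom_f]) (simp_all, intro holomorphic_intros)
  moreover have "h (x0, p) 0 = 0" using x0 by (simp add: h_def)
  moreover obtain v1 where "h (x0, p) v1 \<noteq> 0"
  proof -
    have "P x0 p \<noteq> 0" using coeff_P[of x0 p e] c_top[of x0 p] lead_nonzero[OF x0(1)] by auto
    then obtain v where "poly (P x0 p) v \<noteq> 0" using poly_all_0_iff_0 by blast
    then show thesis using that[of v] by (simp add: poly_P h_def)
  qed
  ultimately obtain \<delta>1 where \<delta>1: "\<delta>1 > 0" "\<And>s. dist s (x0, p) < \<delta>1 \<Longrightarrow> \<exists>v. dist v 0 < \<epsilon> \<and> h s v = 0"
    using roots_persist[of h "(x0, p)" 0 v1 \<epsilon>] \<epsilon> by metis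
  have in_ball: "(x0, p) \<in> ball (x0, p) \<delta>1" using \<delta>1 by simp
  obtain \<delta>2 where \<delta>2: "\<delta>2 > 0" "\<forall>x y. dist x x0 < \<delta>2 \<longrightarrow> dist y p < \<delta>2 \<longrightarrow> (x, y) \<in> ball (x0, p) \<delta>1"
    by (rule open_pair_ball[OF open_ball in_ball])
  define \<delta> where "\<delta> = min \<delta>2 (\<rho> / 2)"
  have \<delta>: "\<delta> > 0" "\<delta> \<le> \<rho>" "\<delta> \<le> \<rho> / 2" "\<delta> \<le> \<delta>2" using \<delta>2(1) \<rho>(1) by (auto simp: \<delta>_def)
  have ex: "\<exists>v. f x (y + v *s Q) = 0 \<and> dist (y + v *s Q) p < \<rho>" if "dist x x0 < \<delta>" "dist y p < \<delta>" for x y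
  proof -
    have "dist (x, y) (x0, p) < \<delta>1" using \<delta>2(2)[rule_format, of x y] that \<delta>(4) by (simp add: dist_commute)
    then obtain v where v: "dist v 0 < \<epsilon>" "h (x, y) v = 0" using \<delta>1(2) by blast
    have "dist (y + v *s Q) p \<le> dist y p + norm (v *s Q)"
      by (metis dist_norm dist_triangle2 add.commute add_diff_cancel_left' dist_commute dist_triangle_le order_refl)
    also have "norm (v *s Q) \<le> \<epsilon> * (3 * norm Q)"
      using norm_vsmult[of v Q] v(1) by (smt (verit) dist_norm diff_zero mult_right_mono norm_ge_zero)
    finally have "dist (y + v *s Q) p < \<rho>" using \<epsilon>Q \<delta>(3) that(2) by linarith
    then show ?thesis using v(2) by (auto simp: h_def)
  qed
  define r where "r = (\<lambda>x y. SOME v. f x (y + v *s Q) = 0 \<and> dist (y + v *s Q) p < \<rho>)"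
  have r: "f x (y + r x y *s Q) = 0 \<and> dist (y + r x y *s Q) p < \<rho>" if "dist x x0 < \<delta>" "dist y p < \<delta>" for x y
    unfolding r_def by (rule someI_ex[OF ex[OF that]])
  \<comment> \<open>For equal base points the right-hand side of the Lipschitz bound is 0.\<close>
  have uniq: "v = r x y" if "dist x x0 < \<delta>" "dist y p < \<delta>" "f x (y + v *s Q) = 0" "dist (y + v *s Q) p < \<rho>" for x y v
  proof -
    have "norm (v - r x y) \<le> K * (norm (x - x) + norm (y - y))"
      using r[OF that(1,2)] that \<delta>(2) by (intro Lip') auto
    then show ?thesis by simp
  qed
  have "r x0 p = 0" using uniq[of x0 p 0] x0 \<delta>(1) \<rho>(1) by simp
  moreover have "norm (r x' y' - r x y) \<le> K * (norm (x' - x) + norm (y' - y))"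
    if "dist x x0 < \<delta>" "dist y p < \<delta>" "dist x' x0 < \<delta>" "dist y' p < \<delta>" for x y x' y'
    using r[OF that(1,2)] r[OF that(3,4)] that \<delta>(2) by (intro Lip') auto
  ultimately have "root_chart x0 p \<delta> \<rho> K r"
    unfolding root_chart_def using \<delta>(1,2) K inU y_nz cm r uniq by blast
  then show thesis using that[OF \<rho>(4)] by blast
qed

end

lemma small_multiples:
  fixes q :: "complex^3"
  assumes "\<delta> > 0" obtains \<epsilon> where "\<epsilon> > 0" "\<forall>v. norm v < \<epsilon> \<longrightarrow> norm (v *s q) < \<delta>"
proof -
  have den: "3 * norm q + 1 > 0" by (simp add: add_nonneg_pos)
  have "norm (v *s q) < \<delta>" if "norm v < \<delta> / (3 * norm q + 1)" for v
  proof -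
    have "norm (v *s q) \<le> norm v * (3 * norm q + 1)"
      using norm_vsmult[of v q] by (simp add: distrib_left add_increasing2)
    also have "\<dots> < \<delta>" using that den by (simp add: field_simps)
    finally show ?thesis .
  qed
  then show thesis using assms den by (intro that[of "\<delta> / (3 * norm q + 1)"]) simp_all
qed

lemma isCont_by_bound:
  fixes g :: "complex \<Rightarrow> complex" and h :: "complex \<Rightarrow> complex^3"
  assumes "eventually (\<lambda>z. norm (g z - g z0) \<le> K * norm (h z - h z0)) (nhds z0)" "isCont h z0"
  shows "isCont g z0"
proof -
  have "((\<lambda>z. K * norm (h z - h z0)) \<longlongrightarrow> K * norm (h z0 - h z0)) (at z0)"
    using assms(2) by (intro tendsto_intros) (simp add: isCont_def)
  then have lim: "((\<lambda>z. K * norm (h z - h z0)) \<longlongrightarrow> 0) (at z0)" by simp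
  have "eventually (\<lambda>z. norm (g z - g z0) \<le> K * norm (h z - h z0)) (at z0)"
    using assms(1) unfolding eventually_nhds_conv_at by (rule conjunct1)
  then have "((\<lambda>z. g z - g z0) \<longlongrightarrow> 0) (at z0)"
    using lim by (rule Lim_null_comparison)
  then show ?thesis unfolding isCont_def by (rule LIM_zero_cancel)
qed

lemma isCont_vec:
  assumes "\<And>i. ((\<lambda>z. X z $ i) has_field_derivative X' $ i) (at z0)"
  shows "isCont (X :: complex \<Rightarrow> complex^3) z0"
  using DERIV_isCont[OF assms] unfolding isCont_def by (intro vec_tendstoI)

lemma line_derivative:
  "((\<lambda>z. (p + z *s q) $ i) has_field_derivative (q :: complex^3) $ i) (at z0)"
  by (auto intro!: derivative_eq_intros)

lemma eventually_norm_less: "norm (z0 :: complex) < r \<Longrightarrow> eventually (\<lambda>z. norm z < r) (nhds z0)"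
  using eventually_nhds_in_open[of "ball 0 r" z0] by (simp add: dist_norm)

context min_multiplicity
begin

text \<open>The case \<open>W1 = 0\<close>, \<open>W2 = Q\<close> of
  \<open>implicit_derivative\<close>, applied to \<open>c (m - 1)\<close>, which vanishes at the
  zeros of \<open>f\<close> by minimality and has slope \<open>m * c m\<close> there.\<close>

lemma root_derivative:
  assumes X: "\<And>i. ((\<lambda>z. X z $ i) has_field_derivative X' $ i) (at z0)"
    and Y: "\<And>i. ((\<lambda>z. Y z $ i) has_field_derivative Y' $ i) (at z0)"
    and \<rho>: "isCont \<rho> z0"
    and zero: "eventually (\<lambda>z. X z \<in> U \<and> Y z + \<rho> z *s Q \<noteq> 0 \<and> f (X z) (Y z + \<rho> z *s Q) = 0) (nhds z0)"
    and cm: "c m (X z0) (Y z0 + \<rho> z0 *s Q) \<noteq> 0"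
    and pq: "p = X z0" "q = Y z0 + \<rho> z0 *s Q"
  shows "(\<rho> has_field_derivative - slope A B X' Y' (p, q, p, q) / (of_nat m * c m p q)) (at z0)"
  unfolding slope_Q_m[symmetric]
proof (rule implicit_derivative[OF factors X Y \<rho>])
  show "eventually (\<lambda>z. c (m - 1) (X z + \<rho> z *s 0) (Y z + \<rho> z *s Q) = 0) (nhds z0)"
    using zero
  proof eventually_elim
    case (elim z)
    then have "c (m - 1) (X z) (Y z + \<rho> z *s Q) = 0" using m_le by (intro minimal) auto
    then show ?case by simp
  qed
  show "p = X z0 + \<rho> z0 *s 0" "q = Y z0 + \<rho> z0 *s Q" using pq by simp_all
  show "slope A B 0 Q (p, q, p, q) \<noteq> 0" using cm m_le by (simp add: slope_Q_m pq)
qed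

text \<open>\<open>f x\<close> vanishes at \<open>p\<close> but not at \<open>Q\<close>, so these
  are different projective points.\<close>

lemma exists_transversal_direction:
  assumes "x \<in> U" "p \<noteq> 0" "f x p = 0" obtains q where "cdot (ccross p Q) q \<noteq> 0"
proof -
  have "ccross p Q \<noteq> 0"
  proof
    assume "ccross p Q = 0"
    then obtain a where "Q = a *s p" using ccross_eq_0_imp assms(2) by blast
    then have "f x Q = 0" using bihom_scaleY[OF bihom_f, of x a p] assms(3) by simp
    then show False using lead_nonzero[OF assms(1)] by simp
  qed
  then show thesis using exists_cdot_nonzero that by blast
qed

text \<open>If no direction \<open>w\<close> worked, the local root function would not depend on \<open>x\<close>, and two nearby
  curves would share infinitely many points.\<close>

lemma exists_moving_point:
  assumes reg: "regular_point x0 p"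
  obtains x y w where "regular_point x y" "slope A B w 0 (x, y, x, y) \<noteq> 0"
proof (rule ccontr)
  assume neg: "\<not> thesis"
  note choose = that
  have stat: "slope A B w 0 (x, y, x, y) = 0" if "regular_point x y" for x y w
    using neg choose[OF that] by blast
  have x0: "x0 \<in> U" "p \<noteq> 0" "f x0 p = 0" using reg by (auto simp: regular_point_def)
  obtain \<delta> \<rho> K r where chart: "root_chart x0 p \<delta> \<rho> K r"
    by (rule root_chart_exists[OF reg zero_less_one])
  note \<delta> = root_chartD(1,2)[OF chart] and inU = root_chartD(5)[OF chart] and y_nz = root_chartD(6)[OF chart]
    and cm = root_chartD(7)[OF chart] and r = root_chartD(8,9)[OF chart] and Lip = root_chartD(11)[OF chart]
  obtain q where q: "cdot (ccross p Q) q \<noteq> 0" by (rule exists_transversal_direction[OF x0])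
  obtain \<epsilon>1 where \<epsilon>1: "\<epsilon>1 > 0" "\<forall>v. norm v < \<epsilon>1 \<longrightarrow> norm (v *s q) < \<delta>"
    by (rule small_multiples[OF \<delta>(1), where q = q])
  define u1 where "u1 = complex_of_real (\<epsilon>1 / 2)"
  have u1: "u1 \<noteq> 0" "norm (u1 *s q) < \<delta>" using \<epsilon>1 by (auto simp: u1_def)
  have "x0 \<noteq> 0" using x0(1) zero_notin_U by blast
  then obtain w where w: "\<forall>\<epsilon> a. \<epsilon> \<noteq> 0 \<longrightarrow> x0 + \<epsilon> *s w \<noteq> a *s x0"
    by (rule exists_nonparallel)
  obtain \<epsilon>2 where \<epsilon>2: "\<epsilon>2 > 0" "\<forall>v. norm v < \<epsilon>2 \<longrightarrow> norm (v *s w) < \<delta>"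
    by (rule small_multiples[OF \<delta>(1), where q = w])
  \<comment> \<open>Scaled so that \<open>x0 + \<tau> *s W\<close> stays in the chart for
    \<open>norm \<tau> < 2\<close>, a disc that contains both 0 and 1.\<close>
  define W where "W = complex_of_real (\<epsilon>2 / 2) *s w"
  have W: "norm (\<tau> *s W) < \<delta>" if "norm \<tau> < 2" for \<tau>
  proof -
    have "norm (\<tau> * complex_of_real (\<epsilon>2 / 2)) < \<epsilon>2" using that \<epsilon>2(1) by (simp add: norm_mult)
    then show ?thesis using \<epsilon>2(2)[rule_format, of "\<tau> * complex_of_real (\<epsilon>2 / 2)"] by (simp add: W_def vector_smult_assoc)
  qed
  \<comment> \<open>By \<open>root_derivative\<close> the derivative of the root along
    \<open>W\<close> is a multiple of a slope that \<open>stat\<close> makes 0.\<close>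
  have const: "r (x0 + W) y = r x0 y" if y: "dist y p < \<delta>" for y
  proof -
    define g where "g = (\<lambda>\<tau>. r (x0 + \<tau> *s W) y)"
    have "(g has_field_derivative 0) (at z)" if z: "norm z < 2" for z
    proof -
      define p' q' where "p' = x0 + z *s W" and "q' = y + g z *s Q"
      have near: "dist (x0 + \<tau> *s W) x0 < \<delta>" if "norm \<tau> < 2" for \<tau> using W[OF that] by (simp add: dist_norm)
      have zero: "f (x0 + \<tau> *s W) (y + g \<tau> *s Q) = 0" "dist (y + g \<tau> *s Q) p < \<rho>" if "norm \<tau> < 2" for \<tau>
        using r(1)[OF near[OF that] y] r(2)[OF near[OF that] y] by (auto simp: g_def)
      have ev: "eventually (\<lambda>\<tau>. norm \<tau> < 2) (nhds z)" using z by (rule eventually_norm_less)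
      have cont: "isCont g z"
      proof (rule isCont_by_bound[where h = "\<lambda>\<tau>. x0 + \<tau> *s W" and K = K])
        show "eventually (\<lambda>\<tau>. norm (g \<tau> - g z) \<le> K * norm (x0 + \<tau> *s W - (x0 + z *s W))) (nhds z)"
          using ev by eventually_elim (use Lip[OF near[OF z] y near y] in \<open>simp add: g_def\<close>)
        show "isCont (\<lambda>\<tau>. x0 + \<tau> *s W) z" by (rule isCont_vec) (rule line_derivative)
      qed
      have reg': "regular_point p' q'"
        using zero[OF z] near[OF z] \<delta>(2) inU[of p'] y_nz[of q'] cm[of p' q']
        by (simp add: regular_point_def p'_def q'_def)
      have "(g has_field_derivative - slope A B W 0 (p', q', p', q') / (of_nat m * c m p' q')) (at z)"
      proof (rule root_derivative[where X = "\<lambda>\<tau>. x0 + \<tau> *s W" and Y = "\<lambda>\<tau>. y"])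
        show "eventually (\<lambda>\<tau>. x0 + \<tau> *s W \<in> U \<and> y + g \<tau> *s Q \<noteq> 0 \<and> f (x0 + \<tau> *s W) (y + g \<tau> *s Q) = 0) (nhds z)"
          using ev
        proof eventually_elim
          case (elim \<tau>)
          then show ?case using zero[OF elim] near[OF elim] \<delta>(2) inU y_nz by auto
        qed
        show "c m (x0 + z *s W) (y + g z *s Q) \<noteq> 0" using reg' by (simp add: regular_point_def p'_def q'_def)
      qed (use cont in \<open>simp_all add: p'_def q'_def line_derivative del: vector_add_component\<close>)
      then show ?thesis by (simp add: stat[OF reg'])
    qed
    then have "\<exists>k. \<forall>z\<in>ball 0 2. g z = k"
      by (intro has_field_derivative_zero_constant) (auto intro: has_field_derivative_at_within)
    then have "g 1 = g 0" by auto
    then show ?thesis by (simp add: g_def)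
  qed
  have near: "dist (x0 + W) x0 < \<delta>" "dist x0 x0 < \<delta>" using W[of 1] \<delta>(1) by (simp_all add: dist_norm)
  have near_y: "dist p p < \<delta>" "dist (p + u1 *s q) p < \<delta>" using u1(2) \<delta>(1) by (simp_all add: dist_norm)
  define y0 where "y0 = p + r x0 p *s Q"
  define y1 where "y1 = p + u1 *s q + r x0 (p + u1 *s q) *s Q"
  \<comment> \<open>The curves of \<open>x0\<close> and \<open>x0 + W\<close> share the points on
    two different lines through \<open>Q\<close>.\<close>
  show False
  proof (rule grid[of x0 "x0 + W" y0 y1])
    show "f x0 y0 = 0" "f x0 y1 = 0" using r(1)[OF near(2) near_y(1)] r(1)[OF near(2) near_y(2)] by (auto simp: y0_def y1_def)
    show "f (x0 + W) y0 = 0" "f (x0 + W) y1 = 0"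
      using r(1)[OF near(1) near_y(1)] r(1)[OF near(1) near_y(2)] const[OF near_y(1)] const[OF near_y(2)] by (auto simp: y0_def y1_def)
    show "y0 \<noteq> 0" "y1 \<noteq> 0"
      using r(2)[OF near(2) near_y(1)] r(2)[OF near(2) near_y(2)] y_nz by (auto simp: y0_def y1_def)
    show "x0 \<in> U" "x0 + W \<in> U" using near \<delta>(2) by (auto intro!: inU)
    show "x0 + W \<noteq> a *s x0" for a unfolding W_def using \<epsilon>2(1) by (intro w[rule_format]) simp
    show "y1 \<noteq> a *s y0" for a
      using pencil_points_distinct[OF q u1(1), of "r x0 (p + u1 *s q)" a "r x0 p"] by (simp add: y0_def y1_def)
  qed
qed

end

context min_multiplicity
begin

text \<open>The curves are given near \<open>p\<close> by \<open>p + u q + r0 u Q\<close> and \<open>p + u q + r1 u Q\<close>, so the lower bound on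
  \<open>r0 - r1\<close> says that they are not tangent.\<close>

definition transversal_pair :: "complex^3 \<Rightarrow> complex^3 \<Rightarrow> complex^3 \<Rightarrow> complex^3 \<Rightarrow> bool" where
  "transversal_pair x0 x1 p q \<longleftrightarrow> regular_point x0 p \<and> regular_point x1 p \<and> (\<forall>a. x1 \<noteq> a *s x0) \<and>
    cdot (ccross p Q) q \<noteq> 0 \<and>
    (\<exists>\<beta> \<eta> \<epsilon> r0 r1. \<beta> > 0 \<and> \<eta> > 0 \<and> \<epsilon> > 0 \<and>
      (\<forall>u. norm u < \<eta> \<longrightarrow> f x0 (p + u *s q + r0 u *s Q) = 0 \<and> f x1 (p + u *s q + r1 u *s Q) = 0 \<and>
         \<beta> * norm u \<le> norm (r0 u - r1 u) \<and>
         (\<forall>v. norm v < \<epsilon> \<longrightarrow> f x0 (p + u *s q + v *s Q) = 0 \<longrightarrow> v = r0 u)) \<and>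
      isCont r0 0 \<and> isCont r1 0 \<and> r0 0 = 0 \<and> r1 0 = 0)"

text \<open>The nonzero slope makes the parameter \<open>\<tau>\<close> of the curves
  \<open>x0 + \<tau> *s w\<close> a Lipschitz function of the point that the curve passes through.
  Hence linear growth of \<open>T u\<close>, which follows from its nonzero derivative, forces
  linear separation of the curves of \<open>x0\<close> and \<open>x1\<close>.\<close>

lemma exists_transversal_pair:
  assumes reg: "regular_point x0 p" and moving: "slope A B w 0 (x0, p, x0, p) \<noteq> 0"
  shows "\<exists>x1 q. transversal_pair x0 x1 p q"
proof -
  have x0: "x0 \<in> U" "p \<noteq> 0" "f x0 p = 0" "c m x0 p \<noteq> 0" using reg by (auto simp: regular_point_def)
  obtain \<rho>T KT where \<rho>T: "\<rho>T > 0" "KT > 0" and LipT: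
    "\<And>x y x' y' v v'. dist (x + v *s w) x0 < \<rho>T \<Longrightarrow> dist (y + v *s 0) p < \<rho>T \<Longrightarrow>
      dist (x' + v' *s w) x0 < \<rho>T \<Longrightarrow> dist (y' + v' *s 0) p < \<rho>T \<Longrightarrow>
      c (m - 1) (x + v *s w) (y + v *s 0) = 0 \<Longrightarrow> c (m - 1) (x' + v' *s w) (y' + v' *s 0) = 0 \<Longrightarrow>
      norm (v' - v) \<le> KT * (norm (x' - x) + norm (y' - y))"
    using transversal_Lipschitz[OF factors moving] by metis
  define N where "N = {z. slope A B w 0 (fst z, snd z, fst z, snd z) \<noteq> 0}"
  have "open N" unfolding N_def
    by (intro open_Collect_neq continuous_on_compose2[OF continuous_on_slope[OF factors]] continuous_intros subset_UNIV)
  moreover have "(x0, p) \<in> N" using moving by (simp add: N_def)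
  ultimately obtain \<rho>N where \<rho>N: "\<rho>N > 0" "\<forall>x y. dist x x0 < \<rho>N \<longrightarrow> dist y p < \<rho>N \<longrightarrow> (x, y) \<in> N"
    using open_pair_ball[of N x0 p] by metis
  define \<epsilon>0 where "\<epsilon>0 = min \<rho>T \<rho>N"
  have \<epsilon>0: "\<epsilon>0 > 0" "\<epsilon>0 \<le> \<rho>T" "\<epsilon>0 \<le> \<rho>N" using \<rho>T(1) \<rho>N(1) by (auto simp: \<epsilon>0_def)
  obtain \<delta> \<rho> K r where \<rho>: "\<rho> \<le> \<epsilon>0" and chart: "root_chart x0 p \<delta> \<rho> K r"
    by (rule root_chart_exists[OF reg \<epsilon>0(1)])
  note \<delta> = root_chartD(1,2)[OF chart] and K = root_chartD(3)[OF chart] and r0 = root_chartD(4)[OF chart]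
    and inU = root_chartD(5)[OF chart] and y_nz = root_chartD(6)[OF chart]
    and cm = root_chartD(7)[OF chart] and r = root_chartD(8,9)[OF chart] and uniq = root_chartD(10)[OF chart]
    and Lip = root_chartD(11)[OF chart]
  have \<psi>: "c (m - 1) x y = 0" if "dist x x0 < \<rho>" "dist y p < \<rho>" "f x y = 0" for x y
    using that m_le by (intro minimal inU y_nz) auto
  have LipT': "norm (v' - v) \<le> KT * norm (y' - y)"
    if "dist (x0 + v *s w) x0 < \<rho>" "dist y p < \<rho>" "dist (x0 + v' *s w) x0 < \<rho>" "dist y' p < \<rho>"
      "f (x0 + v *s w) y = 0" "f (x0 + v' *s w) y' = 0" for v v' y y'
  proof -
    have "norm (v' - v) \<le> KT * (norm (x0 - x0) + norm (y' - y))"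
      using that \<psi>[OF that(1,2,5)] \<psi>[OF that(3,4,6)] \<rho> \<epsilon>0 by (intro LipT) auto
    then show ?thesis by simp
  qed
  obtain q where q: "cdot (ccross p Q) q \<noteq> 0" by (rule exists_transversal_direction[OF x0(1-3)])
  have x0_nz: "x0 \<noteq> 0" using x0(1) zero_notin_U by blast
  have half: "\<delta> / 2 > 0" "\<rho> / 2 > 0" using \<delta> by auto
  obtain \<epsilon>w where \<epsilon>w: "\<epsilon>w > 0" "\<forall>v. norm v < \<epsilon>w \<longrightarrow> norm (v *s w) < \<delta> / 2"
    by (rule small_multiples[OF half(1), where q = w])
  \<comment> \<open>Both the independence of \<open>x0\<close> and \<open>w\<close> and the
    application of \<open>roots_persist\<close> rest on this.\<close>
  have not_all: "\<exists>\<tau>. f (x0 + \<tau> *s w) p \<noteq> 0"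
  proof (rule ccontr)
    assume "\<not> ?thesis"
    then have *: "f (x0 + \<tau> *s w) p = 0" for \<tau> by blast
    define \<tau> where "\<tau> = complex_of_real (\<epsilon>w / 2)"
    have "norm \<tau> < \<epsilon>w" using \<epsilon>w(1) by (simp add: \<tau>_def)
    then have "norm (\<tau> *s w) < \<rho>" using \<epsilon>w(2) \<delta> by fastforce
    then have "norm (\<tau> - 0) \<le> KT * norm (p - p)"
      using \<delta> *[of 0] *[of \<tau>] by (intro LipT') (auto simp: dist_norm)
    then show False using \<epsilon>w(1) by (simp add: \<tau>_def)
  qed
  have l: "ccross x0 w \<noteq> 0"
  proof
    assume "ccross x0 w = 0"
    then obtain a where a: "w = a *s x0" by (rule ccross_eq_0_imp[OF _ x0_nz])
    have "f (x0 + \<tau> *s w) p = 0" for \<tau>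
    proof -
      have "x0 + \<tau> *s w = (1 + \<tau> * a) *s x0" by (simp add: a vec_eq_iff algebra_simps)
      then show ?thesis by (simp only: bihom_scaleX[OF bihom_f] x0(3) mult_zero_right)
    qed
    then show False using not_all by blast
  qed
  \<comment> \<open>Moving in the direction \<open>w1\<close> leaves the plane spanned by
    \<open>x0\<close> and \<open>w\<close>, so \<open>x1\<close> will differ projectively from every
    \<open>x0 + \<tau> *s w\<close>.\<close>
  obtain w1 where w1: "cdot (ccross x0 w) w1 \<noteq> 0" using exists_cdot_nonzero[OF l] .
  \<comment> \<open>Persistence of its root is used twice: with \<open>\<sigma> \<noteq> 0\<close>
    and the point \<open>p\<close> to find \<open>x1\<close>, and with \<open>\<sigma> = 0\<close>
    and the point \<open>y u\<close> to find \<open>T u\<close>.\<close>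
  define h where "h = (\<lambda>(s :: complex \<times> (complex^3)) \<tau>. f (x0 + fst s *s w1 + \<tau> *s w) (snd s))"
  have "continuous_on UNIV (\<lambda>(s, v). h s v)"
    unfolding h_def case_prod_unfold by (intro bihom_continuous[OF bihom_f] continuous_intros)
  moreover have "h s holomorphic_on UNIV" for s
    unfolding h_def by (intro bihom_holomorphic[OF bihom_f]) (simp_all, intro holomorphic_intros)
  moreover have "h (0, p) 0 = 0" using x0 by (simp add: h_def)
  moreover obtain v1 where "h (0, p) v1 \<noteq> 0" using not_all by (auto simp: h_def)
  ultimately obtain \<delta>1 where \<delta>1: "\<delta>1 > 0" "\<And>s. dist s (0, p) < \<delta>1 \<Longrightarrow> \<exists>v. dist v 0 < \<epsilon>w \<and> h s v = 0"
    using roots_persist[of h "(0, p)" 0 v1 \<epsilon>w] \<epsilon>w(1) by metis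
  have in_ball: "(0, p) \<in> ball (0 :: complex, p) \<delta>1" using \<delta>1 by simp
  obtain \<delta>2 where \<delta>2: "\<delta>2 > 0" "\<forall>(\<sigma>::complex) y. dist \<sigma> 0 < \<delta>2 \<longrightarrow> dist y p < \<delta>2 \<longrightarrow> (\<sigma>, y) \<in> ball (0, p) \<delta>1"
    by (rule open_pair_ball[OF open_ball in_ball])
  have root: "\<exists>\<tau>. norm \<tau> < \<epsilon>w \<and> f (x0 + \<sigma> *s w1 + \<tau> *s w) y = 0" if "norm \<sigma> < \<delta>2" "dist y p < \<delta>2" for \<sigma> y
    using \<delta>1(2)[of "(\<sigma>, y)"] \<delta>2(2)[rule_format, of \<sigma> y] that by (auto simp: h_def dist_commute)
  obtain \<epsilon>1 where \<epsilon>1: "\<epsilon>1 > 0" "\<forall>v. norm v < \<epsilon>1 \<longrightarrow> norm (v *s w1) < \<delta> / 2"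
    by (rule small_multiples[OF half(1), where q = w1])
  define \<sigma> where "\<sigma> = complex_of_real (min \<epsilon>1 \<delta>2 / 2)"
  have "min \<epsilon>1 \<delta>2 > 0" using \<epsilon>1(1) \<delta>2(1) by simp
  then have \<sigma>: "\<sigma> \<noteq> 0" "norm \<sigma> < \<epsilon>1" "norm \<sigma> < \<delta>2" unfolding \<sigma>_def norm_of_real by auto
  obtain \<tau>1 where \<tau>1: "norm \<tau>1 < \<epsilon>w" "f (x0 + \<sigma> *s w1 + \<tau>1 *s w) p = 0"
    using root[OF \<sigma>(3), of p] \<delta>2(1) by auto
  define x1 where "x1 = x0 + \<sigma> *s w1 + \<tau>1 *s w"
  have x1_near: "dist x1 x0 < \<delta>"
  proof -
    have "norm (\<sigma> *s w1 + \<tau>1 *s w) < \<delta> / 2 + \<delta> / 2"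
      using \<epsilon>1(2) \<epsilon>w(2) \<sigma>(2) \<tau>1(1) by (intro norm_triangle_lt add_strict_mono) auto
    then show ?thesis by (simp add: x1_def dist_norm add.assoc)
  qed
  have x1: "x1 \<in> U" "f x1 p = 0" using inU[of x1] x1_near \<delta>(2) \<tau>1(2) by (auto simp: x1_def)
  have reg1: "regular_point x1 p"
    using x1 x0(2) cm[of x1 p] x1_near \<delta> by (simp add: regular_point_def)
  have x1_off: "x1 \<noteq> a *s (x0 + \<tau> *s w)" for a \<tau>
  proof
    assume "x1 = a *s (x0 + \<tau> *s w)"
    then have "cdot (ccross x0 w) x1 = 0" by simp
    moreover have "cdot (ccross x0 w) x1 = \<sigma> * cdot (ccross x0 w) w1" by (simp add: x1_def)
    ultimately show False using \<sigma>(1) w1 by simp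
  qed
  define R0 where "R0 = (\<lambda>u. r x0 (p + u *s q))"
  define R1 where "R1 = (\<lambda>u. r x1 (p + u *s q))"
  have R1_0: "R1 0 = 0" using uniq[of x1 p 0] x1_near x1 \<delta> by (simp add: R1_def)
  have R0_0: "R0 0 = 0" using r0 by (simp add: R0_def)
  define y where "y = (\<lambda>u. p + u *s q + R1 u *s Q)"
  have y_0: "y 0 = p" by (simp add: y_def R1_0)
  \<comment> \<open>Chosen so that both parts of \<open>y u - p\<close>, namely
    \<open>u *s q\<close> and the root along \<open>Q\<close> bounded by the Lipschitz constant,
    together stay below \<open>min \<delta> \<delta>2\<close>.\<close>
  define \<kappa> where "\<kappa> = min \<delta> \<delta>2 / (1 + K * (3 * norm Q))"
  have den: "1 + K * (3 * norm Q) > 0" using K by (simp add: add_pos_nonneg)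
  have \<kappa>: "\<kappa> > 0" "\<kappa> * (1 + K * (3 * norm Q)) = min \<delta> \<delta>2" using \<delta>(1) \<delta>2(1) den by (simp_all add: \<kappa>_def)
  have \<kappa>_le: "\<kappa> \<le> \<delta>"
  proof -
    have "\<kappa> * 1 \<le> \<kappa> * (1 + K * (3 * norm Q))" using \<kappa>(1) K by (intro mult_left_mono) auto
    then show ?thesis unfolding \<kappa>(2) by simp
  qed
  obtain \<eta> where \<eta>: "\<eta> > 0" "\<forall>u. norm u < \<eta> \<longrightarrow> norm (u *s q) < \<kappa>" by (rule small_multiples[OF \<kappa>(1), where q = q])
  have near: "dist (p + u *s q) p < \<delta>" if "norm u < \<eta>" for u
    using \<eta>(2) that \<kappa>_le by (force simp: dist_norm)
  have p_near: "dist p p < \<delta>" "dist x0 x0 < \<delta>" using \<delta>(1) by auto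
  have R1: "f x1 (y u) = 0" "dist (y u) p < \<rho>" if "norm u < \<eta>" for u
    using r[OF x1_near near[OF that]] by (auto simp: y_def R1_def)
  have y_near: "dist (y u) p < min \<delta> \<delta>2" if "norm u < \<eta>" for u
  proof -
    have "norm (R1 u - R1 0) \<le> K * (norm (x1 - x1) + norm (p + u *s q - p))"
      using Lip[OF x1_near p_near(1) x1_near near[OF that]] by (simp add: R1_def)
    then have "norm (R1 u) \<le> K * norm (u *s q)" by (simp add: R1_0)
    then have "norm (R1 u) * (3 * norm Q) \<le> K * norm (u *s q) * (3 * norm Q)" by (intro mult_right_mono) auto
    with norm_vsmult[of "R1 u" Q] have "norm (R1 u *s Q) \<le> K * norm (u *s q) * (3 * norm Q)" by linarith
    then have "norm (u *s q + R1 u *s Q) \<le> norm (u *s q) + K * norm (u *s q) * (3 * norm Q)"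
      by (intro norm_triangle_le) simp
    also have "\<dots> = norm (u *s q) * (1 + K * (3 * norm Q))" by (simp add: algebra_simps)
    also have "\<dots> < \<kappa> * (1 + K * (3 * norm Q))" using \<eta>(2) that den by (intro mult_strict_right_mono) auto
    finally show ?thesis unfolding \<kappa>(2) by (simp add: y_def dist_norm add.assoc)
  qed
  have line_cont: "isCont (\<lambda>u. p + u *s q) z" for z by (rule isCont_vec) (rule line_derivative)
  have R_cont: "isCont (\<lambda>u. r x (p + u *s q)) z" if "norm z < \<eta>" "dist x x0 < \<delta>" for z x
  proof (rule isCont_by_bound[where h = "\<lambda>u. p + u *s q" and K = K])
    show "eventually (\<lambda>u. norm (r x (p + u *s q) - r x (p + z *s q)) \<le> K * norm (p + u *s q - (p + z *s q))) (nhds z)"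
      using eventually_norm_less[OF that(1)]
    proof eventually_elim
      case (elim u)
      show ?case using Lip[OF that(2) near[OF that(1)] that(2) near[OF elim]] by simp
    qed
  qed (rule line_cont)
  have R1_deriv: "\<exists>D. (R1 has_field_derivative D) (at z)" if z: "norm z < \<eta>" for z
  proof -
    have "(R1 has_field_derivative - slope A B 0 q (x1, y z, x1, y z) / (of_nat m * c m x1 (y z))) (at z)"
    proof (rule root_derivative[where X = "\<lambda>u. x1" and Y = "\<lambda>u. p + u *s q"])
      show "isCont R1 z" unfolding R1_def by (rule R_cont[OF z x1_near])
      show "eventually (\<lambda>u. x1 \<in> U \<and> p + u *s q + R1 u *s Q \<noteq> 0 \<and> f x1 (p + u *s q + R1 u *s Q) = 0) (nhds z)"
        using eventually_norm_less[OF z]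
      proof eventually_elim
        case (elim u)
        show ?case using R1[OF elim] x1(1) y_nz[of "y u"] by (simp add: y_def)
      qed
      show "c m x1 (p + z *s q + R1 z *s Q) \<noteq> 0"
        using cm[of x1 "y z"] x1_near \<delta>(2) R1(2)[OF z] by (simp add: y_def)
    qed (simp_all add: y_def line_derivative del: vector_add_component)
    then show ?thesis by blast
  qed
  have ex_T: "\<exists>\<tau>. norm \<tau> < \<epsilon>w \<and> f (x0 + \<tau> *s w) (y u) = 0" if "norm u < \<eta>" for u
    using root[of 0 "y u"] y_near[OF that] \<delta>2(1) by simp
  then obtain T where T: "\<And>u. norm u < \<eta> \<Longrightarrow> norm (T u) < \<epsilon>w \<and> f (x0 + T u *s w) (y u) = 0" by metis
  have T_near: "dist (x0 + T u *s w) x0 < \<rho>" if "norm u < \<eta>" for u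
  proof -
    have "norm (T u *s w) < \<delta> / 2" using \<epsilon>w(2) T[OF that] by blast
    then show ?thesis using \<delta> by (simp add: dist_norm)
  qed
  have near0: "dist (x0 + 0 *s w) x0 < \<rho>" using \<delta> by simp
  have \<eta>0: "norm (0::complex) < \<eta>" using \<eta>(1) by simp
  \<comment> \<open>The curve of \<open>x0\<close> itself passes through \<open>y 0 = p\<close>, and
    the parameter for a given point is unique.\<close>
  have T_0: "T 0 = 0"
    using LipT'[OF near0 R1(2)[OF \<eta>0] T_near[OF \<eta>0] R1(2)[OF \<eta>0] _ conjunct2[OF T[OF \<eta>0]]] x0(3) by (simp add: y_0)
  have y_deriv: "\<exists>Y'. \<forall>i. ((\<lambda>u. y u $ i) has_field_derivative Y' $ i) (at z)" if z: "norm z < \<eta>" for z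
  proof -
    obtain D where D: "(R1 has_field_derivative D) (at z)" using R1_deriv[OF z] by blast
    have "((\<lambda>u. y u $ i) has_field_derivative (q + D *s Q) $ i) (at z)" for i
      unfolding y_def by (auto intro!: derivative_eq_intros D)
    then show ?thesis by blast
  qed
  have T_deriv: "T field_differentiable (at z)" if z: "norm z < \<eta>" for z
  proof -
    obtain Y' where Y': "\<And>i. ((\<lambda>u. y u $ i) has_field_derivative Y' $ i) (at z)" using y_deriv[OF z] by blast
    have cont: "isCont T z"
    proof (rule isCont_by_bound[where h = y and K = KT])
      show "eventually (\<lambda>u. norm (T u - T z) \<le> KT * norm (y u - y z)) (nhds z)"
        using eventually_norm_less[OF z]
      proof eventually_elim
        case (elim u)
        show ?case
          by (rule LipT'[OF T_near[OF z] R1(2)[OF z] T_near[OF elim] R1(2)[OF elim] conjunct2[OF T[OF z]] conjunct2[OF T[OF elim]]])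
      qed
    qed (rule isCont_vec[OF Y'])
    define xz where "xz = x0 + T z *s w"
    have "(T has_field_derivative - slope A B 0 Y' (xz, y z, xz, y z) / slope A B w 0 (xz, y z, xz, y z)) (at z)"
    proof (rule implicit_derivative[OF factors _ Y' cont, where X = "\<lambda>_. x0"])
      show "eventually (\<lambda>u. c (m - 1) (x0 + T u *s w) (y u + T u *s 0) = 0) (nhds z)"
        using eventually_norm_less[OF z]
      proof eventually_elim
        case (elim u)
        show ?case using \<psi>[OF T_near[OF elim] R1(2)[OF elim]] T[OF elim] by simp
      qed
      have "dist xz x0 < \<rho>N" "dist (y z) p < \<rho>N" using T_near[OF z] R1(2)[OF z] \<rho> \<epsilon>0 by (auto simp: xz_def)
      then show "slope A B w 0 (xz, y z, xz, y z) \<noteq> 0" using \<rho>N(2) by (fastforce simp: N_def)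
    qed (simp_all add: xz_def)
    then show ?thesis by (auto simp: field_differentiable_def)
  qed
  have T_hol: "T holomorphic_on ball 0 \<eta>"
    using T_deriv by (auto simp: holomorphic_on_def intro: field_differentiable_at_within)
  \<comment> \<open>If \<open>T u = T u'\<close>, the curves of \<open>x0 + T u *s w\<close> and
    \<open>x1\<close> would share the two points \<open>y u\<close> and \<open>y u'\<close>;
    \<open>x1_off\<close> makes these parameters distinct.\<close>
  have T_inj: "inj_on T (ball 0 \<eta>)"
  proof (rule inj_onI, rule ccontr)
    fix u u' assume u: "u \<in> ball 0 \<eta>" "u' \<in> ball 0 \<eta>" "T u = T u'" "u \<noteq> u'"
    then have n: "norm u < \<eta>" "norm u' < \<eta>" by simp_all
    show False
    proof (rule grid[of "x0 + T u *s w" x1 "y u'" "y u"])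
      show "x0 + T u *s w \<in> U" by (rule inU[OF T_near[OF n(1)]])
      show "y u' \<noteq> 0" "y u \<noteq> 0" using R1(2)[OF n(1)] R1(2)[OF n(2)] y_nz by blast+
      show "f (x0 + T u *s w) (y u') = 0" "f (x0 + T u *s w) (y u) = 0" using T[OF n(1)] T[OF n(2)] u(3) by simp_all
      show "f x1 (y u') = 0" "f x1 (y u) = 0" using R1(1) n by blast+
      show "y u \<noteq> a *s y u'" for a unfolding y_def by (rule pencil_points_distinct[OF q u(4)])
    qed (rule x1 x1_off)+
  qed
  have "deriv T 0 \<noteq> 0"
    using \<eta>(1) by (intro holomorphic_injective_imp_regular[OF T_hol _ T_inj]) auto
  moreover have "(T has_field_derivative deriv T 0) (at 0)"
    using T_deriv[OF \<eta>0] by (rule field_differentiable_derivI)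
  then have "((\<lambda>u. norm (T u / u)) \<longlongrightarrow> norm (deriv T 0)) (at 0)"
    using tendsto_field_quotient[of T "deriv T 0" 0] by (intro tendsto_norm) (simp add: T_0)
  ultimately have "eventually (\<lambda>u. norm (deriv T 0) / 2 < norm (T u / u)) (at 0)"
    by (intro order_tendstoD) auto
  then obtain \<eta>1 where \<eta>1: "\<eta>1 > 0" "\<And>u. u \<noteq> 0 \<Longrightarrow> dist u 0 < \<eta>1 \<Longrightarrow> norm (deriv T 0) / 2 < norm (T u / u)"
    unfolding eventually_at by auto
  define \<beta>1 where "\<beta>1 = norm (deriv T 0) / 2"
  have \<beta>1: "\<beta>1 > 0" using \<open>deriv T 0 \<noteq> 0\<close> by (simp add: \<beta>1_def)
  have T_lower: "\<beta>1 * norm u \<le> norm (T u)" if "norm u < \<eta>1" for u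
    using \<eta>1(2)[of u] that by (cases "u = 0") (auto simp: \<beta>1_def norm_divide field_simps)
  define \<beta> where "\<beta> = \<beta>1 / (KT * (3 * norm Q + 1))"
  have denT: "KT * (3 * norm Q + 1) > 0" using \<rho>T(2) by (simp add: add_nonneg_pos)
  have \<beta>: "\<beta> > 0" using \<beta>1 denT by (simp add: \<beta>_def)
  have lower: "\<beta> * norm u \<le> norm (R0 u - R1 u)" if u: "norm u < min \<eta> \<eta>1" for u
  proof -
    have n: "norm u < \<eta>" "norm u < \<eta>1" using u by auto
    define y' where "y' = p + u *s q + R0 u *s Q"
    have y': "f x0 y' = 0" "dist y' p < \<rho>" using r[OF p_near(2) near[OF n(1)]] by (auto simp: y'_def R0_def)
    \<comment> \<open>Parameter 0 belongs to the point \<open>y'\<close> and parameter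
      \<open>T u\<close> to \<open>y u\<close>, both on the same line through \<open>Q\<close>, so
      the points are at least as far apart as the parameters, up to \<open>KT\<close>.\<close>
    have "norm (T u - 0) \<le> KT * norm (y u - y')"
      using T[OF n(1)] y' by (intro LipT' T_near n R1 near0) auto
    also have "y u - y' = (R1 u - R0 u) *s Q" by (simp add: y_def y'_def vec_eq_iff algebra_simps)
    finally have "norm (T u) \<le> KT * norm ((R1 u - R0 u) *s Q)" by simp
    also have "\<dots> \<le> KT * (norm (R1 u - R0 u) * (3 * norm Q + 1))"
      using norm_vsmult[of "R1 u - R0 u" Q] \<rho>T(2)
      by (intro mult_left_mono) (auto simp: distrib_left intro!: add_increasing2)
    also have "\<dots> = norm (R0 u - R1 u) * (KT * (3 * norm Q + 1))" by (simp add: norm_minus_commute)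
    finally have "\<beta>1 * norm u \<le> norm (R0 u - R1 u) * (KT * (3 * norm Q + 1))" using T_lower[OF n(2)] by linarith
    then show ?thesis using denT by (simp add: \<beta>_def field_simps)
  qed
  obtain \<epsilon>Q where \<epsilon>Q: "\<epsilon>Q > 0" "\<forall>v. norm v < \<epsilon>Q \<longrightarrow> norm (v *s Q) < \<rho> / 2"
    by (rule small_multiples[OF half(2), where q = Q])
  obtain \<eta>2 where \<eta>2: "\<eta>2 > 0" "\<forall>u. norm u < \<eta>2 \<longrightarrow> norm (u *s q) < \<rho> / 2"
    by (rule small_multiples[OF half(2), where q = q])
  define \<eta>3 where "\<eta>3 = min (min \<eta> \<eta>1) \<eta>2"
  have \<eta>3: "\<eta>3 > 0" "\<eta>3 \<le> \<eta>" "\<eta>3 \<le> min \<eta> \<eta>1" "\<eta>3 \<le> \<eta>2" using \<eta>(1) \<eta>1(1) \<eta>2(1) by (auto simp: \<eta>3_def)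
  have main: "f x0 (p + u *s q + R0 u *s Q) = 0 \<and> f x1 (p + u *s q + R1 u *s Q) = 0 \<and>
         \<beta> * norm u \<le> norm (R0 u - R1 u) \<and>
         (\<forall>v. norm v < \<epsilon>Q \<longrightarrow> f x0 (p + u *s q + v *s Q) = 0 \<longrightarrow> v = R0 u)" if u: "norm u < \<eta>3" for u
  proof (intro conjI allI impI)
    have n: "norm u < \<eta>" "norm u < min \<eta> \<eta>1" "norm u < \<eta>2" using u \<eta>3 by linarith+
    show "f x0 (p + u *s q + R0 u *s Q) = 0" using r[OF p_near(2) near[OF n(1)]] by (simp add: R0_def)
    show "f x1 (p + u *s q + R1 u *s Q) = 0" using R1(1)[OF n(1)] by (simp add: y_def)
    show "\<beta> * norm u \<le> norm (R0 u - R1 u)" by (rule lower[OF n(2)])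
    fix v assume v: "norm v < \<epsilon>Q" "f x0 (p + u *s q + v *s Q) = 0"
    have "norm (u *s q + v *s Q) < \<rho> / 2 + \<rho> / 2"
      using \<eta>2(2) \<epsilon>Q(2) v(1) n(3) by (intro norm_triangle_lt add_strict_mono) auto
    then have "dist (p + u *s q + v *s Q) p < \<rho>" by (simp add: dist_norm add.assoc)
    then show "v = R0 u" unfolding R0_def by (rule uniq[OF p_near(2) near[OF n(1)] v(2)])
  qed
  have "isCont R0 0" "isCont R1 0" unfolding R0_def R1_def
    by (rule R_cont[OF \<eta>0 p_near(2)], rule R_cont[OF \<eta>0 x1_near])
  moreover have "x1 \<noteq> a *s x0" for a using x1_off[of a 0] by simp
  ultimately have "transversal_pair x0 x1 p q"
    unfolding transversal_pair_def using reg reg1 q \<beta> \<eta>3(1) \<epsilon>Q(1) main R0_0 R1_0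
    by (intro conjI exI[of _ \<beta>] exI[of _ \<eta>3] exI[of _ \<epsilon>Q] exI[of _ R0] exI[of _ R1]) auto
  then show ?thesis by blast
qed

end

section \<open>Roots on the lines through the centre: multiplicity, scaling and bounds\<close>

lemma proots_prod_linear: "proots (\<Prod>x\<in>#M. [:- g x, 1 :: complex:]) = image_mset g M"
proof (induction M)
  case (add x M)
  have "(\<Prod>x\<in>#M. [:- g x, 1:]) \<noteq> 0" by (auto simp: prod_mset_zero_iff)
  then show ?case using add.IH by (simp add: proots_mult del: mult_pCons_left)
qed simp

lemma prod_mset_lower_bound:
  fixes h :: "'a \<Rightarrow> complex"
  assumes "\<And>x. x \<in># N \<Longrightarrow> \<gamma> \<le> norm (h x)" "0 \<le> \<gamma>"
  shows "\<gamma> ^ size N \<le> norm (\<Prod>x\<in>#N. h x)"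
  using assms(1)
proof (induction N)
  case (add x N)
  have "\<gamma> * \<gamma> ^ size N \<le> norm (h x) * norm (\<Prod>x\<in>#N. h x)"
    using assms(2) by (intro mult_mono add.IH) (auto intro: add.prems)
  then show ?case by (simp add: norm_mult)
qed simp

lemma pencil_point_eq_base:
  assumes "cdot (ccross p Q) q \<noteq> 0" "p + u *s q + v *s Q = a *s p"
  shows "u = 0 \<and> v = 0"
proof -
  have "cdot (ccross p Q) (p + u *s q + v *s Q) = cdot (ccross p Q) (a *s p)"
    "cdot (ccross p q) (p + u *s q + v *s Q) = cdot (ccross p q) (a *s p)"
    using assms(2) by (simp_all only:)
  moreover have "cdot (ccross p q) Q = - cdot (ccross p Q) q" by (simp add: cdot_3 ccross_def algebra_simps)
  ultimately show ?thesis using assms(1) by simp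
qed

lemma pencil_point_nonzero:
  assumes "cdot (ccross p Q) q \<noteq> 0" shows "p + u *s q + v *s Q \<noteq> 0"
proof
  assume "p + u *s q + v *s Q = 0"
  then have "cdot (ccross q Q) (p + u *s q + v *s Q) = 0" by (simp only: cdot_0)
  then show False using assms cdot_ccross_swap[of p Q q] by simp
qed

lemma isCont_bihom:
  fixes Y :: "complex \<Rightarrow> complex^3"
  assumes "bihom d e g" "isCont Y z" shows "isCont (\<lambda>u. g x (Y u)) z"
proof -
  have "continuous_on UNIV (\<lambda>y. g x y)"
    by (rule bihom_continuous[OF assms(1)]) (intro continuous_intros)+
  then have "isCont (\<lambda>y. g x y) (Y z)" by (simp add: continuous_on_eq_continuous_at)
  then show ?thesis using assms(2) by (rule isCont_o2[rotated])
qed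

context gridfree_family
begin

text \<open>After the shift by \<open>v\<close> the order is the index of the first nonzero
  coefficient.\<close>

lemma order_P:
  assumes x: "x \<in> U" and low: "\<And>j. j < m \<Longrightarrow> c j x (y + v *s Q) = 0" and top: "c m x (y + v *s Q) \<noteq> 0" and "m \<le> e"
  shows "order v (P x y) = m"
proof -
  have "monom 1 m dvd P x (y + v *s Q)"
    unfolding monom_1_dvd_iff' using low by (simp add: coeff_P)
  then obtain g where g: "P x (y + v *s Q) = monom 1 m * g" by blast
  have g0: "poly g 0 \<noteq> 0"
  proof -
    have "coeff (P x (y + v *s Q)) m = coeff g 0" unfolding g by (simp add: coeff_monom_mult)
    then show ?thesis using top \<open>m \<le> e\<close> by (simp add: coeff_P poly_0_coeff_0)
  qed
  have "P x y = pcompose (P x (y + v *s Q)) [:- v, 1:]"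
  proof -
    have "y + v *s Q + (- v) *s Q = y" by (simp add: vec_eq_iff)
    then show ?thesis using P_shift[of x "y + v *s Q" "- v"] by simp
  qed
  also have "\<dots> = [:- v, 1:] ^ m * pcompose g [:- v, 1:]"
  proof -
    have pow: "pcompose ([:0, 1:] ^ n) r = r ^ n" for n and r :: "complex poly"
      by (induction n) (simp_all add: pcompose_mult pcompose_pCons pcompose_1 del: mult_pCons_left)
    have "monom 1 m = ([:0, 1:] :: complex poly) ^ m" by (simp add: monom_altdef)
    then show ?thesis unfolding g by (simp only: pcompose_mult pow)
  qed
  finally have eq: "P x y = [:- v, 1:] ^ m * pcompose g [:- v, 1:]" .
  have gv: "poly (pcompose g [:- v, 1:]) v \<noteq> 0" using g0 by (simp add: poly_pcompose)
  have "P x y \<noteq> 0" using coeff_P[of x y e] c_top[of x y] lead_nonzero[OF x] by auto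
  then have "order v (P x y) = order v ([:- v, 1:] ^ m) + order v (pcompose g [:- v, 1:])"
    unfolding eq by (rule order_mult)
  then show ?thesis using gv by (simp add: order_power_n_n order_0I)
qed

text \<open>Relates the line through \<open>a *s p + q\<close>, for large \<open>a\<close>, to the
  line through \<open>p + u *s q\<close> with \<open>u = 1 / a\<close>.\<close>

lemma proots_P_scale:
  assumes "a \<noteq> 0" and x: "x \<in> U"
  shows "proots (P x (a *s y)) = image_mset (\<lambda>\<alpha>. a * \<alpha>) (proots (P x y))"
proof -
  define L where "L = f x Q"
  have L: "L \<noteq> 0" using lead_nonzero[OF x] by (simp add: L_def)
  have lead: "lead_coeff (P x z) = L" for z using degree_P[OF x] by (simp add: coeff_P c_top L_def)
  have sz: "size (proots (P x y)) = e" using degree_P[OF x] by (simp add: size_proots_complex)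
  have "P x (a *s y) = smult L (\<Prod>\<alpha>\<in>#proots (P x y). [:- (a * \<alpha>), 1:])"
  proof (rule poly_ext)
    fix t
    have "a *s y + t *s Q = a *s (y + (t / a) *s Q)" using assms(1) by (simp add: vec_eq_iff algebra_simps)
    then have "poly (P x (a *s y)) t = a ^ e * poly (P x y) (t / a)"
      by (simp only: poly_P bihom_scaleY[OF bihom_f])
    also have "poly (P x y) (t / a) = L * (\<Prod>\<alpha>\<in>#proots (P x y). t / a - \<alpha>)"
    proof -
      have "poly (P x y) (t / a) = poly (smult (lead_coeff (P x y)) (\<Prod>\<alpha>\<in>#proots (P x y). [:- \<alpha>, 1:])) (t / a)"
        by (simp only: complex_poly_decompose_multiset)
      then show ?thesis unfolding lead by (simp add: poly_prod_mset image_mset.compositionality o_def)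
    qed
    also have "a ^ e * (L * (\<Prod>\<alpha>\<in>#proots (P x y). t / a - \<alpha>)) = L * (\<Prod>\<alpha>\<in>#proots (P x y). t - a * \<alpha>)"
    proof -
      have "a ^ size M * (\<Prod>\<alpha>\<in>#M. t / a - \<alpha>) = (\<Prod>\<alpha>\<in>#M. t - a * \<alpha>)" for M
        using assms(1) by (induction M) (simp_all add: field_simps)
      from this[of "proots (P x y)"] show ?thesis unfolding sz by (simp only: mult.left_commute)
    qed
    also have "\<dots> = poly (smult L (\<Prod>\<alpha>\<in>#proots (P x y). [:- (a * \<alpha>), 1:])) t"
      by (simp add: poly_prod_mset image_mset.compositionality o_def)
    finally show "poly (P x (a *s y)) t = poly (smult L (\<Prod>\<alpha>\<in>#proots (P x y). [:- (a * \<alpha>), 1:])) t" .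
  qed
  then show ?thesis using L by (simp add: proots_prod_linear)
qed

text \<open>For large \<open>v\<close> the point is projectively close to \<open>Q\<close>, and
  \<open>f x\<close> does not vanish near \<open>Q\<close>.\<close>

lemma zeros_bounded:
  assumes "x \<in> U"
  obtains M where "\<forall>u v. norm u \<le> 1 \<longrightarrow> f x (p + u *s q + v *s Q) = 0 \<longrightarrow> norm v \<le> M"
proof -
  have "open {z. f x (z + Q) \<noteq> 0}"
    by (intro open_Collect_neq bihom_continuous[OF bihom_f] continuous_intros)
  moreover have "0 \<in> {z. f x (z + Q) \<noteq> 0}" using lead_nonzero[OF assms] by simp
  ultimately obtain \<xi> where \<xi>: "\<xi> > 0" "\<And>z. dist z 0 < \<xi> \<Longrightarrow> f x (z + Q) \<noteq> 0"
    unfolding open_dist by blast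
  define C where "C = norm p + 3 * norm q"
  define M where "M = 3 * C / \<xi> + 1"
  have "C \<ge> 0" by (simp add: C_def)
  have "norm v \<le> M" if u: "norm u \<le> 1" and zero: "f x (p + u *s q + v *s Q) = 0" for u v
  proof (rule ccontr)
    assume "\<not> norm v \<le> M"
    then have v: "norm v > 3 * C / \<xi> + 1" by (simp add: M_def)
    have "3 * C / \<xi> \<ge> 0" using \<open>C \<ge> 0\<close> \<xi>(1) by simp
    then have v0: "v \<noteq> 0" "norm v > 0" using v by auto
    have "norm (u *s q) \<le> 1 * (3 * norm q)"
      using norm_vsmult[of u q] u by (meson mult_right_mono norm_ge_zero order_trans zero_le_mult_iff zero_le_numeral)
    then have "norm (p + u *s q) \<le> C" unfolding C_def by (intro norm_triangle_le) simp
    then have "norm ((1 / v) *s (p + u *s q)) \<le> norm (1 / v) * (3 * C)"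
      using norm_vsmult[of "1 / v" "p + u *s q"] by (smt (verit) mult_left_mono norm_ge_zero)
    also have "\<dots> = 3 * C / norm v" by (simp add: norm_divide)
    also have "\<dots> < \<xi>"
    proof -
      have "3 * C / \<xi> < norm v" using v by simp
      then have "3 * C < norm v * \<xi>" using \<xi>(1) by (simp add: pos_divide_less_eq)
      then show ?thesis using v0(2) by (simp add: pos_divide_less_eq mult.commute)
    qed
    finally have "f x ((1 / v) *s (p + u *s q) + Q) \<noteq> 0" by (intro \<xi>(2)) simp
    moreover have "v *s ((1 / v) *s (p + u *s q) + Q) = p + u *s q + v *s Q"
      using v0(1) by (simp add: vec_eq_iff field_simps)
    then have "v ^ e * f x ((1 / v) *s (p + u *s q) + Q) = 0"
      using zero by (simp only: bihom_scaleY[OF bihom_f, symmetric])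
    ultimately show False using v0(1) by simp
  qed
  then show thesis by (intro that) blast
qed

end

subsection \<open>Bezout's theorem and the multiplicity of the curves\<close>

lemma (in gridfree_family) P_nonzero: "x \<in> U \<Longrightarrow> P x y \<noteq> 0"
  using coeff_P[of x y e] c_top[of x y] lead_nonzero[of x] by auto

lemma isCont_pencil:
  assumes "isCont r z" shows "isCont (\<lambda>u. p + u *s q + r u *s (Q :: complex^3)) z"
  unfolding isCont_def
proof (rule vec_tendstoI)
  fix i
  have "((\<lambda>u. p $ i + u * q $ i + r u * Q $ i) \<longlongrightarrow> p $ i + z * q $ i + r z * Q $ i) (at z)"
    using assms unfolding isCont_def by (intro tendsto_intros)
  then show "((\<lambda>u. (p + u *s q + r u *s Q) $ i) \<longlongrightarrow> (p + z *s q + r z *s Q) $ i) (at z)" by simp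
qed

context min_multiplicity
begin

lemma regular_order:
  assumes "regular_point x (y + v *s Q)" shows "order v (P x y) = m"
  using assms m_le by (intro order_P) (auto simp: regular_point_def intro: minimal)

text \<open>Bezout's theorem for two curves of degree \<open>e\<close> meeting in \<open>p\<close> only: the product \<open>R a\<close> of the values of
  \<open>f x1\<close> at the zeros of \<open>f x0\<close> on the line through \<open>a p + q\<close> is entire without zeros, while the
  transversal crossing with multiplicity \<open>m\<close> in \<open>p\<close> makes it grow like \<open>a\<close> to the power \<open>e\<^sup>2 - m\<^sup>2\<close>.\<close>

lemma Bezout_contradiction:
  assumes pair: "transversal_pair x0 x1 p q" and "m < e"
  shows False
proof -
  obtain \<beta> \<eta> \<epsilon> r0 r1 where reg: "regular_point x0 p" "regular_point x1 p" and off: "\<forall>a. x1 \<noteq> a *s x0"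
    and q: "cdot (ccross p Q) q \<noteq> 0" and pos: "\<beta> > 0" "\<eta> > 0" "\<epsilon> > 0"
    and r01: "\<forall>u. norm u < \<eta> \<longrightarrow> f x0 (p + u *s q + r0 u *s Q) = 0 \<and> f x1 (p + u *s q + r1 u *s Q) = 0 \<and>
         \<beta> * norm u \<le> norm (r0 u - r1 u) \<and>
         (\<forall>v. norm v < \<epsilon> \<longrightarrow> f x0 (p + u *s q + v *s Q) = 0 \<longrightarrow> v = r0 u)"
    and cont: "isCont r0 0" "isCont r1 0" and r_0: "r0 0 = 0" "r1 0 = 0"
    using pair unfolding transversal_pair_def by (elim conjE exE) (rule that)
  have x: "x0 \<in> U" "x1 \<in> U" and p: "p \<noteq> 0" "f x0 p = 0" "f x1 p = 0"
    and cm: "c m x0 p \<noteq> 0" "c m x1 p \<noteq> 0" using reg by (auto simp: regular_point_def)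
  have common: False if "y \<noteq> 0" "\<And>a. y \<noteq> a *s p" "f x0 y = 0" "f x1 y = 0" for y
    by (rule grid[of x0 x1 p y]) (use x p off that in auto)
  \<comment> \<open>The resultant of the two curves on a line through \<open>Q\<close>. The points
    \<open>a *s p + q\<close> reach every line through \<open>Q\<close> except the one through
    \<open>p\<close>, which corresponds to \<open>a\<close> tending to infinity.\<close>
  define R where "R = (\<lambda>a. \<Prod>\<alpha>\<in>#proots (P x0 (a *s p + q)). poly (P x1 (a *s p + q)) \<alpha>)"
  have coeff_hol: "(\<lambda>a. coeff (P z (a *s p + q)) j) holomorphic_on UNIV" for z j
  proof (cases "j \<le> e")
    case True
    then show ?thesis unfolding coeff_P
      by (simp, intro bihom_holomorphic[OF bihom_c[OF True]]) (auto intro!: holomorphic_intros)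
  qed (simp add: coeff_P)
  have R_hol: "R holomorphic_on UNIV"
    unfolding R_def
  proof (rule root_product_holomorphic[where e = e and L = "f x0 Q" and n = e])
    show "degree (P x1 (a *s p + q)) \<le> e" for a using degree_P[OF x(2)] by simp
  qed (use x in \<open>simp_all add: degree_P coeff_P c_top lead_nonzero\<close>, use coeff_hol in \<open>simp_all add: coeff_P\<close>)
  \<comment> \<open>A zero would be a common point of the two curves off the line through
    \<open>p\<close> and \<open>Q\<close>, hence a second one.\<close>
  have R_nz: "R a \<noteq> 0" for a
  proof
    assume "R a = 0"
    then obtain \<alpha> where \<alpha>: "\<alpha> \<in># proots (P x0 (a *s p + q))" "poly (P x1 (a *s p + q)) \<alpha> = 0"
      unfolding R_def by (auto simp: prod_mset_zero_iff)
    have "poly (P x0 (a *s p + q)) \<alpha> = 0" using \<alpha>(1) P_nonzero[OF x(1)] by simp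
    define y where "y = a *s p + q + \<alpha> *s Q"
    have ky: "cdot (ccross p Q) y \<noteq> 0" using q by (simp add: y_def)
    show False
    proof (rule common[of y])
      show "y \<noteq> 0" "y \<noteq> b *s p" for b using ky by auto
      show "f x0 y = 0" "f x1 y = 0" using \<open>poly (P x0 _) \<alpha> = 0\<close> \<alpha>(2) by (simp_all add: poly_P y_def)
    qed
  qed
  obtain M where M: "\<forall>u v. norm u \<le> 1 \<longrightarrow> f x0 (p + u *s q + v *s Q) = 0 \<longrightarrow> norm v \<le> M"
    by (rule zeros_bounded[OF x(1), where p = p and q = q])
  \<comment> \<open>The part of the curve of \<open>x0\<close> near the line through
    \<open>p\<close> and \<open>Q\<close> but away from \<open>p\<close>; \<open>f x1\<close> does
    not vanish on it, hence is bounded below by compactness.\<close>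
  define Kset where "Kset = {z. norm (fst z) \<le> 1} \<inter> {z. norm (snd z) \<le> M} \<inter> {z. \<epsilon> \<le> norm (snd z)} \<inter>
      {z :: complex \<times> complex. f x0 (p + fst z *s q + snd z *s Q) = 0}"
  have "compact Kset"
  proof -
    have "closed Kset" unfolding Kset_def
      by (intro closed_Int closed_Collect_le closed_Collect_eq continuous_intros bihom_continuous[OF bihom_f])
    moreover have "Kset \<subseteq> cball 0 1 \<times> cball 0 M" by (auto simp: Kset_def)
    then have "bounded Kset" using bounded_Times[OF bounded_cball bounded_cball] bounded_subset by blast
    ultimately show ?thesis by (simp add: compact_eq_bounded_closed)
  qed
  have Knz: "f x1 (p + fst z *s q + snd z *s Q) \<noteq> 0" if "z \<in> Kset" for z
  proof
    assume zero: "f x1 (p + fst z *s q + snd z *s Q) = 0"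
    have z: "f x0 (p + fst z *s q + snd z *s Q) = 0" "snd z \<noteq> 0" using that pos by (auto simp: Kset_def)
    show False
      by (rule common[OF pencil_point_nonzero[OF q] _ z(1) zero]) (use pencil_point_eq_base[OF q] z(2) in blast)
  qed
  \<comment> \<open>With \<open>\<gamma> \<le> 1\<close> the power \<open>\<gamma> ^ e\<close> is a
    lower bound for any number of at most \<open>e\<close> factors.\<close>
  have "\<exists>\<gamma>>0. \<gamma> \<le> 1 \<and> (\<forall>z\<in>Kset. \<gamma> \<le> norm (f x1 (p + fst z *s q + snd z *s Q)))"
  proof (cases "Kset = {}")
    case True
    then show ?thesis by (intro exI[of _ 1]) simp
  next
    case False
    have "continuous_on Kset (\<lambda>z. norm (f x1 (p + fst z *s q + snd z *s Q)))"
      by (intro continuous_intros bihom_continuous[OF bihom_f])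
    then obtain z0 where z0: "z0 \<in> Kset" "\<forall>z\<in>Kset. norm (f x1 (p + fst z0 *s q + snd z0 *s Q)) \<le> norm (f x1 (p + fst z *s q + snd z *s Q))"
      using continuous_attains_inf[OF \<open>compact Kset\<close> False] by blast
    then show ?thesis
      using Knz[OF z0(1)] by (intro exI[of _ "min 1 (norm (f x1 (p + fst z0 *s q + snd z0 *s Q)))"]) (auto intro: min.coboundedI2)
  qed
  then obtain \<gamma> where \<gamma>: "\<gamma> > 0" "\<gamma> \<le> 1" "\<forall>z\<in>Kset. \<gamma> \<le> norm (f x1 (p + fst z *s q + snd z *s Q))"
    by blast
  define y1 where "y1 = (\<lambda>u. p + u *s q + r1 u *s Q)"
  \<comment> \<open>The Taylor expansion of \<open>f x1\<close> at its own zero \<open>y1 u\<close>,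
    divided by the power \<open>m\<close> of the distance \<open>r0 u - r1 u\<close>; the terms
    below \<open>m\<close> vanish by minimality.\<close>
  define S where "S = (\<lambda>u. \<Sum>j\<in>{m..e}. c j x1 (y1 u) * (r0 u - r1 u) ^ (j - m))"
  have y1_cont: "isCont y1 0"
    unfolding y1_def by (rule isCont_pencil[OF cont(2)])
  have S_cont: "isCont S 0"
    unfolding S_def using cont by (intro continuous_intros isCont_bihom[OF bihom_c y1_cont]) auto
  have S_0: "S 0 = c m x1 p"
  proof -
    have "S 0 = (\<Sum>j\<in>{m..e}. if j = m then c m x1 p else 0)"
      unfolding S_def by (intro sum.cong) (auto simp: r_0 y1_def)
    then show ?thesis using m_le by simp
  qed
  define s where "s = norm (c m x1 p) / 2"
  have s: "s > 0" using cm by (simp add: s_def)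
  have S_ev: "eventually (\<lambda>u. s < norm (S u)) (at 0)"
  proof -
    have "((\<lambda>u. norm (S u)) \<longlongrightarrow> norm (S 0)) (at 0)" using S_cont by (intro tendsto_norm) (simp add: isCont_def)
    then show ?thesis unfolding S_0 by (rule order_tendstoD(1)) (use s in \<open>simp add: s_def\<close>)
  qed
  have y0_ev: "eventually (\<lambda>u. c m x0 (p + u *s q + r0 u *s Q) \<noteq> 0) (at 0)"
  proof -
    have "isCont (\<lambda>u. p + u *s q + r0 u *s Q) 0"
      by (rule isCont_pencil[OF cont(1)])
    then have "isCont (\<lambda>u. c m x0 (p + u *s q + r0 u *s Q)) 0" by (rule isCont_bihom[OF bihom_c[OF m_le(2)]])
    then show ?thesis unfolding isCont_def by (rule tendsto_imp_eventually_ne) (simp add: r_0 cm)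
  qed
  have small_ev: "eventually (\<lambda>u. dist u 0 < min \<eta> 1) (at (0::complex))"
    unfolding eventually_at using pos by (intro exI[of _ "min \<eta> 1"]) auto
  have "eventually (\<lambda>u. s < norm (S u) \<and> c m x0 (p + u *s q + r0 u *s Q) \<noteq> 0 \<and> norm u < min \<eta> 1) (at 0)"
    using S_ev y0_ev small_ev by eventually_elim auto
  then obtain \<eta>1 where \<eta>1: "\<eta>1 > 0" "\<And>u. u \<noteq> 0 \<Longrightarrow> norm u < \<eta>1 \<Longrightarrow>
      s < norm (S u) \<and> c m x0 (p + u *s q + r0 u *s Q) \<noteq> 0 \<and> norm u < min \<eta> 1"
    unfolding eventually_at by auto
  define C where "C = (s * \<beta> ^ m) ^ m * \<gamma> ^ e"
  have C: "C > 0" using s pos \<gamma>(1) by (simp add: C_def)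
  \<comment> \<open>The root \<open>r0 u\<close> occurs \<open>m\<close> times and contributes at
    least \<open>s * \<beta> ^ m * norm u ^ m\<close> each time; the other roots lie in
    \<open>Kset\<close> and contribute at least \<open>\<gamma>\<close>.\<close>
  have small: "C * norm u ^ (m * m) \<le> norm (\<Prod>\<alpha>\<in>#proots (P x0 (p + u *s q)). f x1 (p + u *s q + \<alpha> *s Q))"
    if u: "u \<noteq> 0" "norm u < \<eta>1" for u
  proof -
    have u': "s < norm (S u)" "c m x0 (p + u *s q + r0 u *s Q) \<noteq> 0" "norm u < \<eta>" "norm u \<le> 1"
      using \<eta>1(2)[OF u] by auto
    define t where "t = r0 u - r1 u"
    have zero: "f x0 (p + u *s q + r0 u *s Q) = 0" "f x1 (y1 u) = 0" "\<beta> * norm u \<le> norm t"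
      and uniq: "\<And>v. norm v < \<epsilon> \<Longrightarrow> f x0 (p + u *s q + v *s Q) = 0 \<Longrightarrow> v = r0 u"
      using r01 u'(3) by (auto simp: y1_def t_def)
    have val: "f x1 (p + u *s q + r0 u *s Q) = t ^ m * S u"
    proof -
      have "p + u *s q + r0 u *s Q = y1 u + t *s Q" by (simp add: y1_def t_def vec_eq_iff algebra_simps)
      then have "f x1 (p + u *s q + r0 u *s Q) = (\<Sum>j\<le>e. c j x1 (y1 u) * t ^ j)" by (simp only: Taylor)
      also have "\<dots> = (\<Sum>j\<in>{m..e}. c j x1 (y1 u) * t ^ j)"
      proof (rule sum.mono_neutral_right)
        have "c j x1 (y1 u) = 0" if "j < m" for j
          using minimal[OF x(2) _ zero(2) that] pencil_point_nonzero[OF q] by (simp add: y1_def)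
        then show "\<forall>j\<in>{..e} - {m..e}. c j x1 (y1 u) * t ^ j = 0" by auto
      qed auto
      also have "\<dots> = (\<Sum>j\<in>{m..e}. t ^ m * (c j x1 (y1 u) * t ^ (j - m)))"
        by (intro sum.cong) (auto simp flip: power_add)
      finally show ?thesis by (simp only: S_def t_def sum_distrib_left)
    qed
    have val_lower: "s * \<beta> ^ m * norm u ^ m \<le> norm (f x1 (p + u *s q + r0 u *s Q))"
    proof -
      have "(\<beta> * norm u) ^ m \<le> norm t ^ m" using zero(3) pos by (intro power_mono) auto
      then have "(\<beta> * norm u) ^ m * s \<le> norm t ^ m * norm (S u)" using u'(1) s by (intro mult_mono) auto
      then show ?thesis unfolding val norm_mult norm_power by (simp add: power_mult_distrib mult_ac)
    qed
    define D where "D = proots (P x0 (p + u *s q))"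
    have reg_u: "regular_point x0 (p + u *s q + r0 u *s Q)"
      using x(1) pencil_point_nonzero[OF q] zero(1) u'(2) by (simp add: regular_point_def)
    have P_nz: "P x0 (p + u *s q) \<noteq> 0" by (rule P_nonzero[OF x(1)])
    have "count D (r0 u) = m" using regular_order[OF reg_u] P_nz by (simp add: D_def)
    then have D: "D = replicate_mset m (r0 u) + {#\<alpha> \<in># D. \<alpha> \<noteq> r0 u#}"
      using multiset_partition[of D "\<lambda>\<alpha>. \<alpha> = r0 u"] by (simp add: filter_eq_replicate_mset)
    define D' where "D' = {#\<alpha> \<in># D. \<alpha> \<noteq> r0 u#}"
    let ?g = "\<lambda>\<alpha>. f x1 (p + u *s q + \<alpha> *s Q)"
    have "size D' \<le> e"
      using size_filter_mset_lesseq[of _ D] by (simp add: D'_def D_def size_proots_complex degree_P x)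
    have "\<gamma> \<le> norm (?g \<alpha>)" if "\<alpha> \<in># D'" for \<alpha>
    proof -
      have \<alpha>: "\<alpha> \<noteq> r0 u" "poly (P x0 (p + u *s q)) \<alpha> = 0" using that P_nz by (auto simp: D'_def D_def)
      have f0: "f x0 (p + u *s q + \<alpha> *s Q) = 0" using \<alpha>(2) by (simp add: poly_P)
      then have "(u, \<alpha>) \<in> Kset" using uniq[of \<alpha>] \<alpha>(1) M u'(4) by (force simp: Kset_def)
      then show ?thesis using bspec[OF \<gamma>(3)] by force
    qed
    then have "\<gamma> ^ size D' \<le> norm (\<Prod>\<alpha>\<in>#D'. ?g \<alpha>)" using \<gamma>(1) by (intro prod_mset_lower_bound) auto
    moreover have "\<gamma> ^ e \<le> \<gamma> ^ size D'" using \<gamma> \<open>size D' \<le> e\<close> by (intro power_decreasing) auto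
    ultimately have others: "\<gamma> ^ e \<le> norm (\<Prod>\<alpha>\<in>#D'. ?g \<alpha>)" by linarith
    have "(\<Prod>\<alpha>\<in>#D. ?g \<alpha>) = ?g (r0 u) ^ m * (\<Prod>\<alpha>\<in>#D'. ?g \<alpha>)"
      by (subst D) (simp add: D'_def)
    then have "norm (\<Prod>\<alpha>\<in>#D. ?g \<alpha>) = norm (?g (r0 u)) ^ m * norm (\<Prod>\<alpha>\<in>#D'. ?g \<alpha>)"
      by (simp add: norm_mult norm_power)
    moreover have "(s * \<beta> ^ m * norm u ^ m) ^ m * \<gamma> ^ e \<le> norm (?g (r0 u)) ^ m * norm (\<Prod>\<alpha>\<in>#D'. ?g \<alpha>)"
      using val_lower others s pos \<gamma>(1) by (intro mult_mono power_mono) auto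
    moreover have "C * norm u ^ (m * m) = (s * \<beta> ^ m * norm u ^ m) ^ m * \<gamma> ^ e"
      by (simp add: C_def power_mult_distrib power_mult)
    ultimately show ?thesis by (simp only: D_def)
  qed
  \<comment> \<open>In scaled coordinates each of the \<open>e\<close> roots contributes a factor
    \<open>a ^ e\<close>, so \<open>R a\<close> grows at least like the power
    \<open>e * e - m * m \<ge> 1\<close> of \<open>a\<close>.\<close>
  have grow: "C * norm a \<le> norm (R a)" if a: "norm a > max 1 (1 / \<eta>1)" for a
  proof -
    define u where "u = 1 / a"
    have a0: "a \<noteq> 0" "norm a > 1" "norm a > 0" using a by auto
    have u: "u \<noteq> 0" "norm u < \<eta>1"
      using a a0 \<eta>1(1) by (auto simp: u_def norm_divide field_simps)
    have pt: "a *s p + q = a *s (p + u *s q)" using a0 by (simp add: u_def vec_eq_iff field_simps)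
    have sz: "size (proots (P x0 (p + u *s q))) = e" by (simp add: size_proots_complex degree_P x)
    have "R a = (\<Prod>\<alpha>\<in>#proots (P x0 (p + u *s q)). a ^ e * f x1 (p + u *s q + \<alpha> *s Q))"
    proof -
      have "poly (P x1 (a *s (p + u *s q))) (a * \<alpha>) = a ^ e * f x1 (p + u *s q + \<alpha> *s Q)" for \<alpha>
      proof -
        have "a *s (p + u *s q) + (a * \<alpha>) *s Q = a *s (p + u *s q + \<alpha> *s Q)" by (simp add: vec_eq_iff algebra_simps)
        then show ?thesis by (simp only: poly_P bihom_scaleY[OF bihom_f])
      qed
      then show ?thesis
        unfolding R_def pt proots_P_scale[OF a0(1) x(1)] by (simp add: image_mset.compositionality o_def)
    qed
    also have "\<dots> = a ^ (e * e) * (\<Prod>\<alpha>\<in>#proots (P x0 (p + u *s q)). f x1 (p + u *s q + \<alpha> *s Q))"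
    proof -
      have "(\<Prod>\<alpha>\<in>#N. a ^ e * h \<alpha>) = a ^ (e * size N) * (\<Prod>\<alpha>\<in>#N. h \<alpha>)" for N and h :: "complex \<Rightarrow> complex"
        by (induction N) (simp_all add: power_add mult_ac)
      then show ?thesis by (simp only: sz)
    qed
    finally have "norm (R a) = norm a ^ (e * e) * norm (\<Prod>\<alpha>\<in>#proots (P x0 (p + u *s q)). f x1 (p + u *s q + \<alpha> *s Q))"
      by (simp add: norm_mult norm_power)
    also have "\<dots> \<ge> norm a ^ (e * e) * (C * norm u ^ (m * m))" by (intro mult_left_mono small u) auto
    finally have 1: "norm a ^ (e * e) * (C * norm u ^ (m * m)) \<le> norm (R a)" .
    have le: "m * m + 1 \<le> e * e"
    proof -
      have "m * m < e * e" using \<open>m < e\<close> m_le by (intro mult_strict_mono) auto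
      then show ?thesis by simp
    qed
    have "C * norm a = C * norm a ^ (m * m + 1) * norm u ^ (m * m)"
      using a0 by (simp add: u_def norm_divide power_divide)
    also have "\<dots> \<le> C * norm a ^ (e * e) * norm u ^ (m * m)"
      using a0 C le by (intro mult_right_mono mult_left_mono power_increasing) auto
    finally show ?thesis using 1 by (simp add: mult_ac)
  qed
  have "eventually (\<lambda>a. B \<le> norm (R a)) at_infinity" for B
    unfolding eventually_at_infinity
  proof (intro exI allI impI)
    fix a assume a: "max (max 1 (1 / \<eta>1) + 1) (B / C) \<le> norm (a :: complex)"
    then have "B / C \<le> norm a" "norm a > max 1 (1 / \<eta>1)" by auto
    then have "B \<le> C * norm a" "C * norm a \<le> norm (R a)" using C grow by (auto simp: field_simps)
    then show "B \<le> norm (R a)" by linarith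
  qed
  \<comment> \<open>Liouville: the reciprocal would otherwise be entire and tend to 0 at
    infinity.\<close>
  then obtain z where "R z = 0" using Liouville_weak_inverse[OF R_hol] by metis
  then show False using R_nz by blast
qed

end

lemma (in gridfree_family) zeros_of_full_multiplicity:
  assumes "x \<in> U" "y \<noteq> 0" "f x y = 0" "j < e"
  shows "c j x y = 0"
proof (rule ccontr)
  assume nz: "c j x y \<noteq> 0"
  \<comment> \<open>Its least element is the smallest multiplicity of a zero over all of
    \<open>U\<close>; it is positive because \<open>c 0\<close> is \<open>f\<close>.\<close>
  define S where "S = {i. \<exists>x y. x \<in> U \<and> y \<noteq> 0 \<and> f x y = 0 \<and> c i x y \<noteq> 0}"
  define m where "m = (LEAST i. i \<in> S)"
  have "j \<in> S" using assms nz by (auto simp: S_def)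
  then have "m \<in> S" "m \<le> j" unfolding m_def by (rule LeastI, rule Least_le)
  have "m < e" using \<open>m \<le> j\<close> assms(4) by simp
  obtain x0 p where x0: "x0 \<in> U" "p \<noteq> 0" "f x0 p = 0" "c m x0 p \<noteq> 0" using \<open>m \<in> S\<close> by (auto simp: S_def)
  have "m > 0" using x0 c_0 by (cases m) auto
  have minimal: "c i x y = 0" if "x \<in> U" "y \<noteq> 0" "f x y = 0" "i < m" for x y i
    using not_less_Least[of i "\<lambda>i. i \<in> S"] that unfolding m_def S_def by blast
  have "m - 1 \<le> e" using \<open>m < e\<close> by simp
  from bihom_difference_factors[OF bihom_c[OF this]] obtain A B where AB: "difference_factors (c (m - 1)) A B"
    by blast
  interpret min_multiplicity d e f U Q c m A B
    by unfold_locales (use \<open>m > 0\<close> \<open>m < e\<close> minimal AB in auto)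
  have "regular_point x0 p" using x0 by (simp add: regular_point_def)
  then obtain x' y' w where *: "regular_point x' y'" "slope A B w 0 (x', y', x', y') \<noteq> 0"
    by (rule exists_moving_point)
  then obtain x1 q where "transversal_pair x' x1 y' q" using exists_transversal_pair by blast
  then show False using Bezout_contradiction \<open>m < e\<close> by blast
qed

subsection \<open>Polynomial functions on three-space\<close>

text \<open>Iterated univariate polynomials form a factorial ring; prime factors are used to lower
  the degree of the coefficient triples.\<close>

type_synonym poly3 = "complex poly poly poly"

definition ev :: "poly3 \<Rightarrow> complex^3 \<Rightarrow> complex" where
  "ev p x = poly (poly (poly p [:[:x $ 1:]:]) [:x $ 2:]) (x $ 3)"

lemma ev_simps [simp]:
  "ev 0 x = 0" "ev 1 x = 1" "ev (p + q) x = ev p x + ev q x" "ev (p - q) x = ev p x - ev q x" "ev (p * q) x = ev p x * ev q x"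
  by (simp_all add: ev_def)

lemma poly_const_all_0:
  fixes q :: "'a::{idom, ring_char_0} poly poly"
  assumes "\<And>b. poly q [:b:] = 0" shows "q = 0"
proof (rule ccontr)
  assume "q \<noteq> 0"
  then have "finite {r. poly q r = 0}" by (rule poly_roots_finite)
  moreover have "range (\<lambda>b. [:b:]) \<subseteq> {r. poly q r = 0}" using assms by auto
  ultimately have "finite (range (\<lambda>b::'a. [:b:]))" by (rule rev_finite_subset)
  then have "finite (UNIV :: 'a set)" by (rule finite_imageD) (simp add: inj_def)
  then show False using infinite_UNIV_char_0 by blast
qed

lemma ev_eq_0_imp:
  assumes "\<And>x. ev p x = 0" shows "p = 0"
proof -
  have "poly (poly (poly p [:[:a:]:]) [:b:]) c = 0" for a b c
    using assms[of "vector [a, b, c]"] by (simp add: ev_def)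
  then have "poly (poly p [:[:a:]:]) [:b:] = 0" for a b by (intro iffD1[OF poly_all_0_iff_0] allI)
  then have "poly p [:[:a:]:] = 0" for a by (rule poly_const_all_0)
  show ?thesis
  proof (rule ccontr)
    assume "p \<noteq> 0"
    then have "finite {r. poly p r = 0}" by (rule poly_roots_finite)
    moreover have "range (\<lambda>a. [:[:a:]:]) \<subseteq> {r. poly p r = 0}" using \<open>\<And>a. poly p [:[:a:]:] = 0\<close> by auto
    ultimately have "finite (range (\<lambda>a::complex. [:[:a:]:]))" by (rule rev_finite_subset)
    then have "finite (UNIV :: complex set)" by (rule finite_imageD) (simp add: inj_def)
    then show False using infinite_UNIV_char_0 by blast
  qed
qed

lemma ev_inject: "(\<And>x. ev p x = ev q x) \<Longrightarrow> p = q"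
  using ev_eq_0_imp[of "p - q"] by simp

definition polyfun :: "(complex^3 \<Rightarrow> complex) \<Rightarrow> bool" where
  "polyfun \<phi> \<longleftrightarrow> (\<exists>p. \<forall>x. \<phi> x = ev p x)"

lemma polyfun_mult: "polyfun \<phi> \<Longrightarrow> polyfun \<theta> \<Longrightarrow> polyfun (\<lambda>x. \<phi> x * \<theta> x)"
  unfolding polyfun_def by (elim exE) (rule_tac x = "p * pa" in exI, simp)

lemma polyfun_diff: "polyfun \<phi> \<Longrightarrow> polyfun \<theta> \<Longrightarrow> polyfun (\<lambda>x. \<phi> x - \<theta> x)"
  unfolding polyfun_def by (elim exE) (rule_tac x = "p - pa" in exI, simp)

text \<open>The density argument used below: an identity that holds wherever \<open>\<theta>\<close>
  is nonzero holds everywhere, as the polynomials form an integral domain.\<close>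

lemma polyfun_mult_eq_0:
  assumes "polyfun \<phi>" "polyfun \<theta>" "\<And>x. \<phi> x * \<theta> x = 0" "\<theta> x0 \<noteq> 0"
  shows "\<phi> x = 0"
proof -
  obtain p q where p: "\<And>x. \<phi> x = ev p x" and q: "\<And>x. \<theta> x = ev q x" using assms unfolding polyfun_def by blast
  have "p * q = 0" using assms(3) by (intro ev_eq_0_imp) (simp add: p q)
  moreover have "q \<noteq> 0" using assms(4) q by auto
  ultimately show ?thesis using p by simp
qed

lemma polyfun_const: "polyfun (\<lambda>x. c)"
  unfolding polyfun_def by (intro exI[of _ "[:[:[:c:]:]:]"]) (simp add: ev_def)

lemma polyfun_coord: "polyfun (\<lambda>x. x $ i)"
proof -
  consider "i = 1" | "i = 2" | "i = 3" using exhaust_3 by blast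
  then show ?thesis
  proof cases
    case 1
    then show ?thesis unfolding polyfun_def by (intro exI[of _ "[:0, 1:]"]) (simp add: ev_def)
  next
    case 2
    then show ?thesis unfolding polyfun_def by (intro exI[of _ "[:[:0, 1:]:]"]) (simp add: ev_def)
  next
    case 3
    then show ?thesis unfolding polyfun_def by (intro exI[of _ "[:[:[:0, 1:]:]:]"]) (simp add: ev_def)
  qed
qed

lemma polyfun_bihom: "bihom d e f \<Longrightarrow> polyfun (\<lambda>x. f x y)"
proof (induction rule: bihom.induct)
  case (add d e f g)
  then obtain p q where "\<forall>x. f x y = ev p x" "\<forall>x. g x y = ev q x" unfolding polyfun_def by blast
  then show ?case unfolding polyfun_def by (intro exI[of _ "p + q"]) simp
qed (simp_all add: polyfun_const polyfun_coord polyfun_mult)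

text \<open>Decomposition into homogeneous components, with a dummy second argument for
  \<open>bihom\<close>. Requiring the components above \<open>n\<close> to vanish lets
  \<open>n\<close> be enlarged and coefficients of any index be compared.\<close>

definition hom_parts :: "(complex^3 \<Rightarrow> complex) \<Rightarrow> nat \<Rightarrow> (nat \<Rightarrow> complex^3 \<Rightarrow> complex) \<Rightarrow> bool" where
  "hom_parts \<phi> n h \<longleftrightarrow> (\<forall>k. bihom k 0 (\<lambda>x y. h k x)) \<and> (\<forall>k>n. \<forall>x. h k x = 0) \<and> (\<forall>x. \<phi> x = (\<Sum>k\<le>n. h k x))"

lemma hom_parts_mono:
  assumes "hom_parts \<phi> n h" "n \<le> n'" shows "hom_parts \<phi> n' h"
proof -
  have "(\<Sum>k\<le>n. h k x) = (\<Sum>k\<le>n'. h k x)" for x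
    using assms unfolding hom_parts_def by (intro sum.mono_neutral_left) auto
  then show ?thesis using assms unfolding hom_parts_def by auto
qed

lemma hom_parts_const: "hom_parts (\<lambda>x. c) 0 (\<lambda>k x. if k = 0 then c else 0)"
proof -
  have "bihom k 0 (\<lambda>x y. if k = 0 then c else 0)" for k
    by (cases "k = 0") (simp_all add: bihom.const bihom.zero)
  then show ?thesis by (simp add: hom_parts_def)
qed

lemma hom_parts_const_exist: "\<exists>n h. hom_parts (\<lambda>x. c) n h"
  by (intro exI, rule hom_parts_const)

lemma hom_parts_add:
  assumes "hom_parts \<phi> n h" "hom_parts \<theta> m g"
  shows "hom_parts (\<lambda>x. \<phi> x + \<theta> x) (max n m) (\<lambda>k x. h k x + g k x)"
  using hom_parts_mono[OF assms(1), of "max n m"] hom_parts_mono[OF assms(2), of "max n m"]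
  unfolding hom_parts_def by (simp add: sum.distrib bihom.add)

lemma hom_parts_mult_coord:
  assumes "hom_parts \<phi> n h"
  shows "hom_parts (\<lambda>x. x $ i * \<phi> x) (Suc n) (\<lambda>k x. case k of 0 \<Rightarrow> 0 | Suc k' \<Rightarrow> x $ i * h k' x)"
  unfolding hom_parts_def
proof (intro conjI allI impI)
  show "bihom k 0 (\<lambda>x y. case k of 0 \<Rightarrow> 0 | Suc k' \<Rightarrow> x $ i * h k' x)" for k
    using assms by (cases k) (simp_all add: hom_parts_def bihom.zero bihom.multX)
  show "(case k of 0 \<Rightarrow> 0 | Suc k' \<Rightarrow> x $ i * h k' x) = 0" if "Suc n < k" for k x
    using assms that by (cases k) (simp_all add: hom_parts_def)
  show "x $ i * \<phi> x = (\<Sum>k\<le>Suc n. case k of 0 \<Rightarrow> 0 | Suc k' \<Rightarrow> x $ i * h k' x)" for x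
    using assms by (subst sum.atMost_Suc_shift) (simp add: hom_parts_def sum_distrib_left)
qed

lemma hom_parts_horner:
  assumes "\<exists>n h. hom_parts \<phi> n h" "\<exists>n h. hom_parts \<theta> n h"
  shows "\<exists>n h. hom_parts (\<lambda>x. \<phi> x + x $ i * \<theta> x) n h"
proof -
  obtain n h m g where "hom_parts \<phi> n h" and 2: "hom_parts \<theta> m g" using assms by (elim exE)
  then have "hom_parts (\<lambda>x. \<phi> x + x $ i * \<theta> x) (max n (Suc m))
      (\<lambda>k x. h k x + (case k of 0 \<Rightarrow> 0 | Suc k' \<Rightarrow> x $ i * g k' x))"
    by (intro hom_parts_add hom_parts_mult_coord)
  then show ?thesis by (intro exI)
qed

lemma hom_parts_exist: "\<exists>n h. hom_parts (ev p) n h"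
proof -
  have 3: "\<exists>n h. hom_parts (\<lambda>x. poly p (x $ 3)) n h" for p :: "complex poly"
  proof (induction p)
    case 0
    show ?case using hom_parts_const_exist[of 0] by simp
  next
    case (pCons a p)
    show ?case using hom_parts_horner[OF hom_parts_const_exist[of a] pCons.IH, of 3] by simp
  qed
  have 2: "\<exists>n h. hom_parts (\<lambda>x. poly (poly p [:x $ 2:]) (x $ 3)) n h" for p :: "complex poly poly"
  proof (induction p)
    case 0
    show ?case using 3[of 0] by simp
  next
    case (pCons a p)
    show ?case using hom_parts_horner[OF 3[of a] pCons.IH, of 2] by simp
  qed
  have "\<exists>n h. hom_parts (\<lambda>x. poly (poly (poly p [:[:x $ 1:]:]) [:x $ 2:]) (x $ 3)) n h"
  proof (induction p)
    case 0
    show ?case using 2[of 0] by simp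
  next
    case (pCons a p)
    show ?case using hom_parts_horner[OF 2[of a] pCons.IH, of 1] by simp
  qed
  then show ?thesis by (simp add: ev_def[abs_def])
qed

text \<open>On the line through 0 and \<open>z\<close> the components become the coefficients of a
  univariate polynomial.\<close>

lemma hom_parts_line:
  assumes "hom_parts \<phi> n h"
  shows "\<phi> (t *s z) = poly (\<Sum>k\<le>n. monom (h k z) k) t"
proof -
  have "h k (t *s z) = t ^ k * h k z" for k
    using bihom_scaleX[of k 0 "\<lambda>x y. h k x"] assms by (simp add: hom_parts_def)
  then show ?thesis using assms by (simp add: hom_parts_def poly_sum poly_monom mult.commute)
qed

text \<open>The variable is prime, so it can be split off from one of the factors until a constant
  remains.\<close>

lemma monom_factor:
  fixes p q :: "complex poly"
  assumes "p * q = monom a k" "a \<noteq> 0"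
  shows "\<exists>b i. b \<noteq> 0 \<and> i \<le> k \<and> q = monom b i \<and> p = monom (a / b) (k - i)"
  using assms
proof (induction k arbitrary: p q)
  case 0
  have nz: "p \<noteq> 0" "q \<noteq> 0" using 0 by auto
  have "degree p + degree q = 0" using degree_mult_eq[OF nz] 0 by (simp add: monom_0)
  then obtain b b' where b: "p = [:b':]" "q = [:b:]" by (metis add_is_0 degree_eq_zeroE)
  then have "b' * b = a" "b \<noteq> 0" using 0 by (auto simp: monom_0)
  then show ?case using b by (intro exI[of _ b] exI[of _ 0]) (auto simp: monom_0)
next
  case (Suc k)
  have "coeff p 0 * coeff q 0 = 0"
    using arg_cong[OF Suc.prems(1), of "\<lambda>r. coeff r 0"] by (simp add: coeff_mult)
  then consider "coeff p 0 = 0" | "coeff q 0 = 0" by auto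
  then show ?case
  proof cases
    case 1
    then obtain p' where p': "p = pCons 0 p'" by (cases p) auto
    then have "p' * q = monom a k" using Suc.prems by (simp add: monom_Suc)
    then obtain b i where *: "b \<noteq> 0" "i \<le> k" "q = monom b i" "p' = monom (a / b) (k - i)"
      using Suc.IH Suc.prems(2) by blast
    then show ?thesis using p' by (intro exI[of _ b] exI[of _ i]) (simp add: Suc_diff_le monom_Suc)
  next
    case 2
    then obtain q' where q': "q = pCons 0 q'" by (cases q) auto
    then have "p * q' = monom a k" using Suc.prems by (simp add: monom_Suc)
    then obtain b i where *: "b \<noteq> 0" "i \<le> k" "q' = monom b i" "p = monom (a / b) (k - i)"
      using Suc.IH Suc.prems(2) by blast
    then show ?thesis using q' by (intro exI[of _ b] exI[of _ "Suc i"]) (simp add: monom_Suc)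
  qed
qed

lemma prime_factor_through_zero:
  assumes "p \<noteq> 0" "ev p x = 0"
  obtains g where "prime_elem g" "g dvd p" "ev g x = 0"
proof -
  have prod_zero: "\<exists>g\<in>#M. ev g x = 0" if "ev (prod_mset M) x = 0" for M :: "poly3 multiset"
    using that by (induction M) auto
  from prime_factorization_exists[OF assms(1)]
  obtain M where M: "\<forall>g. g \<in># M \<longrightarrow> prime_elem g" "normalize (prod_mset M) = normalize p"
    by (elim exE conjE)
  have "p dvd prod_mset M" using M(2) by (metis associatedD1 dvd_refl)
  then have "ev (prod_mset M) x = 0" using assms(2) by (auto elim!: dvdE)
  then obtain g where g: "g \<in># M" "ev g x = 0" using prod_zero by blast
  have "g dvd prod_mset M" using g(1) by (rule dvd_prod_mset)
  moreover have "prod_mset M dvd p" using M(2) by (metis associatedD2 dvd_refl)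
  ultimately have "g dvd p" by (rule dvd_trans)
  then show thesis using that M(1) g by blast
qed

lemma bihom_0_independent: "bihom d e f \<Longrightarrow> e = 0 \<Longrightarrow> f x y = f x 0"
  by (induction rule: bihom.induct) simp_all

lemma bihom_linear_coefficients:
  assumes "bihom d e f" "e = 1"
  shows "\<exists>h. (\<forall>i. bihom d 0 (\<lambda>x y. h i x)) \<and> (\<forall>x y. f x y = (\<Sum>i\<in>UNIV. h i x * y $ i))"
  using assms
proof (induction rule: bihom.induct)
  case (zero d e)
  show ?case by (intro exI[of _ "\<lambda>_ _. 0"]) (simp add: bihom.zero)
next
  case (add d e f g)
  from add.IH(1)[OF add.prems] obtain h where
    "\<forall>i. bihom d 0 (\<lambda>x y. h i x)" "\<forall>x y. f x y = (\<Sum>i\<in>UNIV. h i x * y $ i)" by (elim exE conjE)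
  moreover from add.IH(2)[OF add.prems] obtain h' where
    "\<forall>i. bihom d 0 (\<lambda>x y. h' i x)" "\<forall>x y. g x y = (\<Sum>i\<in>UNIV. h' i x * y $ i)" by (elim exE conjE)
  ultimately show ?case
    by (intro exI[of _ "\<lambda>i x. h i x + h' i x"]) (simp add: bihom.add sum.distrib distrib_right)
next
  case (multX d e f i)
  from multX.IH[OF multX.prems] obtain h where
    "\<forall>i. bihom d 0 (\<lambda>x y. h i x)" "\<forall>x y. f x y = (\<Sum>i\<in>UNIV. h i x * y $ i)" by (elim exE conjE)
  then show ?case
    by (intro exI[of _ "\<lambda>j x. x $ i * h j x"]) (simp add: bihom.multX sum_distrib_left mult.assoc)
next
  case (multY d e f i)
  then have e: "e = 0" by simp
  have indep: "f x y = f x 0" for x y by (rule bihom_0_independent[OF multY.hyps e])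
  have f_eq: "f = (\<lambda>x y. f x 0)" by (intro ext) (rule indep)
  have "bihom d 0 f" using multY.hyps e by simp
  then have "bihom d 0 (\<lambda>x y. f x 0)" by (subst (asm) f_eq)
  then have "bihom d 0 (\<lambda>x y. if j = i then f x 0 else 0)" for j
    by (cases "j = i") (simp_all add: bihom.zero)
  then have "\<forall>j. bihom d 0 (\<lambda>x y. if j = i then f x 0 else 0)" by blast
  moreover have "\<forall>x y. y $ i * f x y = (\<Sum>j\<in>UNIV. (if j = i then f x 0 else 0) * y $ j)"
  proof (intro allI)
    fix x y
    have "(\<Sum>j\<in>UNIV. (if j = i then f x 0 else 0) * y $ j) = (\<Sum>j\<in>UNIV. if j = i then f x 0 * y $ i else 0)"
      by (intro sum.cong) auto
    then show "y $ i * f x y = (\<Sum>j\<in>UNIV. (if j = i then f x 0 else 0) * y $ j)"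
      by (simp add: indep[of x y])
  qed
  ultimately show ?case by (intro exI conjI)
qed simp

subsection \<open>Equations of the lines\<close>

lemma bihom_root_exists:
  assumes "bihom d e f" "f x Q \<noteq> 0" "e \<ge> 1"
  shows "\<exists>v. f x (y + v *s Q) = 0"
proof -
  obtain c where c: "\<And>x y. c e x y = f x Q" "\<And>x y t. f x (y + t *s Q) = (\<Sum>j\<le>e. c j x y * t ^ j)"
    using bihom_Taylor[OF assms(1)] by metis
  define p where "p = (\<Sum>j\<le>e. monom (c j x y) j)"
  have "coeff p e \<noteq> 0" using assms(2) by (simp add: p_def coeff_sum c(1))
  then have "degree p \<noteq> 0" using le_degree[of p e] assms(3) by auto
  then obtain v where "poly p v = 0" using fundamental_theorem_of_algebra[of p] by (auto simp: constant_degree)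
  then have "f x (y + v *s Q) = 0" by (simp add: c(2) p_def poly_sum poly_monom)
  then show ?thesis by blast
qed

lemma ccross_swap: "ccross u v = - ccross v u"
  by (simp add: ccross_def vec_eq_iff forall_3)

text \<open>The vector with entries \<open>b $ j\<close> at \<open>i\<close> and
  \<open>- b $ i\<close> at \<open>j\<close> lies in the first kernel; on the second form it gives
  the minor.\<close>

lemma equal_kernels_parallel:
  assumes "\<And>z. cdot b z = 0 \<longleftrightarrow> cdot b' z = 0"
  shows "b' $ i * b $ j = b' $ j * b $ i"
proof -
  have "cdot b (b $ j *s axis i 1 - b $ i *s axis j 1) = 0" by simp
  then have "cdot b' (b $ j *s axis i 1 - b $ i *s axis j 1) = 0" using assms by blast
  then show ?thesis by (simp add: mult.commute)
qed

lemma polyfun_bihom_0: "bihom k 0 (\<lambda>x y. \<phi> x) \<Longrightarrow> polyfun \<phi>"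
  using polyfun_bihom[of k 0 "\<lambda>x y. \<phi> x" 0] by simp

text \<open>Here \<open>U\<close> plays the role of the cone over all of \<open>X\<close>, without a
  fixed centre. \<open>Zariski_nbhd\<close> is used to extend polynomial identities from
  \<open>U\<close> to the whole space.\<close>

locale gridfree_hypersurface =
  fixes d e :: nat and f :: "complex^3 \<Rightarrow> complex^3 \<Rightarrow> complex" and U :: "(complex^3) set"
  assumes bihom_f: "bihom d e f" and e_pos: "e \<ge> 1"
    and open_U: "open U" and zero_notin_U: "0 \<notin> U" and U_nonempty: "U \<noteq> {}"
    and Zariski_nbhd: "x \<in> U \<Longrightarrow> \<exists>h. polyfun h \<and> h x \<noteq> 0 \<and> (\<forall>z. z \<noteq> 0 \<longrightarrow> h z \<noteq> 0 \<longrightarrow> z \<in> U)"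
    and grid: "x \<in> U \<Longrightarrow> x' \<in> U \<Longrightarrow> y \<noteq> 0 \<Longrightarrow> y' \<noteq> 0 \<Longrightarrow> (\<And>a. x' \<noteq> a *s x) \<Longrightarrow> (\<And>a. y' \<noteq> a *s y) \<Longrightarrow>
      f x y = 0 \<Longrightarrow> f x y' = 0 \<Longrightarrow> f x' y = 0 \<Longrightarrow> f x' y' = 0 \<Longrightarrow> False"
begin

text \<open>Otherwise any two points of a neighbouring curve would complete a grid. That curve might
  be the whole plane as well; if not, its points are found on two different lines through a point
  off it.\<close>

lemma curve_not_plane:
  assumes x: "x \<in> U" shows "\<exists>Q. f x Q \<noteq> 0"
proof (rule ccontr)
  assume "\<not> ?thesis"
  then have zero: "f x y = 0" for y by blast
  have "x \<noteq> 0" using x zero_notin_U by blast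
  then obtain w where w: "\<forall>\<epsilon> a. \<epsilon> \<noteq> 0 \<longrightarrow> x + \<epsilon> *s w \<noteq> a *s x" by (rule exists_nonparallel)
  obtain r where r: "r > 0" "\<forall>z. dist z x < r \<longrightarrow> z \<in> U" using open_U x unfolding open_dist by blast
  obtain \<epsilon> where \<epsilon>: "\<epsilon> > 0" "\<forall>v. norm v < \<epsilon> \<longrightarrow> norm (v *s w) < r" by (rule small_multiples[OF r(1), where q = w])
  define x' where "x' = x + complex_of_real (\<epsilon> / 2) *s w"
  have "norm (complex_of_real (\<epsilon> / 2)) < \<epsilon>" using \<epsilon>(1) by simp
  then have "norm (complex_of_real (\<epsilon> / 2) *s w) < r" using \<epsilon>(2) by blast
  then have x': "x' \<in> U" using r(2) by (simp add: x'_def dist_norm)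
  have off: "x' \<noteq> a *s x" for a using w \<epsilon>(1) by (simp add: x'_def)
  have "\<exists>y y'. y \<noteq> 0 \<and> y' \<noteq> 0 \<and> (\<forall>a. y' \<noteq> a *s y) \<and> f x' y = 0 \<and> f x' y' = 0"
  proof (cases "\<forall>y. f x' y = 0")
    case True
    have "axis 2 1 \<noteq> a *s (axis 1 1 :: complex^3)" for a
    proof
      assume "axis 2 1 = a *s (axis 1 1 :: complex^3)"
      then have "(axis 2 1 :: complex^3) $ 2 = (a *s (axis 1 1 :: complex^3)) $ 2" by (rule arg_cong)
      then show False by (simp add: axis_def)
    qed
    then show ?thesis using True by (intro exI[of _ "axis 1 1"] exI[of _ "axis 2 1"]) (simp add: axis_eq_0_iff)
  next
    case False
    then obtain Q where Q: "f x' Q \<noteq> 0" by blast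
    have "Q \<noteq> 0" using Q bihom_scaleY[OF bihom_f, of x' 0 Q] e_pos by (auto simp: power_0_left)
    then obtain p where p: "\<forall>\<epsilon> a. \<epsilon> \<noteq> 0 \<longrightarrow> Q + \<epsilon> *s p \<noteq> a *s Q" by (rule exists_nonparallel)
    have "ccross Q p \<noteq> 0"
    proof
      assume "ccross Q p = 0"
      then obtain a where "p = a *s Q" by (rule ccross_eq_0_imp[OF _ \<open>Q \<noteq> 0\<close>])
      then have "Q + 1 *s p = (1 + a) *s Q" by (simp add: vec_eq_iff algebra_simps)
      then show False using p one_neq_zero by blast
    qed
    then have "ccross p Q \<noteq> 0" using ccross_swap[of p Q] by simp
    then obtain q where q: "cdot (ccross p Q) q \<noteq> 0" by (rule exists_cdot_nonzero)
    obtain v where v: "f x' (p + 0 *s q + v *s Q) = 0" using bihom_root_exists[OF bihom_f Q e_pos] by blast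
    obtain v' where v': "f x' (p + 1 *s q + v' *s Q) = 0" using bihom_root_exists[OF bihom_f Q e_pos] by blast
    have "\<forall>a. p + 1 *s q + v' *s Q \<noteq> a *s (p + 0 *s q + v *s Q)"
      using pencil_points_distinct[OF q one_neq_zero] by blast
    then show ?thesis using v v' pencil_point_nonzero[OF q] by blast
  qed
  then obtain y y' where "y \<noteq> 0" "y' \<noteq> 0" "\<forall>a. y' \<noteq> a *s y" "f x' y = 0" "f x' y' = 0" by blast
  then show False using grid[OF x x', of y y'] off zero by blast
qed

text \<open>Where \<open>f x Q \<noteq> 0\<close> the curve is a line with multiplicity \<open>e\<close>, so the coefficient of \<open>t\<close> to the power \<open>e - 1\<close> in
  \<open>f x (z + t Q)\<close> is an equation of this line.\<close>

lemma line_equation: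
  obtains b where "bihom d 1 b"
    "\<forall>x z. x \<in> U \<longrightarrow> f x Q \<noteq> 0 \<longrightarrow> b x Q \<noteq> 0 \<and> (f x z = 0 \<longleftrightarrow> b x z = 0)"
proof -
  obtain c where c: "\<And>j. j \<le> e \<Longrightarrow> bihom d (e - j) (c j)" "\<And>x y. c e x y = f x Q"
    "\<And>x y t. f x (y + t *s Q) = (\<Sum>j\<le>e. c j x y * t ^ j)"
    using bihom_Taylor[OF bihom_f] by metis
  have "open (U \<inter> {x. f x Q \<noteq> 0})"
    by (intro open_Int open_U open_Collect_neq bihom_continuous[OF bihom_f] continuous_intros)
  then interpret G: gridfree_family d e f "U \<inter> {x. f x Q \<noteq> 0}" Q c
  proof unfold_locales
    fix x x' y y' :: "complex^3"
    assume *: "x \<in> U \<inter> {x. f x Q \<noteq> 0}" "x' \<in> U \<inter> {x. f x Q \<noteq> 0}" "y \<noteq> 0" "y' \<noteq> 0"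
      "\<And>a. x' \<noteq> a *s x" "\<And>a. y' \<noteq> a *s y" "f x y = 0" "f x y' = 0" "f x' y = 0" "f x' y' = 0"
    show False by (rule grid[OF IntD1[OF *(1)] IntD1[OF *(2)] *(3-10)])
  qed (use c bihom_f zero_notin_U in auto)
  have key: "f x z = 0 \<longleftrightarrow> c (e - 1) x z = 0" if x: "x \<in> U" "f x Q \<noteq> 0" for x z
  proof -
    obtain v where v: "f x (z + v *s Q) = 0" using bihom_root_exists[OF bihom_f x(2) e_pos] by blast
    \<comment> \<open>At a zero of multiplicity \<open>e\<close> only the top Taylor coefficient
      survives.\<close>
    have full: "f x (z + v *s Q + t *s Q) = f x Q * t ^ e" for t
    proof (cases "z + v *s Q = 0")
      case True
      then show ?thesis using bihom_scaleY[OF bihom_f, of x t Q] by (simp add: mult.commute)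
    next
      case False
      have "f x (z + v *s Q + t *s Q) = (\<Sum>j\<le>e. c j x (z + v *s Q) * t ^ j)" by (rule c(3))
      also have "\<dots> = (\<Sum>j\<le>e. if j = e then f x Q * t ^ e else 0)"
      proof (rule sum.cong)
        fix j assume "j \<in> {..e}"
        then show "c j x (z + v *s Q) * t ^ j = (if j = e then f x Q * t ^ e else 0)"
          using G.zeros_of_full_multiplicity[of x "z + v *s Q" j] x v False c(2) by auto
      qed simp
      finally show ?thesis by simp
    qed
    have "G.P x z = smult (f x Q) ([:- v, 1:] ^ e)"
    proof (rule poly_ext)
      fix t
      have "z + t *s Q = z + v *s Q + (t - v) *s Q" by (simp add: vec_eq_iff algebra_simps)
      then have "f x (z + t *s Q) = f x Q * (t - v) ^ e" using full[of "t - v"] by (simp only:)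
      then show "poly (G.P x z) t = poly (smult (f x Q) ([:- v, 1:] ^ e)) t"
        by (simp add: G.poly_P poly_power)
    qed
    then have coeffs: "coeff (G.P x z) j = f x Q * coeff ([:- v, 1:] ^ e) j" for j by simp
    \<comment> \<open>The coefficients of index \<open>e - 1\<close> and 0 in the
      \<open>e\<close>-th power of \<open>t - v\<close> are \<open>- e * v\<close> and
      \<open>(- v) ^ e\<close>, which vanish for the same \<open>v\<close>, namely 0.\<close>
    have "e choose (e - 1) = e" "e - (e - 1) = 1" using e_pos by (cases e; simp)+
    then have "coeff ([:- v, 1:] ^ e) (e - 1) = of_nat e * (- v)"
      by (simp only: coeff_linear_poly_power power_one mult_1_right power_one_right)
    then have "c (e - 1) x z = f x Q * (of_nat e * (- v))"
      using coeffs[of "e - 1"] by (simp add: G.coeff_P)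
    moreover have "f x z = f x Q * (- v) ^ e"
      using coeffs[of 0] by (simp add: G.coeff_P G.c_0 coeff_linear_poly_power)
    ultimately show ?thesis using x(2) e_pos by simp
  qed
  show thesis
  proof (rule that)
    show "bihom d 1 (c (e - 1))" using c(1)[of "e - 1"] e_pos by simp
    show "\<forall>x z. x \<in> U \<longrightarrow> f x Q \<noteq> 0 \<longrightarrow> c (e - 1) x Q \<noteq> 0 \<and> (f x z = 0 \<longleftrightarrow> c (e - 1) x z = 0)"
      using key by blast
  qed
qed

text \<open>The coefficients may all vanish where \<open>f x Q = 0\<close>, so one line form need
  not serve all of \<open>U\<close>.\<close>

definition line_form :: "complex^3 \<Rightarrow> (3 \<Rightarrow> complex^3 \<Rightarrow> complex) \<Rightarrow> bool" where
  "line_form Q \<beta> \<longleftrightarrow> (\<forall>i. bihom d 0 (\<lambda>x y. \<beta> i x)) \<and>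
     (\<forall>x. x \<in> U \<longrightarrow> f x Q \<noteq> 0 \<longrightarrow> (\<exists>i. \<beta> i x \<noteq> 0) \<and> (\<forall>z. f x z = 0 \<longleftrightarrow> (\<Sum>i\<in>UNIV. \<beta> i x * z $ i) = 0))"

lemma line_formD:
  assumes "line_form Q \<beta>"
  shows "bihom d 0 (\<lambda>x y. \<beta> i x)" "x \<in> U \<Longrightarrow> f x Q \<noteq> 0 \<Longrightarrow> \<exists>i. \<beta> i x \<noteq> 0"
    "x \<in> U \<Longrightarrow> f x Q \<noteq> 0 \<Longrightarrow> f x z = 0 \<longleftrightarrow> cdot (\<chi> i. \<beta> i x) z = 0"
proof -
  note * = assms[unfolded line_form_def]
  show "bihom d 0 (\<lambda>x y. \<beta> i x)" by (rule *[THEN conjunct1, rule_format])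
  show "\<exists>i. \<beta> i x \<noteq> 0" if "x \<in> U" "f x Q \<noteq> 0"
    by (rule *[THEN conjunct2, rule_format, OF that, THEN conjunct1])
  show "f x z = 0 \<longleftrightarrow> cdot (\<chi> i. \<beta> i x) z = 0" if "x \<in> U" "f x Q \<noteq> 0"
    using *[THEN conjunct2, rule_format, OF that, THEN conjunct2, rule_format, of z] by (simp add: cdot_def)
qed

lemma line_form_exists: "\<exists>\<beta>. line_form Q \<beta>"
proof -
  obtain b where b: "bihom d 1 b"
    "\<forall>x z. x \<in> U \<longrightarrow> f x Q \<noteq> 0 \<longrightarrow> b x Q \<noteq> 0 \<and> (f x z = 0 \<longleftrightarrow> b x z = 0)" by (rule line_equation)
  from bihom_linear_coefficients[OF b(1) refl] obtain \<beta> where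
    \<beta>: "\<forall>i. bihom d 0 (\<lambda>x y. \<beta> i x)" "\<forall>x y. b x y = (\<Sum>i\<in>UNIV. \<beta> i x * y $ i)" by (elim exE conjE)
  have "line_form Q \<beta>" unfolding line_form_def
  proof (intro conjI allI impI)
    fix x assume x: "x \<in> U" "f x Q \<noteq> 0"
    show "\<exists>i. \<beta> i x \<noteq> 0"
    proof (rule ccontr)
      assume "\<not> ?thesis"
      then have "b x Q = 0" using \<beta>(2) by simp
      then show False using b(2) x by blast
    qed
    show "f x z = 0 \<longleftrightarrow> (\<Sum>i\<in>UNIV. \<beta> i x * z $ i) = 0" for z using b(2) x \<beta>(2) by metis
  qed (use \<beta>(1) in blast)
  then show ?thesis by blast
qed

lemma line_forms_parallel:
  assumes lf: "line_form Q \<beta>" "line_form Q' \<beta>'" and x1: "x1 \<in> U" "f x1 Q \<noteq> 0" and x2: "x2 \<in> U" "f x2 Q' \<noteq> 0"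
  shows "\<beta>' i x * \<beta> j x = \<beta>' j x * \<beta> i x"
proof -
  obtain h where h: "polyfun h" "h x1 \<noteq> 0" "\<forall>z. z \<noteq> 0 \<longrightarrow> h z \<noteq> 0 \<longrightarrow> z \<in> U" using Zariski_nbhd[OF x1(1)] by blast
  define \<phi> where "\<phi> = (\<lambda>x. \<beta>' i x * \<beta> j x - \<beta>' j x * \<beta> i x)"
  have pf: "polyfun (\<beta> i)" "polyfun (\<beta>' i)" for i
    by (rule polyfun_bihom[OF line_formD(1)[OF lf(1)]], rule polyfun_bihom[OF line_formD(1)[OF lf(2)]])
  have pf\<phi>: "polyfun \<phi>" unfolding \<phi>_def by (intro polyfun_diff polyfun_mult pf)
  have pfQ: "polyfun (\<lambda>x. f x Q)" "polyfun (\<lambda>x. f x Q')" using polyfun_bihom[OF bihom_f] by blast+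
  \<comment> \<open>The factors confine the claim to points where both forms describe the curve:
    \<open>h\<close> forces \<open>x\<close> into \<open>U\<close> once \<open>x $ 1\<close>
    excludes the origin. They are then cancelled one by one by
    \<open>polyfun_mult_eq_0\<close>.\<close>
  have all: "\<phi> x * x $ 1 * f x Q * f x Q' * h x = 0" for x
  proof (rule ccontr)
    assume "\<not> ?thesis"
    then have nz: "\<phi> x \<noteq> 0" "x $ 1 \<noteq> 0" "f x Q \<noteq> 0" "f x Q' \<noteq> 0" "h x \<noteq> 0" by auto
    then have "x \<noteq> 0" by auto
    then have x: "x \<in> U" using h(3) nz(5) by blast
    define b b' where "b = (\<chi> i. \<beta> i x)" and "b' = (\<chi> i. \<beta>' i x)"
    have "cdot b z = 0 \<longleftrightarrow> cdot b' z = 0" for z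
      unfolding b_def b'_def line_formD(3)[OF lf(1) x nz(3), symmetric] line_formD(3)[OF lf(2) x nz(4), symmetric] ..
    then have "b' $ i * b $ j = b' $ j * b $ i" by (rule equal_kernels_parallel)
    then show False using nz(1) by (simp add: \<phi>_def b_def b'_def)
  qed
  have 1: "\<phi> x * x $ 1 * f x Q * f x Q' = 0" for x
    by (rule polyfun_mult_eq_0[OF _ h(1) all h(2)]) (intro polyfun_mult pf\<phi> pfQ polyfun_coord)
  have 2: "\<phi> x * x $ 1 * f x Q = 0" for x
    by (rule polyfun_mult_eq_0[OF _ pfQ(2) 1 x2(2)]) (intro polyfun_mult pf\<phi> pfQ polyfun_coord)
  have 3: "\<phi> x * x $ 1 = 0" for x
    by (rule polyfun_mult_eq_0[OF _ pfQ(1) 2 x1(2)]) (intro polyfun_mult pf\<phi> pfQ polyfun_coord)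
  have "(axis 1 1 :: complex^3) $ 1 \<noteq> 0" by simp
  have "\<phi> x = 0"
    by (rule polyfun_mult_eq_0[OF pf\<phi> polyfun_coord[of 1] 3 \<open>axis 1 1 $ 1 \<noteq> 0\<close>])
  then show ?thesis by (simp add: \<phi>_def)
qed

end

section \<open>Gluing the line equations\<close>

lemma parallel_equal_kernels:
  assumes par: "\<And>i j. b $ i * b' $ j = b $ j * b' $ i" and nz: "b $ l \<noteq> 0" "b' $ i \<noteq> 0"
  shows "cdot b z = 0 \<longleftrightarrow> cdot b' z = 0"
proof -
  have "b $ i * b' $ l \<noteq> 0" using par[of i l] nz by simp
  have "b' $ l * cdot b z = b $ l * cdot b' z"
    unfolding cdot_def sum_distrib_left
  proof (rule sum.cong)
    fix j
    show "b' $ l * (b $ j * z $ j) = b $ l * (b' $ j * z $ j)"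
      using arg_cong[OF par[of j l], of "\<lambda>a. a * z $ j"] by (simp add: mult_ac)
  qed simp
  moreover have "b' $ l \<noteq> 0" using \<open>b $ i * b' $ l \<noteq> 0\<close> by simp
  ultimately show ?thesis using nz(1) by (metis mult_eq_0_iff)
qed

context gridfree_hypersurface
begin

text \<open>Another homogeneous representative, possibly of lower degree, of the rational map to the
  dual plane given by \<open>\<beta>\<close>.\<close>

definition parallel_triple :: "(3 \<Rightarrow> complex^3 \<Rightarrow> complex) \<Rightarrow> nat \<Rightarrow> (3 \<Rightarrow> complex^3 \<Rightarrow> complex) \<Rightarrow> bool" where
  "parallel_triple \<beta> k B \<longleftrightarrow> (\<forall>i. bihom k 0 (\<lambda>x y. B i x)) \<and> (\<exists>i x. B i x \<noteq> 0) \<and>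
     (\<forall>i j x. \<beta> i x * B j x = \<beta> j x * B i x)"

lemma parallel_tripleD:
  assumes "parallel_triple \<beta> k B"
  shows "bihom k 0 (\<lambda>x y. B i x)" "\<exists>i x. B i x \<noteq> 0" "\<beta> i x * B j x = \<beta> j x * B i x"
  using assms unfolding parallel_triple_def by blast+

text \<open>Both triples are parallel to \<open>\<beta>0\<close>; transitivity holds after
  cancelling a coordinate of \<open>\<beta>0\<close> that is not identically 0.\<close>

lemma parallel_triple_line_form:
  assumes lf0: "line_form Q0 \<beta>0" "x0 \<in> U" "f x0 Q0 \<noteq> 0" and B: "parallel_triple \<beta>0 k B"
    and lf: "line_form Q \<beta>" and x1: "x1 \<in> U" and Q: "f x1 Q \<noteq> 0"
  shows "\<beta> i x * B j x = \<beta> j x * B i x"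
proof -
  obtain l z0 where l: "\<beta>0 l z0 \<noteq> 0" using line_formD(2)[OF lf0] by blast
  have pf0: "polyfun (\<beta>0 i)" for i by (rule polyfun_bihom_0[OF line_formD(1)[OF lf0(1)]])
  have pf: "polyfun (\<beta> i)" for i by (rule polyfun_bihom_0[OF line_formD(1)[OF lf]])
  have pfB: "polyfun (B i)" for i by (rule polyfun_bihom_0[OF parallel_tripleD(1)[OF B]])
  have zero: "(\<beta> i x * B j x - \<beta> j x * B i x) * \<beta>0 l x = 0" for x
  proof -
    have "\<beta> i x * B j x * \<beta>0 l x = \<beta> i x * (\<beta>0 j x * B l x)"
      using parallel_tripleD(3)[OF B, of l x j] by (simp add: mult_ac)
    also have "\<dots> = \<beta> j x * \<beta>0 i x * B l x"
      using line_forms_parallel[OF lf0(1) lf lf0(2,3) x1 Q, of i x j] by (simp add: mult_ac)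
    also have "\<dots> = \<beta> j x * (\<beta>0 l x * B i x)"
      using parallel_tripleD(3)[OF B, of l x i] by (simp add: mult_ac)
    finally show ?thesis by (simp add: algebra_simps)
  qed
  have "\<beta> i x * B j x - \<beta> j x * B i x = 0"
    by (rule polyfun_mult_eq_0[OF _ pf0[of l] zero l]) (intro polyfun_diff polyfun_mult pf pfB)
  then show ?thesis by simp
qed

text \<open>If \<open>B\<close> vanished at a point \<open>x1\<close> of \<open>U\<close>, compare it with a line form \<open>\<beta>\<close> that does not vanish there: since \<open>\<beta> i B j = \<beta> j B i\<close>,
  a prime factor through \<open>x1\<close> of one \<open>B i\<close> divides every \<open>B j\<close>. Dividing by it and taking a homogeneous part lowers the degree.\<close>

lemma minimal_triple_nonzero:
  assumes x1: "x1 \<in> U" and lf0: "line_form Q0 \<beta>0" "x0 \<in> U" "f x0 Q0 \<noteq> 0"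
    and B: "parallel_triple \<beta>0 k B" and min: "\<forall>k' B'. parallel_triple \<beta>0 k' B' \<longrightarrow> k \<le> k'"
  shows "\<exists>i. B i x1 \<noteq> 0"
proof (rule ccontr)
  assume "\<not> ?thesis"
  then have B_x1: "B i x1 = 0" for i by blast
  obtain Q where Q: "f x1 Q \<noteq> 0" using curve_not_plane[OF x1] by blast
  obtain \<beta> where lf: "line_form Q \<beta>" using line_form_exists by blast
  obtain i0 where i0: "\<beta> i0 x1 \<noteq> 0" using line_formD(2)[OF lf x1 Q] by blast
  have pf0: "polyfun (\<beta>0 i)" for i by (rule polyfun_bihom_0[OF line_formD(1)[OF lf0(1)]])
  have pf: "polyfun (\<beta> i)" for i by (rule polyfun_bihom_0[OF line_formD(1)[OF lf]])
  have pfB: "polyfun (B i)" for i by (rule polyfun_bihom_0[OF parallel_tripleD(1)[OF B]])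
  note rel = parallel_triple_line_form[OF lf0 B lf x1 Q]
  obtain pB where pB: "\<And>i x. B i x = ev (pB i) x" using pfB unfolding polyfun_def by metis
  obtain p\<beta> where p\<beta>: "\<And>i x. \<beta> i x = ev (p\<beta> i) x" using pf unfolding polyfun_def by metis
  obtain p0 where p0: "\<And>i x. \<beta>0 i x = ev (p0 i) x" using pf0 unfolding polyfun_def by metis
  have rel_p: "p\<beta> i * pB j = p\<beta> j * pB i" for i j
    by (rule ev_inject) (use rel in \<open>simp add: pB p\<beta>\<close>)
  have rel0_p: "p0 i * pB j = p0 j * pB i" for i j
    by (rule ev_inject) (use parallel_tripleD(3)[OF B] in \<open>simp add: pB p0\<close>)
  have "p\<beta> i0 \<noteq> 0" using i0 p\<beta>[of i0 x1] by auto
  have "pB i0 \<noteq> 0"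
  proof
    assume "pB i0 = 0"
    then have "pB j = 0" for j using rel_p[of i0 j] \<open>p\<beta> i0 \<noteq> 0\<close> by simp
    then show False using parallel_tripleD(2)[OF B] pB by simp
  qed
  moreover have "ev (pB i0) x1 = 0" using B_x1 pB by simp
  ultimately obtain g where g: "prime_elem g" "g dvd pB i0" "ev g x1 = 0" by (rule prime_factor_through_zero)
  \<comment> \<open>A divisor that vanishes at \<open>x1\<close> cannot divide a polynomial that
    does not.\<close>
  have "\<not> g dvd p\<beta> i0" using g(3) i0 p\<beta>[of i0 x1] by (auto elim!: dvdE)
  have "g dvd pB j" for j
  proof -
    have "g dvd p\<beta> i0 * pB j" unfolding rel_p[of i0 j] using g(2) by (rule dvd_mult)
    then show ?thesis using prime_elem_dvd_multD[OF g(1)] \<open>\<not> g dvd p\<beta> i0\<close> by blast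
  qed
  then have "\<forall>j. \<exists>r. pB j = g * r" by (auto simp: dvd_def)
  then obtain r where r: "\<And>j. pB j = g * r j" by metis
  have "g \<noteq> 0" using g(1) by auto
  have rel_r: "p0 i * r j = p0 j * r i" for i j
  proof -
    have "g * (p0 i * r j) = g * (p0 j * r i)" using rel0_p[of i j] unfolding r by (simp add: mult_ac)
    then show ?thesis using \<open>g \<noteq> 0\<close> by simp
  qed
  have "\<exists>nh. hom_parts (ev (r j)) (fst nh) (snd nh)" for j
  proof -
    from hom_parts_exist[of "r j"] obtain n h where "hom_parts (ev (r j)) n h" by (elim exE)
    then have "hom_parts (ev (r j)) (fst (n, h)) (snd (n, h))" by simp
    then show ?thesis by (rule exI)
  qed
  then have "\<exists>nh. \<forall>j. hom_parts (ev (r j)) (fst (nh j)) (snd (nh j))" by (intro choice allI)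
  then obtain nh where nh: "\<forall>j. hom_parts (ev (r j)) (fst (nh j)) (snd (nh j))" by (elim exE)
  define N h where "N = (\<lambda>j. fst (nh j))" and "h = (\<lambda>j. snd (nh j))"
  have Nh: "hom_parts (ev (r j)) (N j) (h j)" for j using nh by (simp add: N_def h_def)
  from hom_parts_exist[of g] obtain n hg where ng: "hom_parts (ev g) n hg" by (elim exE)
  \<comment> \<open>Compare coefficients on the line through 0 and \<open>x\<close>. Homogeneity of
    \<open>\<beta>0\<close> produces a factor \<open>t ^ d\<close>, cancelled as a polynomial
    because \<open>t\<close> may be 0.\<close>
  have parts_rel: "\<beta>0 i x * h j \<kappa> x = \<beta>0 j x * h i \<kappa> x" for i j \<kappa> x
  proof -
    define M where "M = max (N i) (N j)"
    have hi: "hom_parts (ev (r i)) M (h i)" and hj: "hom_parts (ev (r j)) M (h j)"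
      using hom_parts_mono[OF Nh] by (auto simp: M_def)
    have scale: "\<beta>0 i' (t *s x) = t ^ d * \<beta>0 i' x" for i' t
      using bihom_scaleX[OF line_formD(1)[OF lf0(1), of i']] by simp
    have "poly (smult (\<beta>0 i x) (\<Sum>k\<le>M. monom (h j k x) k) - smult (\<beta>0 j x) (\<Sum>k\<le>M. monom (h i k x) k)) t * t ^ d = 0" for t
    proof -
      have "\<beta>0 i (t *s x) * ev (r j) (t *s x) = \<beta>0 j (t *s x) * ev (r i) (t *s x)"
        using arg_cong[OF rel_r[of i j], of "\<lambda>p. ev p (t *s x)"] by (simp add: p0)
      then show ?thesis
        unfolding hom_parts_line[OF hi] hom_parts_line[OF hj] scale by (simp add: algebra_simps)
    qed
    then have "poly ((smult (\<beta>0 i x) (\<Sum>k\<le>M. monom (h j k x) k) - smult (\<beta>0 j x) (\<Sum>k\<le>M. monom (h i k x) k)) * monom 1 d) t = 0" for t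
      unfolding poly_mult poly_monom by simp
    then have "(smult (\<beta>0 i x) (\<Sum>k\<le>M. monom (h j k x) k) - smult (\<beta>0 j x) (\<Sum>k\<le>M. monom (h i k x) k)) * monom 1 d = 0"
      by (intro iffD1[OF poly_all_0_iff_0] allI)
    then have "smult (\<beta>0 i x) (\<Sum>k\<le>M. monom (h j k x) k) - smult (\<beta>0 j x) (\<Sum>k\<le>M. monom (h i k x) k) = 0"
      by simp
    then have "coeff (smult (\<beta>0 i x) (\<Sum>k\<le>M. monom (h j k x) k) - smult (\<beta>0 j x) (\<Sum>k\<le>M. monom (h i k x) k)) \<kappa> = 0"
      by simp
    then show ?thesis
      using hi hj by (cases "\<kappa> \<le> M") (simp_all add: coeff_sum hom_parts_def)
  qed
  \<comment> \<open>On the line through 0 and \<open>z\<close> the product of \<open>g\<close> and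
    \<open>r j\<close> is a monomial of degree \<open>k\<close>, so both are monomials. That of
    \<open>r j\<close> exhibits a parallel triple of degree \<open>\<kappa> \<le> k\<close>;
    minimality gives \<open>\<kappa> = k\<close>, so \<open>g\<close> is constant there.\<close>
  have g_const: "ev g z = ev g 0 \<and> ev g 0 \<noteq> 0" if z: "B j z \<noteq> 0" for j z
  proof -
    define G where "G = (\<Sum>k\<le>n. monom (hg k z) k)"
    define R where "R = (\<Sum>k\<le>N j. monom (h j k z) k)"
    have "G * R = monom (B j z) k"
    proof (rule poly_ext)
      fix t
      have "poly (G * R) t = ev g (t *s z) * ev (r j) (t *s z)"
        by (simp add: G_def R_def hom_parts_line[OF ng] hom_parts_line[OF Nh])
      also have "\<dots> = B j (t *s z)" by (simp add: pB r)
      also have "\<dots> = t ^ k * B j z" using bihom_scaleX[OF parallel_tripleD(1)[OF B, of j]] by simp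
      finally show "poly (G * R) t = poly (monom (B j z) k) t" by (simp add: poly_monom mult.commute)
    qed
    then obtain b \<kappa> where b: "b \<noteq> 0" "\<kappa> \<le> k" "R = monom b \<kappa>" "G = monom (B j z / b) (k - \<kappa>)"
      using monom_factor[OF _ z] by blast
    have "h j \<kappa> z \<noteq> 0"
    proof -
      have "coeff R \<kappa> \<noteq> 0" using b by simp
      then show ?thesis by (auto simp: R_def coeff_sum split: if_splits)
    qed
    moreover have "bihom \<kappa> 0 (\<lambda>x y. h i \<kappa> x)" for i using Nh[of i] by (simp add: hom_parts_def)
    ultimately have "parallel_triple \<beta>0 \<kappa> (\<lambda>i x. h i \<kappa> x)"
      unfolding parallel_triple_def using parts_rel by blast
    then have "k \<le> \<kappa>" using min by blast
    then have "G = [:B j z / b:]" using b by (simp add: monom_0)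
    then have "poly G t = B j z / b" for t by simp
    moreover have "poly G t = ev g (t *s z)" for t by (simp add: G_def hom_parts_line[OF ng])
    ultimately have "ev g (t *s z) = B j z / b" for t by metis
    from this[of 0] this[of 1] show ?thesis using z b(1) by simp
  qed
  obtain j z where z: "B j z \<noteq> 0" using parallel_tripleD(2)[OF B] by blast
  \<comment> \<open>Density extends the constancy of \<open>g\<close> to \<open>x1\<close>, where
    \<open>g\<close> vanishes.\<close>
  have "(ev g x - ev g 0) * B j x = 0" for x using g_const[of j x] by auto
  moreover have "polyfun (\<lambda>x. ev g x - ev g 0)" by (intro polyfun_diff polyfun_const) (auto simp: polyfun_def)
  ultimately have "ev g x1 - ev g 0 = 0" using polyfun_mult_eq_0[of "\<lambda>x. ev g x - ev g 0" "B j"] pfB z by blast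
  then show False using g(3) g_const[OF z] by simp
qed

text \<open>A parallel triple of least degree works at every point of \<open>U\<close>;
  \<open>\<beta>0\<close> itself shows that there are parallel triples.\<close>

lemma global_linear_equation:
  "\<exists>k b. bihom k 1 b \<and> (\<forall>x\<in>U. \<forall>z. f x z = 0 \<longleftrightarrow> b x z = 0)"
proof -
  obtain x0 where x0: "x0 \<in> U" using U_nonempty by blast
  obtain Q0 where Q0: "f x0 Q0 \<noteq> 0" using curve_not_plane[OF x0] by blast
  obtain \<beta>0 where lf0: "line_form Q0 \<beta>0" using line_form_exists by blast
  have "parallel_triple \<beta>0 d \<beta>0"
    unfolding parallel_triple_def using line_formD(1)[OF lf0] line_formD(2)[OF lf0 x0 Q0] mult.commute by blast
  then have "\<exists>k B. parallel_triple \<beta>0 k B" by blast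
  define k where "k = (LEAST k. \<exists>B. parallel_triple \<beta>0 k B)"
  obtain B where B: "parallel_triple \<beta>0 k B"
    using LeastI_ex[OF \<open>\<exists>k B. parallel_triple \<beta>0 k B\<close>] unfolding k_def by blast
  have min: "\<forall>k' B'. parallel_triple \<beta>0 k' B' \<longrightarrow> k \<le> k'"
    unfolding k_def by (auto intro: Least_le)
  define b where "b = (\<lambda>x z. \<Sum>i\<in>UNIV. z $ i * B i x)"
  have "bihom k 1 b"
    unfolding b_def using bihom.multY[OF parallel_tripleD(1)[OF B]] by (intro bihom_sum) simp
  moreover have "f x z = 0 \<longleftrightarrow> b x z = 0" if x: "x \<in> U" for x z
  proof -
    obtain i where i: "B i x \<noteq> 0" using minimal_triple_nonzero[OF x lf0 x0 Q0 B min] by blast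
    obtain Q where Q: "f x Q \<noteq> 0" using curve_not_plane[OF x] by blast
    obtain \<beta> where lf: "line_form Q \<beta>" using line_form_exists by blast
    obtain l where l: "\<beta> l x \<noteq> 0" using line_formD(2)[OF lf x Q] by blast
    have "f x z = 0 \<longleftrightarrow> cdot (\<chi> i. \<beta> i x) z = 0" by (rule line_formD(3)[OF lf x Q])
    also have "\<dots> \<longleftrightarrow> cdot (\<chi> i. B i x) z = 0"
      by (rule parallel_equal_kernels[of _ _ l i])
        (use l i parallel_triple_line_form[OF lf0 x0 Q0 B lf x Q] in \<open>simp_all add: mult.commute\<close>)
    also have "\<dots> \<longleftrightarrow> b x z = 0" by (simp add: cdot_def b_def mult.commute)
    finally show ?thesis .
  qed
  ultimately show ?thesis by blast
qed

end

section \<open>Translation to the projective statement\<close>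

lemma C_hom_bidegree: "F \<in> C_hom \<Longrightarrow> \<exists>d e. has_bidegree d e F"
  unfolding C_hom_def homogeneous_in_def has_bidegree_def by blast

lemma has_bidegree_C_hom: "has_bidegree d e F \<Longrightarrow> F \<in> C_hom"
  unfolding C_hom_def homogeneous_in_def has_bidegree_def by blast

lemma has_bidegree_degree_in: "has_bidegree d e F \<Longrightarrow> degree_in y_vars F \<le> e"
  unfolding degree_in_def has_bidegree_def by (intro Max.boundedI) auto

lemma bihom_poly_eval:
  fixes h :: "3 cpoly"
  assumes "homogeneous_in UNIV h"
  obtains D where "bihom D 0 (\<lambda>x y. poly_eval (\<lambda>i. x $ i) h)"
proof -
  obtain D where D: "\<forall>m\<in>Poly_Mapping.keys h. mon_degree_in UNIV m = D"
    using assms unfolding homogeneous_in_def by blast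
  have "bihom D 0 (\<lambda>x y. Poly_Mapping.lookup h m * (\<Prod>v\<in>UNIV. x $ v ^ Poly_Mapping.lookup m v))"
    if "m \<in> Poly_Mapping.keys h" for m
    using bihom_cmult[OF bihom_prodX[of UNIV "Poly_Mapping.lookup m"]] D that by (simp add: mon_degree_in_def)
  then have "bihom D 0 (\<lambda>x y. poly_eval (\<lambda>i. x $ i) h)"
    unfolding poly_eval_def by (rule bihom_sum)
  then show thesis by (rule that)
qed

theorem theorem4:
  fixes H :: "(p2 \<times> p2) set" and X :: "p2 set"
  assumes "hypersurface H"
    and "zariski_open X" and "X \<noteq> {}"
    and "grid_free 2 2 (H \<inter> (X \<times> UNIV))"
  shows "\<exists>F\<in>C_hom. degree_in y_vars F \<le> 2 \<and>
           H \<inter> (X \<times> UNIV) = zeros_p2p2 F \<inter> (X \<times> UNIV)"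
proof -
  obtain F0 where F0: "F0 \<in> C_hom" "H = zeros_p2p2 F0" using assms(1) unfolding hypersurface_def by blast
  obtain d e where de: "has_bidegree d e F0" using C_hom_bidegree[OF F0(1)] by blast
  show ?thesis
  \<comment> \<open>For small \<open>e\<close> the given equation already has the required degree.
    This also settles \<open>e = 0\<close>, so that \<open>e \<ge> 1\<close> is available for the
    geometric argument.\<close>
  proof (cases "e \<le> 2")
    case True
    then have "degree_in y_vars F0 \<le> 2" using has_bidegree_degree_in[OF de] by simp
    then show ?thesis using F0 by blast
  next
    case False
    define f where "f = eval_xy F0"
    have mem_H: "(proj v, proj w) \<in> H \<longleftrightarrow> f v w = 0" if "v \<noteq> 0" "w \<noteq> 0" for v w
      unfolding F0(2) f_def by (rule proj_in_zeros_p2p2_iff[OF F0(1) that])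
    obtain S where S: "\<And>h. h \<in> S \<Longrightarrow> homogeneous_in UNIV h" "- X = {p. \<forall>h\<in>S. p \<in> zeros_p2 h}"
      using assms(2) unfolding zariski_open_def zariski_closed_def by blast
    define U where "U = {v. v \<noteq> 0 \<and> proj v \<in> X}"
    have mem_X: "proj v \<in> X \<longleftrightarrow> (\<exists>h\<in>S. poly_eval (\<lambda>i. v $ i) h \<noteq> 0)" if "v \<noteq> 0" for v
    proof -
      have "proj v \<in> X \<longleftrightarrow> \<not> (\<forall>h\<in>S. proj v \<in> zeros_p2 h)" using S(2) by blast
      then show ?thesis using proj_in_zeros_p2_iff[OF S(1) that] by blast
    qed
    interpret gridfree_hypersurface d e f U
    proof
      show "bihom d e f" unfolding f_def by (rule bihom_eval_xy[OF de])
      show "e \<ge> 1" using False by simp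
      show "0 \<notin> U" by (simp add: U_def)
      obtain p where "p \<in> X" using assms(3) by blast
      then show "U \<noteq> {}" using p2_cases[of p] unfolding U_def by blast
      \<comment> \<open>As a union of complements of zero sets of polynomials, \<open>U\<close> is
        open in the usual topology too.\<close>
      have U_eq: "U = (\<Union>h\<in>S. {v. v \<noteq> 0} \<inter> {v. poly_eval (\<lambda>i. v $ i) h \<noteq> 0})"
        using mem_X by (auto simp: U_def)
      have open_h: "open ({v. v \<noteq> 0} \<inter> {v :: complex^3. poly_eval (\<lambda>i. v $ i) h \<noteq> 0})" if h: "h \<in> S" for h
      proof -
        obtain D where "bihom D 0 (\<lambda>x y. poly_eval (\<lambda>i. x $ i) h)" using bihom_poly_eval[OF S(1)[OF h]] .
        then have "continuous_on UNIV (\<lambda>v :: complex^3. poly_eval (\<lambda>i. v $ i) h)"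
          by (rule bihom_continuous[where g = "\<lambda>v. v" and h = "\<lambda>v. 0"]) (intro continuous_intros)+
        then show ?thesis by (intro open_Int open_Collect_neq continuous_intros)
      qed
      show "open U" unfolding U_eq by (intro open_UN ballI open_h)
      show "\<exists>h. polyfun h \<and> h x \<noteq> 0 \<and> (\<forall>z. z \<noteq> 0 \<longrightarrow> h z \<noteq> 0 \<longrightarrow> z \<in> U)" if x: "x \<in> U" for x
      proof -
        obtain h where h: "h \<in> S" "poly_eval (\<lambda>i. x $ i) h \<noteq> 0" using x mem_X by (auto simp: U_def)
        obtain D where D: "bihom D 0 (\<lambda>x y. poly_eval (\<lambda>i. x $ i) h)" using bihom_poly_eval[OF S(1)[OF h(1)]] .
        have "polyfun (\<lambda>x. poly_eval (\<lambda>i. x $ i) h)" by (rule polyfun_bihom[OF D])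
        moreover have "\<forall>z. z \<noteq> 0 \<longrightarrow> poly_eval (\<lambda>i. z $ i) h \<noteq> 0 \<longrightarrow> z \<in> U" using mem_X h(1) by (auto simp: U_def)
        ultimately show ?thesis using h(2) by blast
      qed
      show False if x: "x \<in> U" "x' \<in> U" and y: "y \<noteq> 0" "y' \<noteq> 0" and off: "\<And>a. x' \<noteq> a *s x" "\<And>a. y' \<noteq> a *s y"
        and zero: "f x y = 0" "f x y' = 0" "f x' y = 0" "f x' y' = 0" for x x' y y'
      proof -
        have nz: "x \<noteq> 0" "x' \<noteq> 0" and X: "proj x \<in> X" "proj x' \<in> X" using x by (auto simp: U_def)
        have "proj x \<noteq> proj x'" "proj y \<noteq> proj y'" using proj_eq_iff[OF nz] proj_eq_iff[OF y] off by auto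
        then have "card {proj x, proj x'} = 2" "card {proj y, proj y'} = 2" by auto
        moreover have "{proj x, proj x'} \<times> {proj y, proj y'} \<subseteq> H \<inter> (X \<times> UNIV)"
          using mem_H nz y zero X by auto
        ultimately have "contains_grid 2 2 (H \<inter> (X \<times> UNIV))"
          unfolding contains_grid_def by (metis finite.emptyI finite.insertI)
        then show False using assms(4) by blast
      qed
    qed
    obtain k b where b: "bihom k 1 b" "\<forall>x\<in>U. \<forall>z. f x z = 0 \<longleftrightarrow> b x z = 0" using global_linear_equation by blast
    obtain F where F: "has_bidegree k 1 F" "eval_xy F = b" using bihom_imp_poly[OF b(1)] by blast
    have F_hom: "F \<in> C_hom" by (rule has_bidegree_C_hom[OF F(1)])
    have "(p, q) \<in> H \<longleftrightarrow> (p, q) \<in> zeros_p2p2 F" if "p \<in> X" for p q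
    proof -
      obtain v where v: "v \<noteq> 0" "p = proj v" by (rule p2_cases)
      obtain w where w: "w \<noteq> 0" "q = proj w" by (rule p2_cases)
      have "v \<in> U" using v that by (simp add: U_def)
      then show ?thesis
        unfolding v(2) w(2) mem_H[OF v(1) w(1)] proj_in_zeros_p2p2_iff[OF F_hom v(1) w(1)] F(2) using b(2) by blast
    qed
    then have "H \<inter> (X \<times> UNIV) = zeros_p2p2 F \<inter> (X \<times> UNIV)" by auto
    moreover have "degree_in y_vars F \<le> 2" using has_bidegree_degree_in[OF F(1)] by simp
    ultimately show ?thesis using F_hom by blast
  qed
qed

end
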